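(* Let $\mathcal{H}$ be a complex separable Hilbert space and $X\subset\mathbb{R}^d$ a relatively separated set. For every $s>d$, the Jaffard algebra $(\mathcal{J}_s,|\|\cdot\||_{\mathcal{J}_s})$ is inverse-closed in $\mathcal{B}(\ell^2(X;\mathcal{H}))$. In particular, $(\mathcal{J}_s,|\|\cdot\||_{\mathcal{J}_s})$ is a symmetric Banach algebra whenever $s>d$.
   Context: $|\cdot|$ is the Euclidean norm on $\mathbb{R}^d$. A countable set $X\subset\mathbb{R}^d$ is relatively separated if $\sup_{x\in\mathbb{R}^d}|X\cap(x+[0,1]^d)|<\infty$ (cardinality). $\ell^2(X;\mathcal{H})$ is the Hilbert space of families $(f_k)_{k\in X}$ in $\mathcal{H}$ with $\sum_k\|f_k\|^2<\infty$. $\mathcal{J}_s=\mathcal{J}_s(X)$ is the space of matrices $A=[A_{k,l}]_{k,l\in X}$ with entries in $\mathcal{B}(\mathcal{H})$ such that $$\|A\|_{\mathcal{J}_s}=\sup_{k,l\in X}\|A_{k,l}\|(1+|k-l|)^s<\infty .$$ For $s>d$ it is closed under matrix multiplication $[AB]_{k,l}=\sum_nA_{k,n}B_{n,l}$ and under the involution $[A^*]_{k,l}=(A_{l,k})^*$, contains the identity matrix, and is equipped with the norm, equivalent to $\|\cdot\|_{\mathcal{J}_s}$, $$|\|A\||_{\mathcal{J}_s}=\sup\{\|AB\|_{\mathcal{J}_s}: B\in\mathcal{J}_s,\ \|B\|_{\mathcal{J}_s}=1\}.$$ A matrix acts on families by $A(f_l)_l=(\sum_lA_{k,l}f_l)_k$;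 this identifies $\mathcal{J}_s$ with a subalgebra of $\mathcal{B}(\ell^2(X;\mathcal{H}))$. $\mathcal{A}\subseteq\mathcal{B}$ (unital Banach algebras with common identity) is inverse-closed in $\mathcal{B}$ if $A\in\mathcal{A}$ invertible in $\mathcal{B}$ implies $A^{-1}\in\mathcal{A}$. A unital Banach algebra $\mathcal{A}$ with involution is symmetric if the spectrum $\sigma_{\mathcal{A}}(A^*A)\subseteq[0,\infty)$ for all $A\in\mathcal{A}$. *)

theory Defs
  imports "HOL-Analysis.Analysis" "HOL-Algebra.Module"
begin

section \<open>Complex Hilbert spaces\<close>

text \<open>
  A complex Hilbert space is a complete real inner product space with a compatible complex
  structure: \<open>scaleC\<close> extends the real scalar multiplication, and the real inner product is the
  real part of the complex one, so that \<open>norm x = sqrt (Re (cinner x x))\<close>.  The complex inner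
  product is linear in its first argument.
\<close>

class complex_hilbert = real_inner + banach +
  fixes scaleC :: "complex \<Rightarrow> 'a \<Rightarrow> 'a"  (infixr \<open>*\<^sub>C\<close> 75)
    and cinner :: "'a \<Rightarrow> 'a \<Rightarrow> complex"
  assumes scaleC_add_right: "a *\<^sub>C (x + y) = a *\<^sub>C x + a *\<^sub>C y"
    and scaleC_add_left: "(a + b) *\<^sub>C x = a *\<^sub>C x + b *\<^sub>C x"
    and scaleC_scaleC: "a *\<^sub>C (b *\<^sub>C x) = (a * b) *\<^sub>C x"
    and scaleC_of_real: "complex_of_real r *\<^sub>C x = r *\<^sub>R x"
    and cinner_commute: "cinner x y = cnj (cinner y x)"
    and cinner_add_left: "cinner (x + y) z = cinner x z + cinner y z"
    and cinner_scaleC_left: "cinner (a *\<^sub>C x) y = a * cinner x y"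
    and Re_cinner: "Re (cinner x y) = inner x y"

text \<open>
  \<open>'h \<Rightarrow>\<^sub>L 'h\<close> consists of the bounded real-linear operators (with the operator norm);
  the bounded complex-linear ones are singled out as a subset.
\<close>

definition bounded_operators :: "('h::complex_hilbert \<Rightarrow>\<^sub>L 'h) set" where
  "bounded_operators =
    {T. \<forall>c x. blinfun_apply T (c *\<^sub>C x) = c *\<^sub>C blinfun_apply T x}"

definition scaleC_operator ::
    "complex \<Rightarrow> ('h::complex_hilbert \<Rightarrow>\<^sub>L 'h) \<Rightarrow> ('h \<Rightarrow>\<^sub>L 'h)" where
  "scaleC_operator c T = Blinfun (\<lambda>x. c *\<^sub>C blinfun_apply T x)"

definition adjoint_operator :: "('h::complex_hilbert \<Rightarrow>\<^sub>L 'h) \<Rightarrow> ('h \<Rightarrow>\<^sub>L 'h)" where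
  "adjoint_operator T =
    (THE S. \<forall>x y. cinner (blinfun_apply T x) y = cinner x (blinfun_apply S y))"


section \<open>Complex Banach algebras\<close>

definition complex_ring :: "complex ring" where
  "complex_ring = \<lparr>carrier = UNIV, mult = (*), one = 1, zero = 0, add = (+)\<rparr>"

record 'a normed_algebra = "(complex, 'a) module" +
  anorm :: "'a \<Rightarrow> real"

record 'a star_algebra = "'a normed_algebra" +
  star :: "'a \<Rightarrow> 'a"

text \<open>
  The zero algebra is allowed, since \<open>X\<close> may be empty and \<open>\<H>\<close> may be trivial; this is why
  the normalisation of the norm of the unit is conditional.
\<close>

locale unital_banach_algebra =
  ring A + Module.module complex_ring A for A :: "('a, 'm) normed_algebra_scheme" (structure) +
  assumes smult_mult_left:
      "\<lbrakk>x \<in> carrier A; y \<in> carrier A\<rbrakk> \<Longrightarrow> (c \<odot> x) \<otimes> y = c \<odot> (x \<otimes> y)"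
    and smult_mult_right:
      "\<lbrakk>x \<in> carrier A; y \<in> carrier A\<rbrakk> \<Longrightarrow> x \<otimes> (c \<odot> y) = c \<odot> (x \<otimes> y)"
    and anorm_nonneg: "x \<in> carrier A \<Longrightarrow> 0 \<le> anorm A x"
    and anorm_eq_0: "x \<in> carrier A \<Longrightarrow> anorm A x = 0 \<longleftrightarrow> x = \<zero>"
    and anorm_triangle:
      "\<lbrakk>x \<in> carrier A; y \<in> carrier A\<rbrakk> \<Longrightarrow> anorm A (x \<oplus> y) \<le> anorm A x + anorm A y"
    and anorm_smult: "x \<in> carrier A \<Longrightarrow> anorm A (c \<odot> x) = cmod c * anorm A x"
    and anorm_mult:
      "\<lbrakk>x \<in> carrier A; y \<in> carrier A\<rbrakk> \<Longrightarrow> anorm A (x \<otimes> y) \<le> anorm A x * anorm A y"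
    and anorm_one: "\<one> \<noteq> \<zero> \<Longrightarrow> anorm A \<one> = 1"
    and complete:
      "\<lbrakk>\<And>n. u n \<in> carrier A;
        \<And>e. 0 < e \<Longrightarrow> \<exists>N. \<forall>m\<ge>N. \<forall>n\<ge>N. anorm A (u m \<ominus> u n) < e\<rbrakk>
       \<Longrightarrow> \<exists>x\<in>carrier A. (\<lambda>n::nat. anorm A (u n \<ominus> x)) \<longlonglongrightarrow> 0"

definition spectrum :: "('a, 'm) normed_algebra_scheme \<Rightarrow> 'a \<Rightarrow> complex set" where
  "spectrum A a = {z. (z \<odot>\<^bsub>A\<^esub> \<one>\<^bsub>A\<^esub>) \<ominus>\<^bsub>A\<^esub> a \<notin> Units A}"

text \<open>
  The inclusion \<open>A \<subseteq> B\<close> of unital Banach algebras is given by an identification \<open>\<iota>\<close>,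
  an injective unital algebra homomorphism.
\<close>

definition inverse_closed_in ::
    "('a \<Rightarrow> 'b) \<Rightarrow> ('a, 'm) normed_algebra_scheme \<Rightarrow> ('b, 'n) normed_algebra_scheme \<Rightarrow> bool" where
  "inverse_closed_in \<iota> A B \<longleftrightarrow>
    unital_banach_algebra A \<and> unital_banach_algebra B \<and>
    \<iota> \<in> ring_hom A B \<and> inj_on \<iota> (carrier A) \<and>
    (\<forall>c. \<forall>a\<in>carrier A. \<iota> (c \<odot>\<^bsub>A\<^esub> a) = c \<odot>\<^bsub>B\<^esub> \<iota> a) \<and>
    (\<forall>a\<in>carrier A. \<iota> a \<in> Units B \<longrightarrow> inv\<^bsub>B\<^esub> (\<iota> a) \<in> \<iota> ` carrier A)"

locale involutive_banach_algebra =
  unital_banach_algebra A for A :: "('a, 'm) star_algebra_scheme" (structure) +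
  assumes star_closed: "x \<in> carrier A \<Longrightarrow> star A x \<in> carrier A"
    and star_star: "x \<in> carrier A \<Longrightarrow> star A (star A x) = x"
    and star_add:
      "\<lbrakk>x \<in> carrier A; y \<in> carrier A\<rbrakk> \<Longrightarrow> star A (x \<oplus> y) = star A x \<oplus> star A y"
    and star_smult: "x \<in> carrier A \<Longrightarrow> star A (c \<odot> x) = cnj c \<odot> star A x"
    and star_mult:
      "\<lbrakk>x \<in> carrier A; y \<in> carrier A\<rbrakk> \<Longrightarrow> star A (x \<otimes> y) = star A y \<otimes> star A x"

locale symmetric_banach_algebra =
  involutive_banach_algebra A for A :: "('a, 'm) star_algebra_scheme" (structure) +
  assumes spectrum_star_mult:
      "x \<in> carrier A \<Longrightarrow> spectrum A (star A x \<otimes> x) \<subseteq> complex_of_real ` {0..}"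


section \<open>The Jaffard algebra\<close>

text \<open>The set \<open>cbox 0 1\<close> is the unit cube.\<close>

definition relatively_separated :: "(real^'d) set \<Rightarrow> bool" where
  "relatively_separated X \<longleftrightarrow> countable X \<and>
    (\<exists>N. \<forall>x. finite (X \<inter> (+) x ` cbox 0 1) \<and> card (X \<inter> (+) x ` cbox 0 1) \<le> N)"

text \<open>
  Matrices over \<open>X\<close> and families over \<open>X\<close> are total functions that vanish for indices
  outside \<open>X\<close>.
\<close>

type_synonym ('d, 'h) op_matrix = "real^'d \<Rightarrow> real^'d \<Rightarrow> ('h \<Rightarrow>\<^sub>L 'h)"

definition jaffard_norm ::
    "(real^'d) set \<Rightarrow> real \<Rightarrow> ('d, 'h::complex_hilbert) op_matrix \<Rightarrow> ennreal" where
  "jaffard_norm X s A =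
    (SUP k\<in>X. SUP l\<in>X. ennreal (norm (A k l) * (1 + norm (k - l)) powr s))"

definition jaffard_space ::
    "(real^'d) set \<Rightarrow> real \<Rightarrow> ('d, 'h::complex_hilbert) op_matrix set" where
  "jaffard_space X s =
    {A. (\<forall>k l. A k l \<in> bounded_operators) \<and> (\<forall>k l. k \<notin> X \<or> l \<notin> X \<longrightarrow> A k l = 0) \<and>
        jaffard_norm X s A < \<infinity>}"

definition matrix_mult ::
    "(real^'d) set \<Rightarrow> ('d, 'h::complex_hilbert) op_matrix \<Rightarrow> ('d, 'h) op_matrix
      \<Rightarrow> ('d, 'h) op_matrix" where
  "matrix_mult X A B = (\<lambda>k l. \<Sum>\<^sub>\<infinity>n\<in>X. A k n o\<^sub>L B n l)"

text \<open>The norm obtained from left multiplication; an empty supremum is 0.\<close>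

definition jaffard_op_norm ::
    "(real^'d) set \<Rightarrow> real \<Rightarrow> ('d, 'h::complex_hilbert) op_matrix \<Rightarrow> real" where
  "jaffard_op_norm X s A =
    enn2real (SUP B\<in>{B \<in> jaffard_space X s. jaffard_norm X s B = 1}.
      jaffard_norm X s (matrix_mult X A B))"

definition jaffard_algebra ::
    "(real^'d) set \<Rightarrow> real \<Rightarrow> ('d, 'h::complex_hilbert) op_matrix star_algebra" where
  "jaffard_algebra X s =
    \<lparr>carrier = jaffard_space X s,
     mult = matrix_mult X,
     one = (\<lambda>k l. if k = l \<and> k \<in> X then id_blinfun else 0),
     zero = (\<lambda>k l. 0),
     add = (\<lambda>A B k l. A k l + B k l),
     smult = (\<lambda>c A k l. scaleC_operator c (A k l)),
     anorm = jaffard_op_norm X s,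
     star = (\<lambda>A k l. adjoint_operator (A l k))\<rparr>"


section \<open>Bounded operators on square-summable families\<close>

definition ell2 :: "(real^'d) set \<Rightarrow> (real^'d \<Rightarrow> 'h::complex_hilbert) set" where
  "ell2 X = {f. (\<forall>k. k \<notin> X \<longrightarrow> f k = 0) \<and> (\<lambda>k. (norm (f k))\<^sup>2) summable_on X}"

definition ell2_norm :: "(real^'d) set \<Rightarrow> (real^'d \<Rightarrow> 'h::complex_hilbert) \<Rightarrow> real" where
  "ell2_norm X f = sqrt (\<Sum>\<^sub>\<infinity>k\<in>X. (norm (f k))\<^sup>2)"

text \<open>Operators are \<open>undefined\<close> off \<open>ell2 X\<close>, so that equality is equality on \<open>ell2 X\<close>.\<close>

definition ell2_operators ::
    "(real^'d) set \<Rightarrow> ((real^'d \<Rightarrow> 'h::complex_hilbert) \<Rightarrow> (real^'d \<Rightarrow> 'h)) set" where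
  "ell2_operators X =
    {T \<in> ell2 X \<rightarrow>\<^sub>E ell2 X.
      (\<forall>f\<in>ell2 X. \<forall>g\<in>ell2 X. T (\<lambda>k. f k + g k) = (\<lambda>k. T f k + T g k)) \<and>
      (\<forall>c. \<forall>f\<in>ell2 X. T (\<lambda>k. c *\<^sub>C f k) = (\<lambda>k. c *\<^sub>C T f k)) \<and>
      (\<exists>C. \<forall>f\<in>ell2 X. ell2_norm X (T f) \<le> C * ell2_norm X f)}"

definition ell2_operator_algebra ::
    "(real^'d) set
      \<Rightarrow> ((real^'d \<Rightarrow> 'h::complex_hilbert) \<Rightarrow> (real^'d \<Rightarrow> 'h)) normed_algebra" where
  "ell2_operator_algebra X =
    \<lparr>carrier = ell2_operators X,
     mult = compose (ell2 X),
     one = (\<lambda>f\<in>ell2 X. f),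
     zero = (\<lambda>f\<in>ell2 X. \<lambda>k. 0),
     add = (\<lambda>S T. \<lambda>f\<in>ell2 X. \<lambda>k. S f k + T f k),
     smult = (\<lambda>c T. \<lambda>f\<in>ell2 X. \<lambda>k. c *\<^sub>C T f k),
     anorm = (\<lambda>T. SUP f\<in>{f \<in> ell2 X. ell2_norm X f \<le> 1}. ell2_norm X (T f))\<rparr>"

definition matrix_operator ::
    "(real^'d) set \<Rightarrow> ('d, 'h::complex_hilbert) op_matrix
      \<Rightarrow> (real^'d \<Rightarrow> 'h) \<Rightarrow> (real^'d \<Rightarrow> 'h)" where
  "matrix_operator X A = (\<lambda>f\<in>ell2 X. \<lambda>k. \<Sum>\<^sub>\<infinity>l\<in>X. blinfun_apply (A k l) (f l))"

end

theory Submission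
  imports Defs
begin

text \<open>
  Let \<open>w\<close> be the weight \<open>(1 + norm (k - l)) powr (-s)\<close>.  Splitting \<open>1 / w k l\<close> along an intermediate index
  \<open>n\<close> bounds the Jaffard norm of \<open>A A\<close>, up to a constant, by the product of the Jaffard norm of \<open>A\<close> and the supremum over
  \<open>k\<close> of \<open>\<Sum>\<^sub>n norm (A k n)\<close> (and the same for columns).  Every entry of \<open>A\<close> is bounded both by \<open>a * w\<close>, where
  \<open>a\<close> is the Jaffard norm, and by the operator norm \<open>M\<close> of \<open>A\<close>, hence by
  \<open>a powr \<theta> * M powr (1 - \<theta>) * w powr \<theta>\<close>, and \<open>w powr \<theta>\<close> is still summable if \<open>\<theta> < 1\<close> is close to \<open>1\<close>.
  So the Jaffard norm of \<open>A A\<close> is at most a constant times \<open>a powr (1 + \<theta>) * M powr (1 - \<theta>)\<close>.  Iterating this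
  along \<open>T ^ 2 ^ m\<close> shows that the Jaffard norms of these powers tend to \<open>0\<close> whenever \<open>T\<close> has operator norm less
  than \<open>1\<close>, so that the Neumann series inverts \<open>1 - T\<close> inside the Jaffard algebra.

  If \<open>A\<close> is bounded below on \<open>\<ell>\<^sup>2\<close>, then \<open>1 - \<mu> A\<^sup>* A\<close> has operator norm less than \<open>1\<close> for a suitable \<open>\<mu> > 0\<close>,
  so \<open>A\<^sup>* A\<close> is invertible in the Jaffard algebra and \<open>A\<close> has a left inverse there.  For \<open>A\<close> invertible on \<open>\<ell>\<^sup>2\<close>
  this left inverse is the inverse.  For symmetry, \<open>z - A\<^sup>* A\<close> and its adjoint are bounded below
  unless \<open>z\<close> is a nonnegative real, so that both have left inverses.
\<close>

text \<open>Submultiplicativity up to a constant gives \<open>a (m + 1) \<le> K * a m ^ 2\<close>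
  for the Jaffard norms of \<open>T ^ 2 ^ m\<close>, which yields decay only if \<open>T\<close> is
  already small in the Jaffard norm. Lowering the exponent of \<open>a m\<close> from 2 to
  \<open>1 + \<theta>\<close> is what lets the operator norm win, however large the Jaffard norm of
  \<open>T\<close> is. The price is a weight with the smaller exponent \<open>s * \<theta>\<close>,
  which must still exceed the dimension; the strict inequality between \<open>s\<close> and the
  dimension leaves room for such a \<theta>.

  A single small power is enough. The Neumann series is applied to one \<open>1 - T ^ 2 ^ m\<close>,
  and the squarings are undone by \<open>1 - T ^ 2 = (1 + T) (1 - T)\<close>, one factor at a time.

  Left inverses are the natural currency, since a lower bound on \<open>\<ell>\<^sup>2\<close> gives
  no information about the range. Right inverses are obtained from adjoints.

  Inner products of families are kept real. The imaginary part is read off by pairing with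
  \<open>\<i>\<close> times the family, so that all Hilbert space estimates are inequalities between
  real sums.\<close>

section \<open>Adjoints\<close>

text \<open>The representing vector minimises \<open>norm x ^ 2 - 2 * f x\<close>; minimising sequences are Cauchy by
  the parallelogram law.\<close>

lemma riesz_representation:
  fixes f :: "'a::{real_inner, banach} \<Rightarrow> real"
  assumes "bounded_linear f"
  shows "\<exists>y. \<forall>x. f x = inner x y"
proof -
  interpret f: bounded_linear f by fact
  define J where "J x = (norm x)\<^sup>2 - 2 * f x" for x
  obtain K where K: "\<And>x. norm (f x) \<le> norm x * K" and "K > 0"
    using f.pos_bounded by blast
  have J_ge: "J x \<ge> - K\<^sup>2" for x
  proof -
    have "0 \<le> (norm x - K)\<^sup>2" by simp
    also have "\<dots> = (norm x)\<^sup>2 - 2 * (norm x * K) + K\<^sup>2"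
      by (simp add: power2_eq_square algebra_simps)
    finally show ?thesis using K[of x] by (simp add: J_def abs_le_iff)
  qed
  then have bdd: "bdd_below (range J)" by (meson bdd_belowI2)
  define m where "m = Inf (range J)"
  have m_le: "m \<le> J x" for x
    unfolding m_def using bdd by (simp add: cInf_lower)
  have "\<exists>x. J x < m + inverse (Suc n)" for n
    using cInf_lessD[of "range J" "m + inverse (Suc n)"] by (auto simp: m_def)
  then obtain u where u: "\<And>n. J (u n) < m + inverse (Suc n)" by metis
  \<comment> \<open>The linear parts cancel in the parallelogram identity, because \<open>f\<close>
    at the midpoint is the mean of its two values; the value of \<open>J\<close> at the midpoint is
    then at least \<open>m\<close>.\<close>
  have par: "(norm (a - b))\<^sup>2 \<le> 2 * (J a - m) + 2 * (J b - m)" for a b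
  proof -
    have "(norm (a - b))\<^sup>2 = 2 * J a + 2 * J b - 4 * J ((1/2) *\<^sub>R (a + b))"
      by (simp add: J_def power2_norm_eq_inner f.scaleR f.add inner_diff inner_add
          inner_commute[of b a] algebra_simps)
    then show ?thesis using m_le[of "(1/2) *\<^sub>R (a + b)"] by simp
  qed
  have arith: "x < d" if "x \<le> 2 * (a - m) + 2 * (b - m)" "a < m + d / 4" "b < m + d / 4"
    for a b d x :: real
    using that by simp
  have "Cauchy u"
  proof (rule metric_CauchyI)
    fix e :: real assume "e > 0"
    then obtain N where N: "inverse (Suc N) < e\<^sup>2 / 4"
      using reals_Archimedean[of "e\<^sup>2 / 4"] by auto
    have "dist (u i) (u j) < e" if "i \<ge> N" "j \<ge> N" for i j
    proof -
      have "inverse (real (Suc i)) \<le> inverse (Suc N)" "inverse (real (Suc j)) \<le> inverse (Suc N)"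
        using that by (auto intro!: le_imp_inverse_le)
      then have "J (u i) < m + e\<^sup>2 / 4" "J (u j) < m + e\<^sup>2 / 4"
        using u[of i] u[of j] N by (meson add_strict_left_mono order.strict_trans order.strict_trans1)+
      then have "(norm (u i - u j))\<^sup>2 < e\<^sup>2"
        using arith par[of "u i" "u j"] by blast
      then show ?thesis using \<open>e > 0\<close> by (simp add: dist_norm power_less_imp_less_base)
    qed
    then show "\<exists>N. \<forall>i\<ge>N. \<forall>j\<ge>N. dist (u i) (u j) < e" by blast
  qed
  then obtain y where y: "u \<longlonglongrightarrow> y" using Cauchy_convergent convergent_def by blast
  have "(\<lambda>n. J (u n)) \<longlonglongrightarrow> J y"
    unfolding J_def by (intro tendsto_intros y f.tendsto)
  moreover have "(\<lambda>n. m + inverse (real (Suc n))) \<longlonglongrightarrow> m + 0"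
    by (intro tendsto_intros LIMSEQ_inverse_real_of_nat)
  ultimately have Jy: "J y \<le> m"
    using u by (intro LIMSEQ_le) (auto intro!: exI[of _ 0] less_imp_le)
  have "f x = inner x y" for x
  proof (cases "x = 0")
    case False
    define c where "c = inner x y - f x"
    \<comment> \<open>The minimiser of \<open>2 * t * c + t\<^sup>2 * (norm x)\<^sup>2\<close>, the
      increment of \<open>J\<close> from \<open>y\<close> in direction \<open>x\<close>; its minimal
      value is \<open>- c\<^sup>2 / (norm x)\<^sup>2\<close>.\<close>
    define t where "t = - c / (norm x)\<^sup>2"
    have "J y \<le> J (y + t *\<^sub>R x)" using Jy m_le order_trans by blast
    then have "0 \<le> 2 * t * c + t\<^sup>2 * (norm x)\<^sup>2"
      by (simp add: J_def c_def power2_norm_eq_inner f.add f.scaleR inner_add inner_commute[of y x]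
          power2_eq_square[of t] algebra_simps)
    also have "\<dots> = - (c\<^sup>2 / (norm x)\<^sup>2)"
      using False by (simp add: t_def field_simps power2_eq_square)
    finally have "c\<^sup>2 / (norm x)\<^sup>2 \<le> 0" by simp
    then show ?thesis using False by (simp add: c_def divide_le_0_iff)
  qed (simp add: f.zero)
  then show ?thesis by blast
qed

section \<open>Complex scalars and the two inner products\<close>

lemma inner_scaleC_i_left: "inner (\<i> *\<^sub>C x) y = - Im (cinner x y)"
  using Re_cinner[of "\<i> *\<^sub>C x" y] by (simp add: cinner_scaleC_left)

lemma cinner_scaleC_right: "cinner x (a *\<^sub>C y) = cnj a * cinner x y"
  using cinner_commute[of x "a *\<^sub>C y"] cinner_commute[of x y] by (simp add: cinner_scaleC_left)

lemma cinner_self: "cinner x x = complex_of_real ((norm x)\<^sup>2)"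
  using cinner_commute[of x x] Re_cinner[of x x]
  by (auto simp: complex_eq_iff power2_norm_eq_inner)

lemma norm_scaleC: "norm (c *\<^sub>C (x::'h::complex_hilbert)) = cmod c * norm x"
proof -
  have "cinner (c *\<^sub>C x) (c *\<^sub>C x) = complex_of_real ((cmod c)\<^sup>2) * cinner x x"
    by (simp add: cinner_scaleC_left cinner_scaleC_right complex_norm_square mult.assoc
        del: of_real_power)
  then have "(norm (c *\<^sub>C x))\<^sup>2 = (cmod c * norm x)\<^sup>2"
    unfolding cinner_self by (metis of_real_eq_iff of_real_mult power_mult_distrib)
  then show ?thesis by simp
qed

lemma scaleC_one: "1 *\<^sub>C (x::'h::complex_hilbert) = x"
  using scaleC_of_real[of 1 x] by simp

lemma scaleC_zero_left: "0 *\<^sub>C x = 0"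
  using scaleC_of_real[of 0 x] by simp

lemma scaleC_zero_right: "c *\<^sub>C 0 = 0"
  using scaleC_add_right[of c 0 0] by simp

text \<open>Multiplication by \<i> is skew for the real inner product. In the symmetry proof this
  removes the contribution of \<open>A\<^sup>* A\<close> and leaves \<open>Im z\<close>
  alone.\<close>

lemma inner_scaleC_i_self: "inner x (\<i> *\<^sub>C x) = 0"
  using Re_cinner[of x "\<i> *\<^sub>C x"] by (simp add: cinner_scaleC_right cinner_self)

lemma inner_scaleC_scaleC_i_self: "inner (z *\<^sub>C x) (\<i> *\<^sub>C x) = Im z * (norm x)\<^sup>2"
  using Re_cinner[of "z *\<^sub>C x" "\<i> *\<^sub>C x"]
  by (simp add: cinner_scaleC_right cinner_scaleC_left cinner_self del: of_real_power)

lemma inner_scaleC_self: "inner (z *\<^sub>C x) x = Re z * (norm x)\<^sup>2"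
  using Re_cinner[of "z *\<^sub>C x" x]
  by (simp add: cinner_scaleC_left cinner_self del: of_real_power)

lemma inner_scaleC_right: "inner x (c *\<^sub>C y) = inner (cnj c *\<^sub>C x) y"
  by (simp flip: Re_cinner add: cinner_scaleC_left cinner_scaleC_right)

lemma bounded_linear_scaleC: "bounded_linear ((*\<^sub>C) c :: 'h::complex_hilbert \<Rightarrow> 'h)"
proof
  fix x y :: 'h and r :: real
  show "c *\<^sub>C (x + y) = c *\<^sub>C x + c *\<^sub>C y" by (rule scaleC_add_right)
  show "c *\<^sub>C (r *\<^sub>R x) = r *\<^sub>R (c *\<^sub>C x)"
    by (simp add: scaleC_of_real[symmetric] scaleC_scaleC mult.commute)
  show "\<exists>K. \<forall>x :: 'h. norm (c *\<^sub>C x) \<le> norm x * K"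
    by (rule exI[of _ "cmod c"]) (simp add: norm_scaleC mult.commute)
qed

lemma scaleC_minus_right: "c *\<^sub>C (- x) = - (c *\<^sub>C x)"
  by (rule linear_neg[OF bounded_linear.linear[OF bounded_linear_scaleC]])

lemma blinfun_apply_scaleC_operator [simp]:
  "blinfun_apply (scaleC_operator c T) x = c *\<^sub>C blinfun_apply T x"
  unfolding scaleC_operator_def
  by (rule bounded_linear_Blinfun_apply[THEN fun_cong])
     (intro bounded_linear_compose[OF bounded_linear_scaleC] blinfun.bounded_linear_right)

lemma bounded_operatorsD: "T \<in> bounded_operators \<Longrightarrow> blinfun_apply T (c *\<^sub>C x) = c *\<^sub>C blinfun_apply T x"
  by (simp add: bounded_operators_def)

lemma norm_scaleC_operator_le: "norm (scaleC_operator c T) \<le> cmod c * norm T"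
  by (rule norm_blinfun_bound)
     (auto simp: norm_scaleC mult.assoc intro!: mult_left_mono norm_blinfun)

lemma bounded_operators_zero: "0 \<in> bounded_operators"
  and bounded_operators_id: "id_blinfun \<in> bounded_operators"
  and bounded_operators_add:
    "S \<in> bounded_operators \<Longrightarrow> T \<in> bounded_operators \<Longrightarrow> S + T \<in> bounded_operators"
  and bounded_operators_uminus: "T \<in> bounded_operators \<Longrightarrow> - T \<in> bounded_operators"
  and bounded_operators_compose:
    "S \<in> bounded_operators \<Longrightarrow> T \<in> bounded_operators \<Longrightarrow> S o\<^sub>L T \<in> bounded_operators"
  and bounded_operators_scaleC: "T \<in> bounded_operators \<Longrightarrow> scaleC_operator c T \<in> bounded_operators"
  by (auto simp: bounded_operators_def blinfun.add_left blinfun.minus_left scaleC_add_right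
      scaleC_scaleC mult.commute scaleC_zero_right scaleC_minus_right)

text \<open>Limits are formed in the space of real-linear operators, so complex linearity of an
  entrywise limit has to be recovered by closedness.\<close>

lemma closed_bounded_operators: "closed (bounded_operators :: ('h::complex_hilbert \<Rightarrow>\<^sub>L 'h) set)"
proof -
  have eq: "(bounded_operators :: ('h \<Rightarrow>\<^sub>L 'h) set)
      = (\<Inter>c. \<Inter>x. {T. blinfun_apply T (c *\<^sub>C x) = c *\<^sub>C blinfun_apply T x})"
    by (auto simp: bounded_operators_def)
  have "closed {T :: 'h \<Rightarrow>\<^sub>L 'h. blinfun_apply T (c *\<^sub>C x) = c *\<^sub>C blinfun_apply T x}" for c x
    by (intro closed_Collect_eq linear_continuous_on blinfun.bounded_linear_left
        bounded_linear_compose[OF bounded_linear_scaleC])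
  then show ?thesis unfolding eq by (intro closed_INT ballI)
qed

text \<open>Complex linearity of \<open>T\<close> turns the imaginary part of \<open>cinner\<close>
  into the real inner product at \<open>\<i> *\<^sub>C x\<close>, so an identity for
  \<open>inner\<close> determines the adjoint. Every later computation of an adjoint goes through
  this rule.\<close>

lemma adjoint_operator_eqI:
  assumes "T \<in> bounded_operators"
    and "\<And>x y. inner (blinfun_apply T x) y = inner x (blinfun_apply S y)"
  shows "adjoint_operator T = S"
proof -
  have "cinner (blinfun_apply T x) y = cinner x (blinfun_apply S y)" for x y
  proof (rule complex_eqI)
    show "Re (cinner (blinfun_apply T x) y) = Re (cinner x (blinfun_apply S y))"
      by (simp add: Re_cinner assms(2))
    have "inner (\<i> *\<^sub>C blinfun_apply T x) y = inner (\<i> *\<^sub>C x) (blinfun_apply S y)"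
      using assms(2)[of "\<i> *\<^sub>C x" y] by (simp add: bounded_operatorsD[OF assms(1)])
    then show "Im (cinner (blinfun_apply T x) y) = Im (cinner x (blinfun_apply S y))"
      by (simp add: inner_scaleC_i_left)
  qed
  moreover have "S' = S"
    if S': "\<forall>x y. cinner (blinfun_apply T x) y = cinner x (blinfun_apply S' y)" for S'
  proof (rule blinfun_eqI)
    fix y
    have "inner x (blinfun_apply S' y) = inner x (blinfun_apply S y)" for x
      using S' assms(2) by (metis Re_cinner)
    then show "blinfun_apply S' y = blinfun_apply S y" by (metis vector_eq_ldot)
  qed
  ultimately show ?thesis unfolding adjoint_operator_def by (intro the_equality) blast+
qed

text \<open>This is the adjoint for the real inner product, from Riesz representation of
  \<open>x \<mapsto> inner (T x) y\<close>. By \<open>adjoint_operator_eqI\<close> it is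
  \<open>adjoint_operator T\<close> as soon as \<open>T\<close> is complex-linear.\<close>

lemma adjoint_operator_exists:
  fixes T :: "'h::complex_hilbert \<Rightarrow>\<^sub>L 'h"
  shows "\<exists>S. norm S \<le> norm T \<and> (\<forall>x y. inner (blinfun_apply T x) y = inner x (blinfun_apply S y))"
proof -
  have "\<exists>z. \<forall>x. inner (blinfun_apply T x) y = inner x z" for y
    by (rule riesz_representation)
       (intro bounded_linear_compose[OF bounded_linear_inner_left] blinfun.bounded_linear_right)
  then obtain g where g: "\<And>x y. inner (blinfun_apply T x) y = inner x (g y)" by metis
  have g_norm: "norm (g y) \<le> norm y * norm T" for y
  proof (cases "g y = 0")
    case False
    have "(norm (g y))\<^sup>2 = inner (blinfun_apply T (g y)) y"
      by (simp add: g power2_norm_eq_inner)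
    also have "\<dots> \<le> norm (blinfun_apply T (g y)) * norm y" by (rule norm_cauchy_schwarz)
    also have "\<dots> \<le> norm T * norm (g y) * norm y" by (intro mult_right_mono norm_blinfun) auto
    finally show ?thesis using False by (simp add: power2_eq_square mult_ac)
  qed simp
  have "bounded_linear g"
  proof
    fix x y and r :: real
    show "g (x + y) = g x + g y" by (rule vector_eq_ldot[THEN iffD1]) (auto simp flip: g simp: inner_add_right)
    show "g (r *\<^sub>R x) = r *\<^sub>R g x" by (rule vector_eq_ldot[THEN iffD1]) (auto simp flip: g)
    show "\<exists>K. \<forall>x. norm (g x) \<le> norm x * K" using g_norm by blast
  qed
  then have "blinfun_apply (Blinfun g) = g" by (rule bounded_linear_Blinfun_apply)
  then show ?thesis
    using g g_norm by (intro exI[of _ "Blinfun g"]) (auto intro!: norm_blinfun_bound simp: mult.commute)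
qed

lemma
  assumes "T \<in> bounded_operators"
  shows inner_adjoint_operator:
      "inner (blinfun_apply T x) y = inner x (blinfun_apply (adjoint_operator T) y)"
    and norm_adjoint_operator_le: "norm (adjoint_operator T) \<le> norm T"
  using adjoint_operator_exists[of T] adjoint_operator_eqI[OF assms] by metis+

lemma bounded_operators_adjoint:
  assumes "T \<in> bounded_operators"
  shows "adjoint_operator T \<in> bounded_operators"
proof -
  have "blinfun_apply (adjoint_operator T) (c *\<^sub>C y) = c *\<^sub>C blinfun_apply (adjoint_operator T) y" for c y
  proof (rule vector_eq_ldot[THEN iffD1], intro allI)
    fix x
    show "inner x (blinfun_apply (adjoint_operator T) (c *\<^sub>C y))
        = inner x (c *\<^sub>C blinfun_apply (adjoint_operator T) y)"
      by (simp flip: inner_adjoint_operator[OF assms] add: inner_scaleC_right bounded_operatorsD[OF assms])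
  qed
  then show ?thesis by (simp add: bounded_operators_def)
qed

lemma adjoint_operator_adjoint:
  "T \<in> bounded_operators \<Longrightarrow> adjoint_operator (adjoint_operator T) = T"
  by (intro adjoint_operator_eqI bounded_operators_adjoint)
     (metis inner_adjoint_operator inner_commute)+

lemma adjoint_operator_zero: "adjoint_operator 0 = 0"
  by (rule adjoint_operator_eqI) (auto simp: bounded_operators_zero)

lemma adjoint_operator_add:
  "S \<in> bounded_operators \<Longrightarrow> T \<in> bounded_operators \<Longrightarrow>
    adjoint_operator (S + T) = adjoint_operator S + adjoint_operator T"
  by (intro adjoint_operator_eqI bounded_operators_add)
     (auto simp: blinfun.add_left inner_add inner_adjoint_operator)

lemma adjoint_operator_scaleC:
  assumes "T \<in> bounded_operators"
  shows "adjoint_operator (scaleC_operator c T) = scaleC_operator (cnj c) (adjoint_operator T)"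
  using assms
  by (intro adjoint_operator_eqI bounded_operators_scaleC)
     (simp_all add: inner_scaleC_right bounded_operatorsD flip: inner_adjoint_operator[OF assms])

section \<open>Square-summable families\<close>

text \<open>Everything is reduced to finite subsets of \<open>X\<close>, where the triangle and
  Cauchy-Schwarz inequalities for \<open>L2_set\<close> apply.\<close>

lemma
  assumes "\<And>k. k \<notin> X \<Longrightarrow> f k = 0"
    and bound: "\<And>F. finite F \<Longrightarrow> F \<subseteq> X \<Longrightarrow> L2_set (\<lambda>k. norm (f k)) F \<le> c"
  shows ell2I: "f \<in> ell2 X" and ell2_norm_leI: "ell2_norm X f \<le> c"
proof -
  have "0 \<le> c" using bound[of "{}"] by simp
  have sum_le: "(\<Sum>k\<in>F. (norm (f k))\<^sup>2) \<le> c\<^sup>2" if "finite F" "F \<subseteq> X" for F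
    using bound[OF that] \<open>0 \<le> c\<close> by (simp add: L2_set_def real_le_lsqrt sqrt_le_D)
  then have summable: "(\<lambda>k. (norm (f k))\<^sup>2) summable_on X"
    by (intro nonneg_bdd_above_summable_on) (auto intro!: bdd_aboveI2)
  then show "f \<in> ell2 X" using assms(1) by (simp add: ell2_def)
  show "ell2_norm X f \<le> c"
    unfolding ell2_norm_def using summable sum_le \<open>0 \<le> c\<close>
    by (intro real_le_lsqrt infsum_le_finite_sums) (auto intro: infsum_nonneg)
qed

lemma ell2_eq_0: "f \<in> ell2 X \<Longrightarrow> k \<notin> X \<Longrightarrow> f k = 0"
  by (simp add: ell2_def)

lemma ell2_summable: "f \<in> ell2 X \<Longrightarrow> (\<lambda>k. (norm (f k))\<^sup>2) summable_on X"
  by (simp add: ell2_def)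

lemma ell2_norm_nonneg [simp]: "0 \<le> ell2_norm X f"
  by (simp add: ell2_norm_def infsum_nonneg)

lemma ell2_norm_square: "(ell2_norm X f)\<^sup>2 = (\<Sum>\<^sub>\<infinity>k\<in>X. (norm (f k))\<^sup>2)"
  by (simp add: ell2_norm_def infsum_nonneg)

lemma L2_set_le_ell2_norm:
  assumes "f \<in> ell2 X" "finite F" "F \<subseteq> X"
  shows "L2_set (\<lambda>k. norm (f k)) F \<le> ell2_norm X f"
  unfolding L2_set_def ell2_norm_def
  using assms by (intro real_sqrt_le_mono finite_sum_le_infsum ell2_summable) auto

lemma norm_le_ell2_norm:
  assumes "f \<in> ell2 X"
  shows "norm (f k) \<le> ell2_norm X f"
proof (cases "k \<in> X")
  case True
  then show ?thesis using L2_set_le_ell2_norm[OF assms, of "{k}"] by simp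
qed (simp add: ell2_eq_0[OF assms])

lemma ell2_norm_eq_0D:
  assumes "f \<in> ell2 X" "ell2_norm X f = 0"
  shows "f = (\<lambda>k. 0)"
  using norm_le_ell2_norm[OF assms(1)] assms(2) by (auto simp: fun_eq_iff)

lemma
  assumes "f \<in> ell2 X" "g \<in> ell2 X"
  shows ell2_add: "(\<lambda>k. f k + g k) \<in> ell2 X"
    and ell2_norm_triangle: "ell2_norm X (\<lambda>k. f k + g k) \<le> ell2_norm X f + ell2_norm X g"
proof -
  have "L2_set (\<lambda>k. norm (f k + g k)) F \<le> ell2_norm X f + ell2_norm X g"
    if "finite F" "F \<subseteq> X" for F
  proof -
    have "L2_set (\<lambda>k. norm (f k + g k)) F \<le> L2_set (\<lambda>k. norm (f k) + norm (g k)) F"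
      by (intro L2_set_mono norm_triangle_ineq) auto
    also have "\<dots> \<le> L2_set (\<lambda>k. norm (f k)) F + L2_set (\<lambda>k. norm (g k)) F"
      by (rule L2_set_triangle_ineq)
    also have "\<dots> \<le> ell2_norm X f + ell2_norm X g"
      using assms that by (intro add_mono L2_set_le_ell2_norm)
    finally show ?thesis .
  qed
  then show "(\<lambda>k. f k + g k) \<in> ell2 X"
    and "ell2_norm X (\<lambda>k. f k + g k) \<le> ell2_norm X f + ell2_norm X g"
    using assms by (auto intro!: ell2I ell2_norm_leI simp: ell2_eq_0)
qed

lemma
  assumes "f \<in> ell2 X"
  shows ell2_scaleC: "(\<lambda>k. c *\<^sub>C f k) \<in> ell2 X"
    and ell2_norm_scaleC: "ell2_norm X (\<lambda>k. c *\<^sub>C f k) = cmod c * ell2_norm X f"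
proof -
  have "(\<lambda>k. (cmod c)\<^sup>2 * (norm (f k))\<^sup>2) summable_on X"
    using assms by (intro summable_on_cmult_right ell2_summable)
  then show "(\<lambda>k. c *\<^sub>C f k) \<in> ell2 X"
    using assms by (simp add: ell2_def norm_scaleC power_mult_distrib scaleC_zero_right)
  show "ell2_norm X (\<lambda>k. c *\<^sub>C f k) = cmod c * ell2_norm X f"
    using assms by (simp add: ell2_norm_def norm_scaleC power_mult_distrib real_sqrt_mult
        infsum_cmult_right ell2_summable)
qed

lemma scaleC_minus_one: "(-1) *\<^sub>C x = - x"
  using scaleC_of_real[of "-1" x] by simp

lemma ell2_diff: "f \<in> ell2 X \<Longrightarrow> g \<in> ell2 X \<Longrightarrow> (\<lambda>k. f k - g k) \<in> ell2 X"
  using ell2_add[of f X "\<lambda>k. (-1) *\<^sub>C g k"] ell2_scaleC[of g X "-1"]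
  by (simp add: scaleC_minus_one)

lemma ell2_zero: "(\<lambda>k. 0) \<in> ell2 X" and ell2_norm_zero [simp]: "ell2_norm X (\<lambda>k. 0) = 0"
  by (simp_all add: ell2_def ell2_norm_def)

lemma
  assumes "l \<in> X"
  shows ell2_single: "(\<lambda>k. if k = l then x else 0) \<in> ell2 X"
    and ell2_norm_single_le: "ell2_norm X (\<lambda>k. if k = l then x else 0) \<le> norm x"
proof -
  have "L2_set (\<lambda>k. norm (if k = l then x else 0)) F \<le> norm x" if "finite F" for F
    using that by (cases "l \<in> F") (auto simp: L2_set_def if_distrib[of "\<lambda>y. (norm y)\<^sup>2"] cong: if_cong)
  then show "(\<lambda>k. if k = l then x else 0) \<in> ell2 X"
    "ell2_norm X (\<lambda>k. if k = l then x else 0) \<le> norm x"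
    using assms by (auto intro!: ell2I ell2_norm_leI)
qed


section \<open>The Banach algebra of bounded operators on square-summable families\<close>

lemma cring_complex_ring: "cring complex_ring"
  unfolding complex_ring_def
  by (intro cringI abelian_groupI comm_monoidI)
     (auto simp: algebra_simps intro: exI[of _ "- x" for x])

section \<open>Bounded operators on families and their operator norm\<close>

lemma ell2_operatorsD:
  assumes "T \<in> ell2_operators X"
  shows "T \<in> extensional (ell2 X)"
    and "f \<in> ell2 X \<Longrightarrow> T f \<in> ell2 X"
    and "f \<in> ell2 X \<Longrightarrow> g \<in> ell2 X \<Longrightarrow> T (\<lambda>k. f k + g k) = (\<lambda>k. T f k + T g k)"
    and "f \<in> ell2 X \<Longrightarrow> T (\<lambda>k. c *\<^sub>C f k) = (\<lambda>k. c *\<^sub>C T f k)"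
    and "\<exists>C. \<forall>f\<in>ell2 X. ell2_norm X (T f) \<le> C * ell2_norm X f"
  using assms by (auto simp: ell2_operators_def PiE_def)

lemma ell2_operatorsI:
  assumes "\<And>f. f \<in> ell2 X \<Longrightarrow> T f \<in> ell2 X"
    and "\<And>f g. f \<in> ell2 X \<Longrightarrow> g \<in> ell2 X \<Longrightarrow> T (\<lambda>k. f k + g k) = (\<lambda>k. T f k + T g k)"
    and "\<And>c f. f \<in> ell2 X \<Longrightarrow> T (\<lambda>k. c *\<^sub>C f k) = (\<lambda>k. c *\<^sub>C T f k)"
    and "\<And>f. f \<in> ell2 X \<Longrightarrow> ell2_norm X (T f) \<le> C * ell2_norm X f"
  shows "restrict T (ell2 X) \<in> ell2_operators X"
proof -
  have "\<exists>C. \<forall>f\<in>ell2 X. ell2_norm X (T f) \<le> C * ell2_norm X f" using assms(4) by blast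
  then show ?thesis using assms(1-3) by (auto simp: ell2_operators_def ell2_add ell2_scaleC)
qed

text \<open>The \<open>anorm\<close> field of \<open>ell2_operator_algebra\<close>, named so that it
  can be used apart from the record.\<close>

definition ell2_op_norm ::
    "(real^'d) set \<Rightarrow> ((real^'d \<Rightarrow> 'h::complex_hilbert) \<Rightarrow> (real^'d \<Rightarrow> 'h)) \<Rightarrow> real" where
  "ell2_op_norm X T = (SUP f\<in>{f \<in> ell2 X. ell2_norm X f \<le> 1}. ell2_norm X (T f))"

lemma ell2_op_norm_nonneg_bdd:
  assumes "T \<in> ell2_operators X"
  shows "bdd_above ((\<lambda>f. ell2_norm X (T f)) ` {f \<in> ell2 X. ell2_norm X f \<le> 1})"
    and "0 \<le> ell2_op_norm X T"
proof -
  obtain C where C: "\<And>f. f \<in> ell2 X \<Longrightarrow> ell2_norm X (T f) \<le> C * ell2_norm X f"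
    using ell2_operatorsD(5)[OF assms] by blast
  have "ell2_norm X (T f) \<le> \<bar>C\<bar>" if "f \<in> ell2 X" "ell2_norm X f \<le> 1" for f
  proof -
    have "C * ell2_norm X f \<le> \<bar>C\<bar> * ell2_norm X f" by (intro mult_right_mono) auto
    also have "\<dots> \<le> \<bar>C\<bar>" using that by (simp add: mult_left_le)
    finally show ?thesis using C[OF that(1)] by simp
  qed
  then show bdd: "bdd_above ((\<lambda>f. ell2_norm X (T f)) ` {f \<in> ell2 X. ell2_norm X f \<le> 1})"
    by (auto intro!: bdd_aboveI2)
  have "0 \<le> ell2_norm X (T (\<lambda>k. 0))" by simp
  also have "\<dots> \<le> ell2_op_norm X T"
    unfolding ell2_op_norm_def using bdd by (intro cSUP_upper) (auto simp: ell2_zero)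
  finally show "0 \<le> ell2_op_norm X T" .
qed

lemma ell2_op_norm_bound:
  assumes "T \<in> ell2_operators X" "f \<in> ell2 X"
  shows "ell2_norm X (T f) \<le> ell2_op_norm X T * ell2_norm X f"
proof (cases "ell2_norm X f = 0")
  case True
  then have "f = (\<lambda>k. 0)" using ell2_norm_eq_0D assms(2) by blast
  then have "T f = (\<lambda>k. 0)"
    using ell2_operatorsD(4)[OF assms(1) ell2_zero, of 0] by (simp add: scaleC_zero_left)
  then show ?thesis using True by simp
next
  case False
  define c where "c = complex_of_real (inverse (ell2_norm X f))"
  have c: "cmod c = inverse (ell2_norm X f)" by (simp add: c_def norm_inverse)
  have "ell2_norm X (\<lambda>k. c *\<^sub>C f k) \<le> 1"
    using False assms by (simp add: ell2_norm_scaleC c)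
  then have "ell2_norm X (T (\<lambda>k. c *\<^sub>C f k)) \<le> ell2_op_norm X T"
    unfolding ell2_op_norm_def
    using assms by (intro cSUP_upper ell2_op_norm_nonneg_bdd(1)) (auto simp: ell2_scaleC)
  then have "inverse (ell2_norm X f) * ell2_norm X (T f) \<le> ell2_op_norm X T"
    using assms by (simp add: ell2_operatorsD ell2_norm_scaleC c)
  then have "inverse (ell2_norm X f) * ell2_norm X (T f) * ell2_norm X f \<le> ell2_op_norm X T * ell2_norm X f"
    by (rule mult_right_mono) simp
  then show ?thesis using False by (simp add: field_simps)
qed

lemma ell2_op_norm_leI:
  fixes T :: "(real^'d \<Rightarrow> 'h::complex_hilbert) \<Rightarrow> (real^'d \<Rightarrow> 'h)"
  assumes "\<And>f. f \<in> ell2 X \<Longrightarrow> ell2_norm X (T f) \<le> c * ell2_norm X f" "0 \<le> c"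
  shows "ell2_op_norm X T \<le> c"
  unfolding ell2_op_norm_def
proof (rule cSUP_least)
  have "(\<lambda>k. 0 :: 'h) \<in> {f \<in> ell2 X. ell2_norm X f \<le> 1}" by (simp add: ell2_zero)
  then show "{f :: real^'d \<Rightarrow> 'h. f \<in> ell2 X \<and> ell2_norm X f \<le> 1} \<noteq> {}" by blast
  fix f :: "real^'d \<Rightarrow> 'h" assume "f \<in> {f \<in> ell2 X. ell2_norm X f \<le> 1}"
  then show "ell2_norm X (T f) \<le> c"
    using assms(1)[of f] mult_left_le[OF _ assms(2), of "ell2_norm X f"] by force
qed

lemma ell2_operators_zero: "(\<lambda>f\<in>ell2 X. \<lambda>k. 0) \<in> ell2_operators X"
  by (rule ell2_operatorsI[where C = 0]) (auto simp: ell2_zero scaleC_zero_right)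

lemma ell2_operators_one: "(\<lambda>f\<in>ell2 X. f) \<in> ell2_operators X"
  by (rule ell2_operatorsI[where C = 1]) auto

lemma
  assumes S: "S \<in> ell2_operators X" and T: "T \<in> ell2_operators X"
  shows ell2_operators_add: "(\<lambda>f\<in>ell2 X. \<lambda>k. S f k + T f k) \<in> ell2_operators X"
    and ell2_op_norm_add:
      "ell2_op_norm X (\<lambda>f\<in>ell2 X. \<lambda>k. S f k + T f k) \<le> ell2_op_norm X S + ell2_op_norm X T"
proof -
  have *: "ell2_norm X (\<lambda>k. S f k + T f k) \<le> (ell2_op_norm X S + ell2_op_norm X T) * ell2_norm X f"
    if "f \<in> ell2 X" for f
    using ell2_norm_triangle[of "S f" X "T f"] ell2_op_norm_bound[OF S that]
      ell2_op_norm_bound[OF T that] S T that by (simp add: ell2_operatorsD algebra_simps)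
  then show "(\<lambda>f\<in>ell2 X. \<lambda>k. S f k + T f k) \<in> ell2_operators X"
    using S T by (intro ell2_operatorsI) (auto simp: ell2_operatorsD ell2_add scaleC_add_right)
  show "ell2_op_norm X (\<lambda>f\<in>ell2 X. \<lambda>k. S f k + T f k) \<le> ell2_op_norm X S + ell2_op_norm X T"
    using * S T by (intro ell2_op_norm_leI) (auto simp: ell2_op_norm_nonneg_bdd)
qed

lemma
  assumes S: "S \<in> ell2_operators X" and T: "T \<in> ell2_operators X"
  shows ell2_operators_compose: "compose (ell2 X) S T \<in> ell2_operators X"
    and ell2_op_norm_compose:
      "ell2_op_norm X (compose (ell2 X) S T) \<le> ell2_op_norm X S * ell2_op_norm X T"
proof -
  have *: "ell2_norm X (S (T f)) \<le> (ell2_op_norm X S * ell2_op_norm X T) * ell2_norm X f"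
    if "f \<in> ell2 X" for f
    using order_trans[OF ell2_op_norm_bound[OF S ell2_operatorsD(2)[OF T that]]
        mult_left_mono[OF ell2_op_norm_bound[OF T that] ell2_op_norm_nonneg_bdd(2)[OF S]]]
    by (simp add: mult.assoc)
  then show "compose (ell2 X) S T \<in> ell2_operators X"
    unfolding compose_def
    using S T by (intro ell2_operatorsI) (auto simp: ell2_operatorsD)
  show "ell2_op_norm X (compose (ell2 X) S T) \<le> ell2_op_norm X S * ell2_op_norm X T"
    using * S T by (intro ell2_op_norm_leI) (auto simp: ell2_op_norm_nonneg_bdd compose_eq)
qed

lemma
  assumes T: "T \<in> ell2_operators X"
  shows ell2_operators_scaleC: "(\<lambda>f\<in>ell2 X. \<lambda>k. c *\<^sub>C T f k) \<in> ell2_operators X"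
    and ell2_op_norm_scaleC_le:
      "ell2_op_norm X (\<lambda>f\<in>ell2 X. \<lambda>k. c *\<^sub>C T f k) \<le> cmod c * ell2_op_norm X T"
proof -
  have *: "ell2_norm X (\<lambda>k. c *\<^sub>C T f k) \<le> (cmod c * ell2_op_norm X T) * ell2_norm X f"
    if "f \<in> ell2 X" for f
    using mult_left_mono[OF ell2_op_norm_bound[OF T that], of "cmod c"] T that
    by (simp add: ell2_norm_scaleC ell2_operatorsD mult.assoc)
  then show "(\<lambda>f\<in>ell2 X. \<lambda>k. c *\<^sub>C T f k) \<in> ell2_operators X"
    using T by (intro ell2_operatorsI[where C = "cmod c * ell2_op_norm X T"])
      (auto simp: ell2_operatorsD ell2_scaleC scaleC_add_right scaleC_scaleC mult.commute)
  show "ell2_op_norm X (\<lambda>f\<in>ell2 X. \<lambda>k. c *\<^sub>C T f k) \<le> cmod c * ell2_op_norm X T"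
    using * T by (intro ell2_op_norm_leI) (auto simp: ell2_op_norm_nonneg_bdd)
qed

text \<open>The missing inequality is \<open>ell2_op_norm_scaleC_le\<close> for
  \<open>inverse c\<close> and the scaled operator.\<close>

lemma ell2_op_norm_scaleC:
  assumes T: "T \<in> ell2_operators X"
  shows "ell2_op_norm X (\<lambda>f\<in>ell2 X. \<lambda>k. c *\<^sub>C T f k) = cmod c * ell2_op_norm X T"
proof (cases "c = 0")
  case True
  then show ?thesis
    using ell2_op_norm_scaleC_le[OF T, of c] ell2_op_norm_nonneg_bdd(2)[OF ell2_operators_scaleC[OF T, of c]]
    by simp
next
  case False
  let ?cT = "\<lambda>f\<in>ell2 X. \<lambda>k. c *\<^sub>C T f k"
  have "(\<lambda>f\<in>ell2 X. \<lambda>k. inverse c *\<^sub>C ?cT f k) = T"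
    using False T by (intro extensionalityI[where A = "ell2 X"])
      (auto simp: scaleC_scaleC scaleC_one ell2_operatorsD(1))
  then have "ell2_op_norm X T \<le> inverse (cmod c) * ell2_op_norm X ?cT"
    using ell2_op_norm_scaleC_le[OF ell2_operators_scaleC[OF T], of "inverse c" c]
    by (simp add: norm_inverse)
  then have "cmod c * ell2_op_norm X T \<le> ell2_op_norm X ?cT"
    using False by (simp add: field_simps)
  then show ?thesis using ell2_op_norm_scaleC_le[OF T, of c] by simp
qed

text \<open>A coordinate is dominated by the norm, so all coordinates of \<open>u n f\<close>
  converge. Coordinatewise convergence controls finitely many coordinates at a time; the Cauchy
  estimate is therefore passed to the limit on finite sets and reassembled by
  \<open>ell2_norm_leI\<close>.\<close>

lemma ell2_operators_complete:
  fixes u :: "nat \<Rightarrow> (real^'d \<Rightarrow> 'h::complex_hilbert) \<Rightarrow> (real^'d \<Rightarrow> 'h)"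
  assumes u: "\<And>n. u n \<in> ell2_operators X"
    and Cauchy: "\<And>e. 0 < e \<Longrightarrow> \<exists>N. \<forall>m\<ge>N. \<forall>n\<ge>N. \<forall>f\<in>ell2 X.
      ell2_norm X (\<lambda>k. u m f k - u n f k) \<le> e * ell2_norm X f"
  shows "\<exists>T\<in>ell2_operators X. \<forall>e>0. \<exists>N. \<forall>m\<ge>N. \<forall>f\<in>ell2 X.
      ell2_norm X (\<lambda>k. u m f k - T f k) \<le> e * ell2_norm X f"
proof -
  define T where "T f = (\<lambda>k. lim (\<lambda>n. u n f k))" for f
  have "Cauchy (\<lambda>n. u n f k)" if f: "f \<in> ell2 X" for f k
  proof (rule metric_CauchyI)
    fix e :: real assume "e > 0"
    \<comment> \<open>The \<open>+ 1\<close> keeps the quotient positive when \<open>f\<close> is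
      zero, where division by the norm would return 0.\<close>
    define e' where "e' = e / (ell2_norm X f + 1)"
    have "e' > 0" using \<open>e > 0\<close> by (simp add: e'_def add_nonneg_pos)
    then obtain N where N: "\<And>m n. m \<ge> N \<Longrightarrow> n \<ge> N \<Longrightarrow>
        ell2_norm X (\<lambda>k. u m f k - u n f k) \<le> e' * ell2_norm X f"
      using Cauchy f by metis
    have "e' * ell2_norm X f < e' * (ell2_norm X f + 1)" using \<open>e' > 0\<close> by simp
    also have "\<dots> = e" using ell2_norm_nonneg[of X f] by (simp add: e'_def add_nonneg_eq_0_iff)
    finally have "e' * ell2_norm X f < e" .
    then have "dist (u m f k) (u n f k) < e" if "m \<ge> N" "n \<ge> N" for m n
      using N[OF that] norm_le_ell2_norm[OF ell2_diff[of "u m f" X "u n f"], of k] f u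
      by (simp add: dist_norm ell2_operatorsD)
    then show "\<exists>N. \<forall>m\<ge>N. \<forall>n\<ge>N. dist (u m f k) (u n f k) < e" by blast
  qed
  then have lim: "(\<lambda>n. u n f k) \<longlonglongrightarrow> T f k" if "f \<in> ell2 X" for f k
    using that by (simp add: T_def Cauchy_convergent_iff convergent_LIMSEQ_iff)
  have u_eq_0: "u n f k = 0" if "f \<in> ell2 X" "k \<notin> X" for n f k
    by (rule ell2_eq_0[OF ell2_operatorsD(2)[OF u that(1)] that(2)])
  then have T_eq_0: "T f k = 0" if "f \<in> ell2 X" "k \<notin> X" for f k
    using lim[OF that(1), of k] that by (simp add: LIMSEQ_const_iff)
  have est: "(\<lambda>k. u m f k - T f k) \<in> ell2 X \<and>
      ell2_norm X (\<lambda>k. u m f k - T f k) \<le> e * ell2_norm X f"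
    if f: "f \<in> ell2 X"
      and N: "\<And>m n. m \<ge> N \<Longrightarrow> n \<ge> N \<Longrightarrow>
        ell2_norm X (\<lambda>k. u m f k - u n f k) \<le> e * ell2_norm X f"
      and "m \<ge> N" for f e N m
  proof -
    have "L2_set (\<lambda>k. norm (u m f k - T f k)) F \<le> e * ell2_norm X f" if F: "finite F" "F \<subseteq> X" for F
    proof (rule LIMSEQ_le_const2)
      show "(\<lambda>n. L2_set (\<lambda>k. norm (u m f k - u n f k)) F) \<longlonglongrightarrow> L2_set (\<lambda>k. norm (u m f k - T f k)) F"
        unfolding L2_set_def by (intro tendsto_intros lim f)
      have "L2_set (\<lambda>k. norm (u m f k - u n f k)) F \<le> e * ell2_norm X f" if "n \<ge> N" for n
        using N[OF \<open>m \<ge> N\<close> that] L2_set_le_ell2_norm[OF ell2_diff[of "u m f" X "u n f"] F] f u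
        by (simp add: ell2_operatorsD)
      then show "\<exists>M. \<forall>n\<ge>M. L2_set (\<lambda>k. norm (u m f k - u n f k)) F \<le> e * ell2_norm X f" by blast
    qed
    then show ?thesis
      using f u by (auto intro!: ell2I ell2_norm_leI simp: T_eq_0 u_eq_0)
  qed
  obtain N where N: "\<And>m n f. m \<ge> N \<Longrightarrow> n \<ge> N \<Longrightarrow> f \<in> ell2 X \<Longrightarrow>
      ell2_norm X (\<lambda>k. u m f k - u n f k) \<le> 1 * ell2_norm X f"
    using Cauchy[of 1] by (metis zero_less_one)
  \<comment> \<open>\<open>T f\<close> is \<open>u N f\<close> minus the difference
    \<open>u N f - T f\<close>, and both are square-summable.\<close>
  have T_ell2: "T f \<in> ell2 X" if "f \<in> ell2 X" for f
    using ell2_diff[OF ell2_operatorsD(2)[OF u[of N] that]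
        conjunct1[OF est[OF that N[OF _ _ that], of N N]]] by simp
  have "restrict T (ell2 X) \<in> ell2_operators X"
  proof (rule ell2_operatorsI)
    fix f g :: "real^'d \<Rightarrow> 'h" assume f: "f \<in> ell2 X"
    show "T f \<in> ell2 X" by (rule T_ell2[OF f])
    show "T (\<lambda>k. c *\<^sub>C f k) = (\<lambda>k. c *\<^sub>C T f k)" for c
    proof
      fix k
      have "(\<lambda>n. c *\<^sub>C u n f k) \<longlonglongrightarrow> T (\<lambda>k. c *\<^sub>C f k) k"
        using lim[OF ell2_scaleC[OF f], of c k] by (simp add: ell2_operatorsD(4)[OF u f])
      moreover have "(\<lambda>n. c *\<^sub>C u n f k) \<longlonglongrightarrow> c *\<^sub>C T f k"
        by (intro bounded_linear.tendsto[OF bounded_linear_scaleC] lim f)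
      ultimately show "T (\<lambda>k. c *\<^sub>C f k) k = c *\<^sub>C T f k" by (rule LIMSEQ_unique)
    qed
    show "T (\<lambda>k. f k + g k) = (\<lambda>k. T f k + T g k)" if g: "g \<in> ell2 X"
    proof
      fix k
      have "(\<lambda>n. u n f k + u n g k) \<longlonglongrightarrow> T (\<lambda>k. f k + g k) k"
        using lim[OF ell2_add[OF f g], of k] by (simp add: ell2_operatorsD(3)[OF u f g])
      moreover have "(\<lambda>n. u n f k + u n g k) \<longlonglongrightarrow> T f k + T g k"
        by (intro tendsto_intros lim f g)
      ultimately show "T (\<lambda>k. f k + g k) k = T f k + T g k" by (rule LIMSEQ_unique)
    qed
    have "ell2_norm X (\<lambda>k. (-1) *\<^sub>C (u N f k - T f k)) \<le> ell2_norm X f"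
      using est[OF f N[OF _ _ f], of N N] by (simp add: ell2_norm_scaleC)
    moreover have "ell2_norm X (T f)
        \<le> ell2_norm X (u N f) + ell2_norm X (\<lambda>k. (-1) *\<^sub>C (u N f k - T f k))"
      using ell2_norm_triangle[of "u N f" X "\<lambda>k. (-1) *\<^sub>C (u N f k - T f k)"] f u
      by (simp add: ell2_operatorsD ell2_scaleC ell2_diff T_ell2 scaleC_minus_one)
    ultimately show "ell2_norm X (T f) \<le> (ell2_op_norm X (u N) + 1) * ell2_norm X f"
      using ell2_op_norm_bound[OF u f, of N] by (simp add: distrib_right)
  qed
  moreover have "\<exists>N. \<forall>m\<ge>N. \<forall>f\<in>ell2 X.
      ell2_norm X (\<lambda>k. u m f k - restrict T (ell2 X) f k) \<le> e * ell2_norm X f" if e: "e > 0" for e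
  proof -
    obtain N where N: "\<And>m n f. m \<ge> N \<Longrightarrow> n \<ge> N \<Longrightarrow> f \<in> ell2 X \<Longrightarrow>
        ell2_norm X (\<lambda>k. u m f k - u n f k) \<le> e * ell2_norm X f"
      using Cauchy[OF e] by metis
    have "ell2_norm X (\<lambda>k. u m f k - T f k) \<le> e * ell2_norm X f" if "m \<ge> N" "f \<in> ell2 X" for m f
      using est[OF that(2) N[OF _ _ that(2)] that(1)] by blast
    then show ?thesis by auto
  qed
  ultimately show ?thesis by blast
qed

lemma ell2_operator_algebra_simps:
  "carrier (ell2_operator_algebra X) = ell2_operators X"
  "mult (ell2_operator_algebra X) = compose (ell2 X)"
  "one (ell2_operator_algebra X) = (\<lambda>f\<in>ell2 X. f)"
  "zero (ell2_operator_algebra X) = (\<lambda>f\<in>ell2 X. \<lambda>k. 0)"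
  "add (ell2_operator_algebra X) = (\<lambda>S T. \<lambda>f\<in>ell2 X. \<lambda>k. S f k + T f k)"
  "smult (ell2_operator_algebra X) = (\<lambda>c T. \<lambda>f\<in>ell2 X. \<lambda>k. c *\<^sub>C T f k)"
  "anorm (ell2_operator_algebra X) = ell2_op_norm X"
  by (simp_all add: ell2_operator_algebra_def ell2_op_norm_def fun_eq_iff)

lemma abelian_group_ell2_operator_algebra: "abelian_group (ell2_operator_algebra X)"
proof (rule abelian_groupI, unfold ell2_operator_algebra_simps)
  fix S assume S: "S \<in> ell2_operators X"
  show "\<exists>T\<in>ell2_operators X. (\<lambda>f\<in>ell2 X. \<lambda>k. T f k + S f k) = (\<lambda>f\<in>ell2 X. \<lambda>k. 0)"
    using S by (intro bexI[of _ "\<lambda>f\<in>ell2 X. \<lambda>k. (-1) *\<^sub>C S f k"] ell2_operators_scaleC)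
      (auto simp: scaleC_minus_one cong: restrict_cong)
  show "(\<lambda>f\<in>ell2 X. \<lambda>k. (\<lambda>f\<in>ell2 X. \<lambda>k. 0) f k + S f k) = S"
    using S by (intro extensionalityI[where A = "ell2 X"]) (auto simp: ell2_operatorsD(1))
qed (auto simp: ell2_operators_add ell2_operators_zero ac_simps cong: restrict_cong)

lemma ell2_operator_algebra_minus:
  assumes "S \<in> ell2_operators X" "T \<in> ell2_operators X"
  shows "S \<ominus>\<^bsub>ell2_operator_algebra X\<^esub> T = (\<lambda>f\<in>ell2 X. \<lambda>k. S f k - T f k)"
proof -
  interpret abelian_group "ell2_operator_algebra X"
    by (rule abelian_group_ell2_operator_algebra)
  have "\<ominus>\<^bsub>ell2_operator_algebra X\<^esub> T = (\<lambda>f\<in>ell2 X. \<lambda>k. (-1) *\<^sub>C T f k)"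
    using assms(2) ell2_operators_scaleC[OF assms(2), of "-1"] by (intro minus_equality)
      (auto simp: ell2_operator_algebra_simps ell2_operators_scaleC scaleC_minus_one cong: restrict_cong)
  then show ?thesis
    by (auto simp: a_minus_def ell2_operator_algebra_simps scaleC_minus_one cong: restrict_cong)
qed

lemma ring_ell2_operator_algebra: "ring (ell2_operator_algebra X)"
proof (rule ringI[OF abelian_group_ell2_operator_algebra])
  show "monoid (ell2_operator_algebra X)"
    by (rule monoidI, unfold ell2_operator_algebra_simps)
       (auto intro!: extensionalityI[where A = "ell2 X"]
         simp: ell2_operators_compose ell2_operators_one compose_eq ell2_operatorsD)
qed (auto intro!: extensionalityI[where A = "ell2 X"]
      simp: ell2_operator_algebra_simps ell2_operators_compose ell2_operators_add compose_eq ell2_operatorsD)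

lemma module_ell2_operator_algebra: "Module.module complex_ring (ell2_operator_algebra X)"
  by (rule moduleI[OF cring_complex_ring abelian_group_ell2_operator_algebra])
     (auto intro!: extensionalityI[where A = "ell2 X"]
       simp: ell2_operator_algebra_simps complex_ring_def ell2_operators_add ell2_operators_scaleC
         ell2_operatorsD scaleC_add_left scaleC_add_right scaleC_scaleC scaleC_one)

lemma unital_banach_algebra_ell2_operator_algebra:
  "unital_banach_algebra (ell2_operator_algebra X :: ((real^'d \<Rightarrow> 'h::complex_hilbert) \<Rightarrow> _) normed_algebra)"
    (is "unital_banach_algebra ?B")
proof (intro unital_banach_algebra.intro ring_ell2_operator_algebra module_ell2_operator_algebra
    unital_banach_algebra_axioms.intro)
  fix x :: "(real^'d \<Rightarrow> 'h) \<Rightarrow> (real^'d \<Rightarrow> 'h)" and c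
  assume "x \<in> carrier ?B"
  then have x: "x \<in> ell2_operators X" by (simp add: ell2_operator_algebra_simps)
  show "0 \<le> anorm ?B x" using x by (simp add: ell2_operator_algebra_simps ell2_op_norm_nonneg_bdd)
  show "anorm ?B x = 0 \<longleftrightarrow> x = \<zero>\<^bsub>?B\<^esub>"
  proof
    assume "anorm ?B x = 0"
    then have "ell2_norm X (x f) = 0" if "f \<in> ell2 X" for f
      using ell2_op_norm_bound[OF x that] by (simp add: ell2_operator_algebra_simps order_antisym)
    then have "x f = (\<lambda>k. 0)" if "f \<in> ell2 X" for f
      using that x by (intro ell2_norm_eq_0D) (auto simp: ell2_operatorsD)
    then show "x = \<zero>\<^bsub>?B\<^esub>"
      unfolding ell2_operator_algebra_simps
      using x by (intro extensionalityI[where A = "ell2 X"]) (auto simp: ell2_operatorsD(1))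
  next
    assume "x = \<zero>\<^bsub>?B\<^esub>"
    then have "ell2_op_norm X x \<le> 0"
      by (intro ell2_op_norm_leI) (auto simp: ell2_operator_algebra_simps)
    then show "anorm ?B x = 0"
      using ell2_op_norm_nonneg_bdd(2)[OF x] by (simp add: ell2_operator_algebra_simps)
  qed
  show "anorm ?B (c \<odot>\<^bsub>?B\<^esub> x) = cmod c * anorm ?B x"
    using x by (simp add: ell2_operator_algebra_simps ell2_op_norm_scaleC)
  fix y assume "y \<in> carrier ?B"
  then have y: "y \<in> ell2_operators X" by (simp add: ell2_operator_algebra_simps)
  show "(c \<odot>\<^bsub>?B\<^esub> x) \<otimes>\<^bsub>?B\<^esub> y = c \<odot>\<^bsub>?B\<^esub> (x \<otimes>\<^bsub>?B\<^esub> y)"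
    and "x \<otimes>\<^bsub>?B\<^esub> (c \<odot>\<^bsub>?B\<^esub> y) = c \<odot>\<^bsub>?B\<^esub> (x \<otimes>\<^bsub>?B\<^esub> y)"
    using x y by (auto intro!: extensionalityI[where A = "ell2 X"] simp: ell2_operator_algebra_simps
        ell2_operators_compose ell2_operators_scaleC compose_eq ell2_operatorsD)
  show "anorm ?B (x \<oplus>\<^bsub>?B\<^esub> y) \<le> anorm ?B x + anorm ?B y"
    and "anorm ?B (x \<otimes>\<^bsub>?B\<^esub> y) \<le> anorm ?B x * anorm ?B y"
    using x y by (simp_all add: ell2_operator_algebra_simps ell2_op_norm_add ell2_op_norm_compose)
next
  assume ne: "\<one>\<^bsub>?B\<^esub> \<noteq> \<zero>\<^bsub>?B\<^esub>"
  let ?I = "\<lambda>f\<in>ell2 X. f :: real^'d \<Rightarrow> 'h"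
  \<comment> \<open>A nonzero family is what forces the norm of the identity up to 1; without one
    the algebra is zero.\<close>
  have "\<exists>f :: real^'d \<Rightarrow> 'h. f \<in> ell2 X \<and> f \<noteq> (\<lambda>k. 0)"
  proof (rule ccontr)
    assume "\<not> ?thesis"
    then have "?I = (\<lambda>f\<in>ell2 X. \<lambda>k. 0)" by (intro restrict_ext) blast
    then show False using ne by (simp add: ell2_operator_algebra_simps)
  qed
  then obtain f :: "real^'d \<Rightarrow> 'h" where f: "f \<in> ell2 X" "f \<noteq> (\<lambda>k. 0)" by blast
  then have "ell2_norm X f > 0" using ell2_norm_eq_0D less_eq_real_def by fastforce
  moreover have "ell2_norm X (?I f) \<le> ell2_op_norm X ?I * ell2_norm X f"
    by (rule ell2_op_norm_bound[OF ell2_operators_one f(1)])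
  ultimately have "1 \<le> ell2_op_norm X ?I" using f by simp
  moreover have "ell2_op_norm X ?I \<le> 1" by (rule ell2_op_norm_leI) auto
  ultimately show "anorm ?B \<one>\<^bsub>?B\<^esub> = 1" by (simp add: ell2_operator_algebra_simps)
next
  fix u :: "nat \<Rightarrow> (real^'d \<Rightarrow> 'h) \<Rightarrow> (real^'d \<Rightarrow> 'h)"
  assume "\<And>n. u n \<in> carrier ?B"
  then have u: "\<And>n. u n \<in> ell2_operators X" by (simp add: ell2_operator_algebra_simps)
  have closed: "(\<lambda>f\<in>ell2 X. \<lambda>k. S f k - T f k) \<in> ell2_operators X"
    if "S \<in> ell2_operators X" "T \<in> ell2_operators X" for S T :: "(real^'d \<Rightarrow> 'h) \<Rightarrow> (real^'d \<Rightarrow> 'h)"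
    using abelian_group.minus_closed[OF abelian_group_ell2_operator_algebra, of S X T] that
    by (simp add: ell2_operator_algebra_simps ell2_operator_algebra_minus)
  assume C: "\<And>e. 0 < e \<Longrightarrow> \<exists>N. \<forall>m\<ge>N. \<forall>n\<ge>N. anorm ?B (u m \<ominus>\<^bsub>?B\<^esub> u n) < e"
  have "\<exists>T\<in>ell2_operators X. \<forall>e>0. \<exists>N. \<forall>m\<ge>N. \<forall>f\<in>ell2 X.
      ell2_norm X (\<lambda>k. u m f k - T f k) \<le> e * ell2_norm X f"
  proof (rule ell2_operators_complete[OF u])
    fix e :: real assume "e > 0"
    then obtain N where N: "\<And>m n. m \<ge> N \<Longrightarrow> n \<ge> N \<Longrightarrow> anorm ?B (u m \<ominus>\<^bsub>?B\<^esub> u n) < e"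
      using C by blast
    have "ell2_norm X (\<lambda>k. u m f k - u n f k) \<le> e * ell2_norm X f"
      if "m \<ge> N" "n \<ge> N" "f \<in> ell2 X" for m n f
    proof -
      have "ell2_norm X (\<lambda>k. u m f k - u n f k)
          \<le> ell2_op_norm X (\<lambda>f\<in>ell2 X. \<lambda>k. u m f k - u n f k) * ell2_norm X f"
        using ell2_op_norm_bound[OF closed[OF u u] that(3), of m n] that(3) by simp
      also have "\<dots> \<le> e * ell2_norm X f"
        using N[OF that(1,2)] u
        by (intro mult_right_mono) (auto simp: ell2_operator_algebra_minus ell2_operator_algebra_simps)
      finally show ?thesis .
    qed
    then show "\<exists>N. \<forall>m\<ge>N. \<forall>n\<ge>N. \<forall>f\<in>ell2 X.
        ell2_norm X (\<lambda>k. u m f k - u n f k) \<le> e * ell2_norm X f" by blast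
  qed
  then obtain T where T: "T \<in> ell2_operators X"
    and lim: "\<And>e. e > 0 \<Longrightarrow> \<exists>N. \<forall>m\<ge>N. \<forall>f\<in>ell2 X.
      ell2_norm X (\<lambda>k. u m f k - T f k) \<le> e * ell2_norm X f" by blast
  have "(\<lambda>n. anorm ?B (u n \<ominus>\<^bsub>?B\<^esub> T)) \<longlonglongrightarrow> 0"
  proof (rule LIMSEQ_I)
    fix r :: real assume "r > 0"
    then obtain N where N: "\<And>m f. m \<ge> N \<Longrightarrow> f \<in> ell2 X \<Longrightarrow>
        ell2_norm X (\<lambda>k. u m f k - T f k) \<le> r/2 * ell2_norm X f"
      using lim[of "r/2"] by auto
    have "ell2_op_norm X (\<lambda>f\<in>ell2 X. \<lambda>k. u n f k - T f k) \<le> r/2" if "n \<ge> N" for n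
      using N[OF that] \<open>r > 0\<close> by (intro ell2_op_norm_leI) auto
    then show "\<exists>N. \<forall>n\<ge>N. norm (anorm ?B (u n \<ominus>\<^bsub>?B\<^esub> T) - 0) < r"
      using u T \<open>r > 0\<close> closed[OF u T]
      by (intro exI[of _ N]) (force simp: ell2_operator_algebra_minus ell2_operator_algebra_simps
          ell2_op_norm_nonneg_bdd)
  qed
  then show "\<exists>x\<in>carrier ?B. (\<lambda>n. anorm ?B (u n \<ominus>\<^bsub>?B\<^esub> x)) \<longlonglongrightarrow> 0"
    using T by (auto simp: ell2_operator_algebra_simps)
qed

section \<open>Polynomial weights on relatively separated sets\<close>

text \<open>The absolute value is injective on the nonnegative and on the negative integers, so each
  of the two halves is dominated by one copy of the convergent series \<open>G\<close>.\<close>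

lemma sum_int_powr_bounded:
  fixes p :: real
  assumes "p > 1"
  shows "\<exists>S. \<forall>A :: int set. finite A \<longrightarrow> (\<Sum>m\<in>A. (1 + \<bar>real_of_int m\<bar>) powr (-p)) \<le> S"
proof -
  define G where "G n = (1 + real n) powr (-p)" for n
  have "summable (\<lambda>n. real (Suc n) powr (-p))"
    using assms by (subst summable_Suc_iff) (simp add: summable_real_powr_iff)
  then have "summable G" by (simp add: G_def[abs_def])
  have le: "(\<Sum>m\<in>A. (1 + \<bar>real_of_int m\<bar>) powr (-p)) \<le> suminf G"
    if "finite A" "inj_on (\<lambda>m. nat \<bar>m\<bar>) A" for A :: "int set"
  proof -
    have "(\<Sum>m\<in>A. (1 + \<bar>real_of_int m\<bar>) powr (-p)) = (\<Sum>n\<in>(\<lambda>m. nat \<bar>m\<bar>) ` A. G n)"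
      using that by (subst sum.reindex) (auto simp: G_def)
    also have "\<dots> \<le> suminf G"
      using that \<open>summable G\<close> by (intro sum_le_suminf) (auto simp: G_def[abs_def])
    finally show ?thesis .
  qed
  have "(\<Sum>m\<in>A. (1 + \<bar>real_of_int m\<bar>) powr (-p)) \<le> suminf G + suminf G" if "finite A" for A :: "int set"
  proof -
    have "(\<Sum>m\<in>A. (1 + \<bar>real_of_int m\<bar>) powr (-p))
        = (\<Sum>m\<in>A \<inter> {0..}. (1 + \<bar>real_of_int m\<bar>) powr (-p)) + (\<Sum>m\<in>A - {0..}. (1 + \<bar>real_of_int m\<bar>) powr (-p))"
      using that by (rule sum.Int_Diff)
    also have "\<dots> \<le> suminf G + suminf G"
      using that by (intro add_mono le) (auto simp: inj_on_def)
    finally show ?thesis .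
  qed
  then show ?thesis by blast
qed

text \<open>Points of \<open>X\<close> are grouped by the integer parts of their coordinates relative to \<open>k\<close>, and the
  weight is dominated by a product of one-dimensional weights with exponent \<open>t / CARD('d) > 1\<close>.\<close>

lemma relatively_separated_sum_bounded:
  fixes X :: "(real^'d) set" and t :: real
  assumes X: "relatively_separated X" and t: "t > real CARD('d)"
  shows "\<exists>K. \<forall>k. \<forall>F. finite F \<longrightarrow> F \<subseteq> X \<longrightarrow> (\<Sum>n\<in>F. (1 + norm (k - n)) powr (-t)) \<le> K"
proof -
  define p where "p = t / real CARD('d)"
  have p: "p > 1" using t by (simp add: p_def)
  have tp: "t = p * real CARD('d)" by (simp add: p_def)
  obtain N where N: "\<And>x. finite (X \<inter> (+) x ` cbox 0 1) \<and> card (X \<inter> (+) x ` cbox 0 1) \<le> N"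
    using X unfolding relatively_separated_def by blast
  define g where "g m = (1 + \<bar>real_of_int m\<bar>) powr (-p)" for m
  obtain S where S: "\<And>A. finite A \<Longrightarrow> (\<Sum>m\<in>A. g m) \<le> S"
    using sum_int_powr_bounded[OF p] unfolding g_def by blast
  have g_nonneg: "g m \<ge> 0" for m by (simp add: g_def)
  have "S \<ge> 0" using S[of "{}"] by simp
  define h where "h v = (\<Prod>i\<in>UNIV. g (v i))" for v :: "'d \<Rightarrow> int"
  have h_nonneg: "h v \<ge> 0" for v by (simp add: h_def g_nonneg prod_nonneg)
  have "(\<Sum>n\<in>F. (1 + norm (k - n)) powr (-t)) \<le> 2 powr t * (real N * S ^ CARD('d))"
    if F: "finite F" "F \<subseteq> X" for k F
  proof -
    define z where "z n = (\<lambda>i. \<lfloor>(n - k) $ i\<rfloor>)" for n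
    have w_le: "(1 + norm (k - n)) powr (-t) \<le> 2 powr t * h (z n)" for n
    proof -
      have "(1 + norm (k - n)) powr (-p) \<le> 2 powr p * g (z n i)" for i
      proof -
        have "\<bar>(n - k) $ i\<bar> \<le> norm (k - n)"
          using component_le_norm_cart[of "n - k" i] by (simp add: norm_minus_commute)
        \<comment> \<open>Taking the floor changes a coordinate by at most 1, and
          \<open>2 + norm (k - n) \<le> 2 * (1 + norm (k - n))\<close>. This is the origin of the
          factor 2.\<close>
        then have "\<bar>real_of_int \<lfloor>(n - k) $ i\<rfloor>\<bar> \<le> norm (k - n) + 1"
          by (rule order_trans[rotated, OF add_right_mono]) linarith
        then have "(1 + \<bar>real_of_int (z n i)\<bar>) / 2 \<le> 1 + norm (k - n)"
          using norm_ge_zero[of "k - n"] unfolding z_def by argo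
        then have "(1 + norm (k - n)) powr (-p) \<le> ((1 + \<bar>real_of_int (z n i)\<bar>) / 2) powr (-p)"
          using p by (intro powr_mono2') auto
        also have "\<dots> = 2 powr p * g (z n i)"
          by (simp add: g_def powr_divide powr_minus field_simps)
        finally show ?thesis .
      qed
      \<comment> \<open>The same bound is used once for each coordinate; multiplying the
        \<open>CARD('d)\<close> copies turns the exponent \<open>p\<close> into
        \<open>t\<close>.\<close>
      then have "(\<Prod>i\<in>(UNIV::'d set). (1 + norm (k - n)) powr (-p)) \<le> (\<Prod>i\<in>UNIV. 2 powr p * g (z n i))"
        by (intro prod_mono) auto
      moreover have "(\<Prod>i\<in>(UNIV::'d set). (1 + norm (k - n)) powr (-p)) = (1 + norm (k - n)) powr (-t)"
        using add_pos_nonneg[of 1 "norm (k - n)"] powr_power[of "1 + norm (k - n)" "-p" "CARD('d)"]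
        by (simp add: tp mult.commute)
      moreover have "(\<Prod>i\<in>(UNIV::'d set). 2 powr p * g (z n i)) = 2 powr t * h (z n)"
        by (simp add: tp h_def prod.distrib powr_power mult.commute)
      ultimately show ?thesis by simp
    qed
    \<comment> \<open>Points with equal integer parts lie in one translate of the unit cube, where
      relative separation bounds their number.\<close>
    have fibre: "real (card {n \<in> F. z n = v}) \<le> real N" for v
    proof -
      let ?x = "k + (\<chi> i. real_of_int (v i))"
      have "{n \<in> F. z n = v} \<subseteq> X \<inter> (+) ?x ` cbox 0 1"
      proof
        fix n assume n: "n \<in> {n \<in> F. z n = v}"
        have "0 \<le> (n - ?x) $ i \<and> (n - ?x) $ i \<le> 1" for i
          using n by (auto simp: z_def) linarith+
        then have "n - ?x \<in> cbox 0 1" by (simp add: mem_box_cart)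
        then have "n \<in> (+) ?x ` cbox 0 1" by (intro image_eqI[of _ _ "n - ?x"]) auto
        then show "n \<in> X \<inter> (+) ?x ` cbox 0 1" using n F by auto
      qed
      then have "card {n \<in> F. z n = v} \<le> card (X \<inter> (+) ?x ` cbox 0 1)"
        using N by (intro card_mono) auto
      then show ?thesis using N[of ?x] by linarith
    qed
    define A where "A = (\<Union>i. (\<lambda>n. z n i) ` F)"
    have "finite A" using F by (simp add: A_def)
    have "(\<Sum>n\<in>F. h (z n)) = (\<Sum>v\<in>z ` F. \<Sum>n\<in>{n \<in> F. z n = v}. h (z n))"
      using F(1) by (rule sum.image_gen)
    also have "\<dots> = (\<Sum>v\<in>z ` F. real (card {n \<in> F. z n = v}) * h v)"
      by (intro sum.cong) auto
    also have "\<dots> \<le> (\<Sum>v\<in>z ` F. real N * h v)"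
      by (intro sum_mono mult_right_mono fibre h_nonneg)
    also have "\<dots> = real N * (\<Sum>v\<in>z ` F. h v)" by (simp add: sum_distrib_left)
    \<comment> \<open>The occurring integer vectors are enlarged to the full box over
      \<open>A\<close>, because a sum over a box of a product of functions of one coordinate
      factors.\<close>
    also have "(\<Sum>v\<in>z ` F. h v) \<le> (\<Sum>v\<in>PiE UNIV (\<lambda>_. A). h v)"
      using \<open>finite A\<close> by (intro sum_mono2 finite_PiE) (auto simp: A_def h_nonneg)
    also have "\<dots> = (\<Prod>i\<in>(UNIV::'d set). \<Sum>m\<in>A. g m)"
      unfolding h_def using \<open>finite A\<close> by (subst prod_sum_PiE) auto
    also have "\<dots> \<le> S ^ CARD('d)"
      using S[OF \<open>finite A\<close>] by (auto intro!: power_mono sum_nonneg g_nonneg)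
    finally have "(\<Sum>n\<in>F. h (z n)) \<le> real N * S ^ CARD('d)" by (simp add: mult_left_mono)
    then show ?thesis
      using sum_mono[of F "\<lambda>n. (1 + norm (k - n)) powr (-t)" "\<lambda>n. 2 powr t * h (z n)"] w_le
      by (simp add: sum_distrib_left[symmetric]) (meson mult_left_mono order_trans powr_ge_zero)
  qed
  then show ?thesis by blast
qed

section \<open>Elementary properties of the weight\<close>

definition weight :: "real \<Rightarrow> real^'d \<Rightarrow> real^'d \<Rightarrow> real" where
  "weight t k l = (1 + norm (k - l)) powr (-t)"

lemma weight_commute: "weight t k l = weight t l k"
  by (simp add: weight_def norm_minus_commute)

lemma weight_pos: "0 < weight t k l"
  unfolding weight_def by (smt (verit) norm_ge_zero powr_gt_zero)

lemma weight_nonneg [simp]: "0 \<le> weight t k l"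
  by (simp add: weight_def)

lemma weight_le_1: "t \<ge> 0 \<Longrightarrow> weight t k l \<le> 1"
  unfolding weight_def by (simp add: powr_le1 powr_minus inverse_le_1_iff ge_one_powr_ge_zero)

lemma weight_self [simp]: "weight t k k = 1"
  by (simp add: weight_def)

lemma weight_powr: "weight t k l powr a = weight (t * a) k l"
  by (simp add: weight_def powr_powr)

text \<open>On the way from \<open>k\<close> over \<open>n\<close> to \<open>l\<close> the longer
  leg has at least half the direct length, up to the shift by 1. Its weight can be traded for
  \<open>weight s k l\<close> at the cost of \<open>2 powr s\<close>, and the weight of the other
  leg remains available for summation over \<open>n\<close>.\<close>

lemma weight_quasi_triangle:
  assumes "s \<ge> 0"
  shows "weight s k n * weight s n l \<le> 2 powr s * weight s k l * (weight s k n + weight s n l)"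
proof -
  define a b c where "a = 1 + norm (k - n)" and "b = 1 + norm (n - l)" and "c = 1 + norm (k - l)"
  have "a \<ge> 1" "b \<ge> 1" "c \<ge> 1" by (auto simp: a_def b_def c_def)
  have "c \<le> 2 * max a b"
    using norm_triangle_ineq[of "k - n" "n - l"] by (auto simp: a_def b_def c_def max_def)
  then have "c powr s \<le> (2 * max a b) powr s"
    using assms \<open>c \<ge> 1\<close> by (intro powr_mono2) auto
  also have "\<dots> = 2 powr s * max a b powr s"
    using \<open>a \<ge> 1\<close> by (simp add: powr_mult)
  also have "max a b powr s \<le> a powr s + b powr s"
    using \<open>a \<ge> 1\<close> \<open>b \<ge> 1\<close> by (auto simp: max_def)
  finally have le: "c powr s \<le> 2 powr s * (a powr s + b powr s)" by (simp add: mult_left_mono)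
  have pos: "a powr s > 0" "b powr s > 0" "c powr s > 0"
    using \<open>a \<ge> 1\<close> \<open>b \<ge> 1\<close> \<open>c \<ge> 1\<close> by auto
  have "inverse (a powr s) * inverse (b powr s)
      = c powr s * (inverse (a powr s) * inverse (b powr s) * inverse (c powr s))"
    using pos by simp
  also have "\<dots> \<le> 2 powr s * (a powr s + b powr s) * (inverse (a powr s) * inverse (b powr s) * inverse (c powr s))"
    using pos by (intro mult_right_mono le) auto
  also have "\<dots> = 2 powr s * inverse (c powr s) * (inverse (a powr s) + inverse (b powr s))"
    using pos by (simp add: field_simps)
  finally show ?thesis
    by (simp add: weight_def powr_minus a_def b_def c_def)
qed

section \<open>Matrices with polynomial off-diagonal decay\<close>

lemma
  fixes f :: "'a \<Rightarrow> 'b::banach" and g :: "'a \<Rightarrow> real"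
  assumes "g summable_on A" "\<And>x. x \<in> A \<Longrightarrow> norm (f x) \<le> g x"
  shows summable_on_dominated: "f summable_on A"
    and norm_infsum_dominated: "norm (infsum f A) \<le> infsum g A"
proof -
  show "f summable_on A"
    using Infinite_Sum.abs_summable_on_comparison_test'[OF assms] by (rule abs_summable_summable)
  then show "norm (infsum f A) \<le> infsum g A"
    using assms by (intro norm_infsum_le[OF has_sum_infsum has_sum_infsum])
qed

lemma
  fixes f :: "'i \<Rightarrow> 'a \<Rightarrow> 'b::real_normed_vector"
  assumes "finite F" "\<And>i. i \<in> F \<Longrightarrow> f i summable_on A"
  shows summable_on_sum: "(\<lambda>x. \<Sum>i\<in>F. f i x) summable_on A"
    and infsum_sum: "(\<Sum>\<^sub>\<infinity>x\<in>A. \<Sum>i\<in>F. f i x) = (\<Sum>i\<in>F. infsum (f i) A)"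
proof -
  have "((\<lambda>x. \<Sum>i\<in>F. f i x) has_sum (\<Sum>i\<in>F. infsum (f i) A)) A"
    using assms by (induction rule: finite_induct) (auto intro!: has_sum_add)
  then show "(\<lambda>x. \<Sum>i\<in>F. f i x) summable_on A"
    and "(\<Sum>\<^sub>\<infinity>x\<in>A. \<Sum>i\<in>F. f i x) = (\<Sum>i\<in>F. infsum (f i) A)"
    by (auto simp: has_sum_iff)
qed

text \<open>A real version of the extended norm. It is faithful on \<open>jaffard_space\<close>,
  where the supremum is finite.\<close>

definition jaffard_bound ::
    "(real^'d) set \<Rightarrow> real \<Rightarrow> ('d, 'h::complex_hilbert) op_matrix \<Rightarrow> real" where
  "jaffard_bound X s A = enn2real (jaffard_norm X s A)"

lemma jaffard_norm_le_iff:
  assumes "0 \<le> c"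
  shows "jaffard_norm X s A \<le> ennreal c \<longleftrightarrow> (\<forall>k\<in>X. \<forall>l\<in>X. norm (A k l) \<le> c * weight s k l)"
proof -
  have "norm (A k l) * (1 + norm (k - l)) powr s \<le> c \<longleftrightarrow> norm (A k l) \<le> c * weight s k l" for k l
  proof -
    have "(1 + norm (k - l)) powr s > 0"
      using add_pos_nonneg[of 1 "norm (k - l)"] by simp
    then show ?thesis by (simp add: weight_def powr_minus_divide pos_le_divide_eq)
  qed
  then show ?thesis using assms by (simp add: jaffard_norm_def SUP_le_iff ennreal_le_iff)
qed

lemma jaffard_bound_nonneg [simp]: "0 \<le> jaffard_bound X s A"
  by (simp add: jaffard_bound_def)

lemma jaffard_norm_eq_bound:
  "A \<in> jaffard_space X s \<Longrightarrow> jaffard_norm X s A = ennreal (jaffard_bound X s A)"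
  by (auto simp: jaffard_bound_def jaffard_space_def)

lemma jaffard_spaceD:
  assumes "A \<in> jaffard_space X s"
  shows "A k l \<in> bounded_operators" "k \<notin> X \<Longrightarrow> A k l = 0" "l \<notin> X \<Longrightarrow> A k l = 0"
  using assms by (auto simp: jaffard_space_def)

lemma jaffard_entry_bound:
  assumes "A \<in> jaffard_space X s"
  shows "norm (A k l) \<le> jaffard_bound X s A * weight s k l"
proof (cases "k \<in> X \<and> l \<in> X")
  case True
  have "jaffard_norm X s A \<le> ennreal (jaffard_bound X s A)"
    by (simp add: jaffard_norm_eq_bound[OF assms])
  then show ?thesis using True by (simp add: jaffard_norm_le_iff)
next
  case False
  then show ?thesis using jaffard_spaceD[OF assms] by auto
qed

lemma
  assumes "\<And>k l. A k l \<in> bounded_operators" "\<And>k l. k \<notin> X \<or> l \<notin> X \<Longrightarrow> A k l = 0"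
    and "0 \<le> c" "\<And>k l. k \<in> X \<Longrightarrow> l \<in> X \<Longrightarrow> norm (A k l) \<le> c * weight s k l"
  shows jaffard_spaceI: "A \<in> jaffard_space X s"
    and jaffard_bound_leI: "jaffard_bound X s A \<le> c"
proof -
  have le: "jaffard_norm X s A \<le> ennreal c" using assms(3,4) by (simp add: jaffard_norm_le_iff)
  then have "jaffard_norm X s A < \<infinity>" by (metis ennreal_less_top infinity_ennreal_def le_less_trans)
  then show "A \<in> jaffard_space X s" using assms(1,2) by (simp add: jaffard_space_def)
  show "jaffard_bound X s A \<le> c" unfolding jaffard_bound_def using le assms(3) by (rule enn2real_leI[rotated])
qed

lemma jaffard_matrix_eqI:
  assumes "A \<in> jaffard_space X s" "B \<in> jaffard_space X s"
    and "\<And>k l. k \<in> X \<Longrightarrow> l \<in> X \<Longrightarrow> A k l = B k l"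
  shows "A = B"
proof (intro ext)
  fix k l
  show "A k l = B k l"
    using assms(3)[of k l] jaffard_spaceD[OF assms(1)] jaffard_spaceD[OF assms(2)]
    by (cases "k \<in> X \<and> l \<in> X") auto
qed

section \<open>Summation against the weight and Schur's test\<close>

locale jaffard =
  fixes X :: "(real^'d) set" and s :: real
  assumes relatively_separated: "relatively_separated X"
    and exponent: "s > real CARD('d)"
begin

text \<open>The exponent is a parameter because both \<open>s\<close> and the smaller exponent from
  the interpolation occur. Only the upper bound matters, so an arbitrary choice of \<open>K\<close>
  will do.\<close>

definition weight_bound :: "real \<Rightarrow> real" where
  "weight_bound t = (SOME K. \<forall>k. \<forall>F. finite F \<longrightarrow> F \<subseteq> X \<longrightarrow> (\<Sum>n\<in>F. weight t k n) \<le> K)"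

lemma s_pos: "s > 0" "s \<ge> 0"
  using exponent by (auto intro: le_less_trans less_imp_le)

context
  fixes t :: real
  assumes t: "t > real CARD('d)"
begin

lemma sum_weight_le: "finite F \<Longrightarrow> F \<subseteq> X \<Longrightarrow> (\<Sum>n\<in>F. weight t k n) \<le> weight_bound t"
  using someI_ex[OF relatively_separated_sum_bounded[OF relatively_separated t, folded weight_def]]
  unfolding weight_bound_def by blast

lemma weight_bound_nonneg: "0 \<le> weight_bound t"
  using sum_weight_le[of "{}"] by simp

lemma weight_summable: "(\<lambda>n. weight t k n) summable_on X"
  using sum_weight_le by (intro nonneg_bdd_above_summable_on) (auto intro!: bdd_aboveI2)

lemma infsum_weight_le: "(\<Sum>\<^sub>\<infinity>n\<in>X. weight t k n) \<le> weight_bound t"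
  using sum_weight_le by (intro infsum_le_finite_sums weight_summable)

lemma weight_summable': "(\<lambda>n. weight t n k) summable_on X"
  and infsum_weight_le': "(\<Sum>\<^sub>\<infinity>n\<in>X. weight t n k) \<le> weight_bound t"
  using weight_summable infsum_weight_le by (simp_all add: weight_commute[of _ _ k])

text \<open>Cauchy-Schwarz with the weight distributed as a square root over both factors.\<close>

lemma sum_weight_mult_square_le:
  assumes "(\<lambda>l. (b l)\<^sup>2) summable_on X" "\<And>l. 0 \<le> b l"
  shows "(\<lambda>l. weight t k l * b l) summable_on X"
    and "(\<lambda>l. weight t k l * (b l)\<^sup>2) summable_on X"
    and "(\<Sum>\<^sub>\<infinity>l\<in>X. weight t k l * b l)\<^sup>2 \<le> weight_bound t * (\<Sum>\<^sub>\<infinity>l\<in>X. weight t k l * (b l)\<^sup>2)"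
proof -
  have "0 < t" using t by (auto intro: le_less_trans)
  show sm2: "(\<lambda>l. weight t k l * (b l)\<^sup>2) summable_on X"
    using assms(1) by (rule summable_on_dominated)
      (use \<open>0 < t\<close> in \<open>auto intro!: mult_left_le_one_le weight_le_1\<close>)
  show sm: "(\<lambda>l. weight t k l * b l) summable_on X"
  proof (rule summable_on_dominated)
    show "(\<lambda>l. weight t k l + weight t k l * (b l)\<^sup>2) summable_on X"
      by (intro summable_on_add weight_summable sm2)
    fix l
    \<comment> \<open>This compares the middle series with the two series already known to
      converge.\<close>
    have "b l \<le> 1 + (b l)\<^sup>2"
      using zero_le_power2[of "b l - 1"] assms(2)[of l] by (simp add: power2_diff)
    then have "weight t k l * b l \<le> weight t k l * (1 + (b l)\<^sup>2)" by (simp add: mult_left_mono)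
    then show "norm (weight t k l * b l) \<le> weight t k l + weight t k l * (b l)\<^sup>2"
      using assms(2)[of l] by (simp add: distrib_left)
  qed
  have nonneg: "0 \<le> weight_bound t * (\<Sum>\<^sub>\<infinity>l\<in>X. weight t k l * (b l)\<^sup>2)"
    by (intro mult_nonneg_nonneg weight_bound_nonneg infsum_nonneg) auto
  have "(\<Sum>\<^sub>\<infinity>l\<in>X. weight t k l * b l) \<le> sqrt (weight_bound t * (\<Sum>\<^sub>\<infinity>l\<in>X. weight t k l * (b l)\<^sup>2))"
  proof (rule infsum_le_finite_sums[OF sm])
    fix F assume F: "finite F" "F \<subseteq> X"
    have "(\<Sum>l\<in>F. weight t k l * b l) = (\<Sum>l\<in>F. sqrt (weight t k l) * (sqrt (weight t k l) * b l))"
      by (simp add: mult.assoc[symmetric])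
    also have "\<dots> \<le> L2_set (\<lambda>l. sqrt (weight t k l)) F * L2_set (\<lambda>l. sqrt (weight t k l) * b l) F"
      using L2_set_mult_ineq[of "\<lambda>l. sqrt (weight t k l)" "\<lambda>l. sqrt (weight t k l) * b l" F] assms(2)
      by (simp add: abs_mult)
    also have "\<dots> = sqrt ((\<Sum>l\<in>F. weight t k l) * (\<Sum>l\<in>F. weight t k l * (b l)\<^sup>2))"
      by (simp add: L2_set_def real_sqrt_mult power_mult_distrib)
    also have "\<dots> \<le> sqrt (weight_bound t * (\<Sum>\<^sub>\<infinity>l\<in>X. weight t k l * (b l)\<^sup>2))"
      using F by (intro real_sqrt_le_mono mult_mono sum_weight_le finite_sum_le_infsum sm2)
        (auto intro!: weight_bound_nonneg sum_nonneg)
    finally show "(\<Sum>l\<in>F. weight t k l * b l)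
        \<le> sqrt (weight_bound t * (\<Sum>\<^sub>\<infinity>l\<in>X. weight t k l * (b l)\<^sup>2))" .
  qed
  moreover have "0 \<le> (\<Sum>\<^sub>\<infinity>l\<in>X. weight t k l * b l)" by (intro infsum_nonneg) (simp add: assms(2))
  ultimately show "(\<Sum>\<^sub>\<infinity>l\<in>X. weight t k l * b l)\<^sup>2 \<le> weight_bound t * (\<Sum>\<^sub>\<infinity>l\<in>X. weight t k l * (b l)\<^sup>2)"
    using real_le_rsqrt real_sqrt_le_iff sqrt_le_D by (metis nonneg power2_nonneg_ge_1_iff real_sqrt_pow2 power_mono)
qed

text \<open>Schur's test. Row sums of the weight enter through Cauchy-Schwarz, column sums after the
  two summations have been exchanged. With a finite outer index set the exchange is plain
  additivity.\<close>

lemma weight_schur_test: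
  assumes b: "(\<lambda>l. (b l)\<^sup>2) summable_on X" "\<And>l. 0 \<le> b l" and F: "finite F" "F \<subseteq> X"
  shows "(\<Sum>k\<in>F. (\<Sum>\<^sub>\<infinity>l\<in>X. weight t k l * b l)\<^sup>2) \<le> (weight_bound t)\<^sup>2 * (\<Sum>\<^sub>\<infinity>l\<in>X. (b l)\<^sup>2)"
proof -
  have "(\<Sum>k\<in>F. (\<Sum>\<^sub>\<infinity>l\<in>X. weight t k l * b l)\<^sup>2)
      \<le> (\<Sum>k\<in>F. weight_bound t * (\<Sum>\<^sub>\<infinity>l\<in>X. weight t k l * (b l)\<^sup>2))"
    by (intro sum_mono sum_weight_mult_square_le b)
  also have "\<dots> = weight_bound t * (\<Sum>k\<in>F. (\<Sum>\<^sub>\<infinity>l\<in>X. weight t k l * (b l)\<^sup>2))"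
    by (simp add: sum_distrib_left)
  also have "(\<Sum>k\<in>F. (\<Sum>\<^sub>\<infinity>l\<in>X. weight t k l * (b l)\<^sup>2)) = (\<Sum>\<^sub>\<infinity>l\<in>X. \<Sum>k\<in>F. weight t k l * (b l)\<^sup>2)"
    using F by (intro infsum_sum[symmetric] sum_weight_mult_square_le b)
  also have "\<dots> \<le> (\<Sum>\<^sub>\<infinity>l\<in>X. weight_bound t * (b l)\<^sup>2)"
  proof (intro infsum_mono)
    show "(\<lambda>l. \<Sum>k\<in>F. weight t k l * (b l)\<^sup>2) summable_on X"
      using F by (intro summable_on_sum sum_weight_mult_square_le b)
    show "(\<lambda>l. weight_bound t * (b l)\<^sup>2) summable_on X"
      by (intro summable_on_cmult_right b)
    show "(\<Sum>k\<in>F. weight t k l * (b l)\<^sup>2) \<le> weight_bound t * (b l)\<^sup>2" for l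
      using mult_right_mono[OF sum_weight_le[OF F, of l], of "(b l)\<^sup>2"]
      by (simp add: sum_distrib_right weight_commute[of t l])
  qed
  also have "\<dots> = weight_bound t * (\<Sum>\<^sub>\<infinity>l\<in>X. (b l)\<^sup>2)"
    by (rule infsum_cmult_right[OF b(1)])
  finally show ?thesis
    by (simp add: mult_left_mono weight_bound_nonneg power2_eq_square mult.assoc)
qed

end

end

lemma blinfun_apply_infsum:
  assumes "T summable_on A"
  shows "blinfun_apply (infsum T A) x = (\<Sum>\<^sub>\<infinity>n\<in>A. blinfun_apply (T n) x)"
    and "(\<lambda>n. blinfun_apply (T n) x) summable_on A"
  using has_sum_bounded_linear[OF blinfun.bounded_linear_left has_sum_infsum[OF assms], of x]
  by (auto simp: has_sum_iff)

lemma bounded_operators_infsum: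
  assumes "T summable_on A" "\<And>n. n \<in> A \<Longrightarrow> T n \<in> bounded_operators"
  shows "infsum T A \<in> bounded_operators"
proof -
  have "(\<Sum>\<^sub>\<infinity>n\<in>A. blinfun_apply (T n) (c *\<^sub>C x)) = c *\<^sub>C (\<Sum>\<^sub>\<infinity>n\<in>A. blinfun_apply (T n) x)" for c x
  proof -
    have "(\<Sum>\<^sub>\<infinity>n\<in>A. blinfun_apply (T n) (c *\<^sub>C x)) = (\<Sum>\<^sub>\<infinity>n\<in>A. c *\<^sub>C blinfun_apply (T n) x)"
      by (intro infsum_cong) (simp add: bounded_operatorsD assms)
    also have "\<dots> = c *\<^sub>C (\<Sum>\<^sub>\<infinity>n\<in>A. blinfun_apply (T n) x)"
      by (intro infsumI has_sum_bounded_linear[OF bounded_linear_scaleC] has_sum_infsum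
          blinfun_apply_infsum assms)
    finally show ?thesis .
  qed
  then show ?thesis by (simp add: bounded_operators_def blinfun_apply_infsum(1)[OF assms(1)])
qed

section \<open>Products of matrices and their action on families\<close>

context jaffard
begin

lemma matrix_mult_summable:
  fixes A B :: "('d, 'h::complex_hilbert) op_matrix"
  assumes A: "A \<in> jaffard_space X s" and B: "B \<in> jaffard_space X s"
  shows "(\<lambda>n. A k n o\<^sub>L B n l) summable_on X"
proof (rule summable_on_dominated)
  show "(\<lambda>n. jaffard_bound X s A * jaffard_bound X s B * weight s k n) summable_on X"
    by (intro summable_on_cmult_right weight_summable exponent)
  fix n
  have "norm (A k n o\<^sub>L B n l) \<le> norm (A k n) * norm (B n l)" by (rule norm_blinfun_compose)
  also have "\<dots> \<le> (jaffard_bound X s A * weight s k n) * (jaffard_bound X s B * weight s n l)"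
    by (intro mult_mono jaffard_entry_bound A B) auto
  also have "\<dots> \<le> (jaffard_bound X s A * weight s k n) * (jaffard_bound X s B * 1)"
    using s_pos by (intro mult_left_mono weight_le_1) auto
  finally show "norm (A k n o\<^sub>L B n l) \<le> jaffard_bound X s A * jaffard_bound X s B * weight s k n"
    by (simp add: mult_ac)
qed

text \<open>Only one factor of each product needs to be controlled by the full weight; the other one enters
  through the weaker bounds \<open>a\<close> and \<open>b\<close>.\<close>

lemma norm_matrix_mult_le:
  fixes A B :: "('d, 'h::complex_hilbert) op_matrix"
  assumes A: "A \<in> jaffard_space X s" and B: "B \<in> jaffard_space X s" and t: "t > real CARD('d)"
    and a: "\<And>n. norm (A k n) \<le> a * weight t k n" "0 \<le> a"
    and b: "\<And>n. norm (B n l) \<le> b * weight t n l" "0 \<le> b"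
  shows "norm (matrix_mult X A B k l)
    \<le> 2 powr s * weight_bound t * (jaffard_bound X s A * b + a * jaffard_bound X s B) * weight s k l"
proof -
  let ?A = "jaffard_bound X s A" and ?B = "jaffard_bound X s B"
  let ?g = "\<lambda>n. 2 powr s * weight s k l * (?A * b * weight t n l + a * ?B * weight t k n)"
  have g: "(?g has_sum 2 powr s * weight s k l *
      (?A * b * (\<Sum>\<^sub>\<infinity>n\<in>X. weight t n l) + a * ?B * (\<Sum>\<^sub>\<infinity>n\<in>X. weight t k n))) X"
    by (intro has_sum_cmult_right has_sum_add has_sum_infsum weight_summable weight_summable' t)
  have "norm (A k n o\<^sub>L B n l) \<le> ?g n" for n
  proof -
    let ?w = "weight s k n" and ?w' = "weight s n l"
    \<comment> \<open>Normalised entries, each bounded by its Jaffard norm. After the weights are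
      split, one factor of each summand is an entry again, estimated through \<open>a\<close> or
      \<open>b\<close>, while the other one stays normalised.\<close>
    define x y where "x = norm (A k n) / ?w" and "y = norm (B n l) / ?w'"
    have xy: "norm (A k n) = x * ?w" "norm (B n l) = y * ?w'"
      using weight_pos[of s k n] weight_pos[of s n l] by (auto simp: x_def y_def)
    have "x \<le> ?A" "y \<le> ?B"
      using jaffard_entry_bound[OF A, of k n] jaffard_entry_bound[OF B, of n l] weight_pos[of s k n] weight_pos[of s n l]
      by (auto simp: x_def y_def pos_divide_le_eq)
    have "0 \<le> x" "0 \<le> y" by (auto simp: x_def y_def)
    have "norm (A k n o\<^sub>L B n l) \<le> x * y * (?w * ?w')"
      using norm_blinfun_compose[of "A k n" "B n l"] by (simp add: xy mult_ac)
    also have "\<dots> \<le> x * y * (2 powr s * weight s k l * (?w + ?w'))"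
      using \<open>0 \<le> x\<close> \<open>0 \<le> y\<close> s_pos by (intro mult_left_mono weight_quasi_triangle) auto
    also have "\<dots> = 2 powr s * weight s k l * (x * norm (B n l) + norm (A k n) * y)"
      unfolding xy by (simp add: algebra_simps)
    also have "\<dots> \<le> 2 powr s * weight s k l * (?A * (b * weight t n l) + (a * weight t k n) * ?B)"
      using \<open>0 \<le> y\<close> \<open>x \<le> ?A\<close> \<open>y \<le> ?B\<close> a b by (intro mult_left_mono add_mono mult_mono) auto
    finally show ?thesis by (simp add: mult_ac)
  qed
  then have "norm (matrix_mult X A B k l) \<le> infsum ?g X"
    unfolding matrix_mult_def using g by (intro norm_infsum_dominated) (auto simp: has_sum_iff)
  also have "\<dots> = 2 powr s * weight s k l *
      (?A * b * (\<Sum>\<^sub>\<infinity>n\<in>X. weight t n l) + a * ?B * (\<Sum>\<^sub>\<infinity>n\<in>X. weight t k n))"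
    using g by (rule infsumI)
  also have "\<dots> \<le> 2 powr s * weight s k l * (?A * b * weight_bound t + a * ?B * weight_bound t)"
    using a b by (intro mult_left_mono add_mono infsum_weight_le infsum_weight_le' t) auto
  finally show ?thesis by (simp add: algebra_simps)
qed

text \<open>The constant of \<open>norm_matrix_mult_le\<close> at \<open>t = s\<close> with both
  Jaffard norms inserted; the two summands then coincide, hence the last factor 2.\<close>

definition mult_const :: real where
  "mult_const = 2 powr s * weight_bound s * 2"

lemma mult_const_nonneg: "0 \<le> mult_const"
  by (simp add: mult_const_def weight_bound_nonneg exponent)

lemma matrix_mult_bounded_operators:
  fixes A B :: "('d, 'h::complex_hilbert) op_matrix"
  assumes A: "A \<in> jaffard_space X s" and B: "B \<in> jaffard_space X s"
  shows "matrix_mult X A B k l \<in> bounded_operators"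
  unfolding matrix_mult_def
  by (intro bounded_operators_infsum matrix_mult_summable bounded_operators_compose
      jaffard_spaceD(1)[OF A] jaffard_spaceD(1)[OF B] A B)

lemma matrix_mult_eq_0:
  fixes A B :: "('d, 'h::complex_hilbert) op_matrix"
  assumes A: "A \<in> jaffard_space X s" and B: "B \<in> jaffard_space X s"
    and "k \<notin> X \<or> l \<notin> X"
  shows "matrix_mult X A B k l = 0"
  using assms(3) jaffard_spaceD(2,3)[OF A] jaffard_spaceD(2,3)[OF B] by (auto simp: matrix_mult_def)

lemma
  fixes A B :: "('d, 'h::complex_hilbert) op_matrix"
  assumes A: "A \<in> jaffard_space X s" and B: "B \<in> jaffard_space X s"
  shows jaffard_space_mult: "matrix_mult X A B \<in> jaffard_space X s"
    and jaffard_bound_mult: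
      "jaffard_bound X s (matrix_mult X A B) \<le> mult_const * jaffard_bound X s A * jaffard_bound X s B"
proof -
  have "norm (matrix_mult X A B k l) \<le> mult_const * jaffard_bound X s A * jaffard_bound X s B * weight s k l" for k l
    using norm_matrix_mult_le[OF A B exponent jaffard_entry_bound[OF A] _ jaffard_entry_bound[OF B]]
    by (simp add: mult_const_def mult_ac)
  moreover have "0 \<le> mult_const * jaffard_bound X s A * jaffard_bound X s B"
    by (simp add: mult_const_nonneg)
  ultimately show "matrix_mult X A B \<in> jaffard_space X s"
    and "jaffard_bound X s (matrix_mult X A B) \<le> mult_const * jaffard_bound X s A * jaffard_bound X s B"
    by (blast intro: jaffard_spaceI jaffard_bound_leI
        matrix_mult_bounded_operators[OF A B] matrix_mult_eq_0[OF A B])+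
qed

lemma matrix_operator_summable:
  fixes A :: "('d, 'h::complex_hilbert) op_matrix"
  assumes A: "A \<in> jaffard_space X s" and f: "f \<in> ell2 X"
  shows "(\<lambda>l. blinfun_apply (A k l) (f l)) summable_on X"
    and "norm (\<Sum>\<^sub>\<infinity>l\<in>X. blinfun_apply (A k l) (f l))
      \<le> jaffard_bound X s A * (\<Sum>\<^sub>\<infinity>l\<in>X. weight s k l * norm (f l))"
proof -
  have sm: "(\<lambda>l. weight s k l * norm (f l)) summable_on X"
    by (intro sum_weight_mult_square_le exponent ell2_summable f) auto
  have "norm (blinfun_apply (A k l) (f l)) \<le> jaffard_bound X s A * (weight s k l * norm (f l))" for l
    using order_trans[OF norm_blinfun mult_right_mono[OF jaffard_entry_bound[OF A]], of "f l" k l]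
    by (simp add: mult.assoc)
  then show "(\<lambda>l. blinfun_apply (A k l) (f l)) summable_on X"
    and "norm (\<Sum>\<^sub>\<infinity>l\<in>X. blinfun_apply (A k l) (f l))
      \<le> jaffard_bound X s A * (\<Sum>\<^sub>\<infinity>l\<in>X. weight s k l * norm (f l))"
    unfolding infsum_cmult_right[OF sm, symmetric]
    by (rule summable_on_dominated[OF summable_on_cmult_right[OF sm]]
        norm_infsum_dominated[OF summable_on_cmult_right[OF sm]])+
qed

lemma matrix_operator_apply:
  "f \<in> ell2 X \<Longrightarrow> matrix_operator X A f = (\<lambda>k. \<Sum>\<^sub>\<infinity>l\<in>X. blinfun_apply (A k l) (f l))"
  by (simp add: matrix_operator_def)

text \<open>Entries are dominated by multiples of the weight, so Schur's test for the scalar family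
  \<open>norm (f l)\<close> gives boundedness on square-summable families.\<close>

lemma
  fixes A :: "('d, 'h::complex_hilbert) op_matrix"
  assumes A: "A \<in> jaffard_space X s" and f: "f \<in> ell2 X"
  shows matrix_operator_ell2: "matrix_operator X A f \<in> ell2 X"
    and ell2_norm_matrix_operator_le:
      "ell2_norm X (matrix_operator X A f) \<le> jaffard_bound X s A * weight_bound s * ell2_norm X f"
proof -
  have eq_0: "matrix_operator X A f k = 0" if "k \<notin> X" for k
    using that jaffard_spaceD(2)[OF A] by (simp add: matrix_operator_apply[OF f])
  have "L2_set (\<lambda>k. norm (matrix_operator X A f k)) F
      \<le> jaffard_bound X s A * weight_bound s * ell2_norm X f" if F: "finite F" "F \<subseteq> X" for F
  proof -
    have "L2_set (\<lambda>k. norm (matrix_operator X A f k)) F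
        \<le> L2_set (\<lambda>k. jaffard_bound X s A * (\<Sum>\<^sub>\<infinity>l\<in>X. weight s k l * norm (f l))) F"
      using matrix_operator_summable(2)[OF A f]
      by (intro L2_set_mono) (simp_all add: matrix_operator_apply[OF f])
    also have "\<dots> = jaffard_bound X s A * sqrt (\<Sum>k\<in>F. (\<Sum>\<^sub>\<infinity>l\<in>X. weight s k l * norm (f l))\<^sup>2)"
      by (simp add: L2_set_right_distrib[symmetric]) (simp add: L2_set_def)
    also have "\<dots> \<le> jaffard_bound X s A * sqrt ((weight_bound s)\<^sup>2 * (\<Sum>\<^sub>\<infinity>l\<in>X. (norm (f l))\<^sup>2))"
      using F by (intro mult_left_mono real_sqrt_le_mono weight_schur_test exponent ell2_summable f) auto
    also have "\<dots> = jaffard_bound X s A * weight_bound s * ell2_norm X f"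
      by (simp add: real_sqrt_mult ell2_norm_def weight_bound_nonneg exponent)
    finally show ?thesis .
  qed
  then show "matrix_operator X A f \<in> ell2 X"
    and "ell2_norm X (matrix_operator X A f) \<le> jaffard_bound X s A * weight_bound s * ell2_norm X f"
    by (auto intro!: ell2I ell2_norm_leI eq_0)
qed

lemma matrix_operator_ell2_operators:
  fixes A :: "('d, 'h::complex_hilbert) op_matrix"
  assumes A: "A \<in> jaffard_space X s"
  shows "matrix_operator X A \<in> ell2_operators X"
proof -
  let ?T = "\<lambda>f k. \<Sum>\<^sub>\<infinity>l\<in>X. blinfun_apply (A k l) (f l)"
  have "restrict ?T (ell2 X) \<in> ell2_operators X"
  proof (rule ell2_operatorsI)
    fix f g :: "real^'d \<Rightarrow> 'h" and c
    assume f: "f \<in> ell2 X"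
    show "?T f \<in> ell2 X" "ell2_norm X (?T f) \<le> jaffard_bound X s A * weight_bound s * ell2_norm X f"
      using matrix_operator_ell2[OF A f] ell2_norm_matrix_operator_le[OF A f]
      by (simp_all add: matrix_operator_apply[OF f])
    show "?T (\<lambda>k. c *\<^sub>C f k) = (\<lambda>k. c *\<^sub>C ?T f k)"
      by (intro ext infsumI)
        (simp add: bounded_operatorsD[OF jaffard_spaceD(1)[OF A]]
          has_sum_bounded_linear[OF bounded_linear_scaleC has_sum_infsum[OF matrix_operator_summable(1)[OF A f]]])
    show "?T (\<lambda>k. f k + g k) = (\<lambda>k. ?T f k + ?T g k)" if "g \<in> ell2 X"
      by (intro ext) (simp add: blinfun.add_right infsum_add matrix_operator_summable(1)[OF A] f that)
  qed
  then show ?thesis by (simp add: matrix_operator_def)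
qed

lemma matrix_operator_single:
  assumes "l \<in> X"
  shows "matrix_operator X A (\<lambda>k. if k = l then x else 0) k = blinfun_apply (A k l) x"
proof -
  have "((\<lambda>l'. blinfun_apply (A k l') (if l' = l then x else 0)) has_sum blinfun_apply (A k l) x) X"
    using assms by (intro has_sum_finite_neutralI[of "{l}"]) auto
  then show ?thesis using assms by (simp add: matrix_operator_apply ell2_single infsumI)
qed

text \<open>Families supported at one point recover the columns. Besides injectivity of the
  identification, this is what allows algebraic laws to be checked on operators.\<close>

lemma matrix_operator_inj: "inj_on (matrix_operator X) (jaffard_space X s)"
proof (rule inj_onI)
  fix A B :: "('d, 'h::complex_hilbert) op_matrix"
  assume A: "A \<in> jaffard_space X s" and B: "B \<in> jaffard_space X s"
    and eq: "matrix_operator X A = matrix_operator X B"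
  show "A = B"
  proof (rule jaffard_matrix_eqI[OF A B])
    fix k l assume "l \<in> X"
    then show "A k l = B k l" using eq by (metis blinfun_eqI matrix_operator_single)
  qed
qed

text \<open>The majorant for the Fubini argument in \<open>matrix_operator_mult\<close>.\<close>

lemma weight_convolution_summable:
  "(\<lambda>(n, l). weight s k n * weight s n l) summable_on X \<times> X"
proof (rule summable_on_SigmaI)
  show "((\<lambda>l. (\<lambda>(n, l). weight s k n * weight s n l) (n, l)) has_sum
      weight s k n * (\<Sum>\<^sub>\<infinity>l\<in>X. weight s n l)) X" for n
    by (simp, intro has_sum_cmult_right has_sum_infsum weight_summable exponent)
  show "(\<lambda>n. weight s k n * (\<Sum>\<^sub>\<infinity>l\<in>X. weight s n l)) summable_on X"
  proof (rule summable_on_dominated)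
    show "(\<lambda>n. weight_bound s * weight s k n) summable_on X"
      by (intro summable_on_cmult_right weight_summable exponent)
    show "norm (weight s k n * (\<Sum>\<^sub>\<infinity>l\<in>X. weight s n l)) \<le> weight_bound s * weight s k n" for n
      using mult_left_mono[OF infsum_weight_le[OF exponent, of n], of "weight s k n"]
      by (simp add: abs_mult infsum_nonneg mult.commute)
  qed
qed auto

text \<open>Fubini for the double sum over \<open>n\<close> and \<open>l\<close>. Replacing
  \<open>norm (f l)\<close> by \<open>ell2_norm X f\<close> leaves a product of two weights as
  majorant.\<close>

lemma matrix_operator_mult:
  fixes A B :: "('d, 'h::complex_hilbert) op_matrix"
  assumes A: "A \<in> jaffard_space X s" and B: "B \<in> jaffard_space X s"
  shows "matrix_operator X (matrix_mult X A B)
    = compose (ell2 X) (matrix_operator X A) (matrix_operator X B)"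
proof (rule extensionalityI[where A = "ell2 X"])
  fix f :: "real^'d \<Rightarrow> 'h" assume f: "f \<in> ell2 X"
  show "matrix_operator X (matrix_mult X A B) f
      = compose (ell2 X) (matrix_operator X A) (matrix_operator X B) f"
  proof
    fix k
    let ?F = "\<lambda>n l. blinfun_apply (A k n) (blinfun_apply (B n l) (f l))"
    have "(\<lambda>(n, l). ?F n l) summable_on X \<times> X"
    proof (rule summable_on_dominated)
      show "(\<lambda>p. jaffard_bound X s A * jaffard_bound X s B * ell2_norm X f *
          (\<lambda>(n, l). weight s k n * weight s n l) p) summable_on X \<times> X"
        by (intro summable_on_cmult_right weight_convolution_summable)
      have "norm (?F n l) \<le> jaffard_bound X s A * jaffard_bound X s B * ell2_norm X f * (weight s k n * weight s n l)" for n l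
      proof -
        have "norm (?F n l) \<le> norm (A k n) * (norm (B n l) * norm (f l))"
          by (intro order_trans[OF norm_blinfun] mult_left_mono norm_blinfun) auto
        also have "\<dots> \<le> (jaffard_bound X s A * weight s k n) * ((jaffard_bound X s B * weight s n l) * ell2_norm X f)"
          by (intro mult_mono jaffard_entry_bound A B norm_le_ell2_norm f) auto
        finally show ?thesis by (simp add: mult_ac)
      qed
      then show "norm (case p of (n, l) \<Rightarrow> ?F n l)
          \<le> jaffard_bound X s A * jaffard_bound X s B * ell2_norm X f * (\<lambda>(n, l). weight s k n * weight s n l) p" for p
        by (cases p) auto
    qed
    then have swap: "(\<Sum>\<^sub>\<infinity>n\<in>X. \<Sum>\<^sub>\<infinity>l\<in>X. ?F n l) = (\<Sum>\<^sub>\<infinity>l\<in>X. \<Sum>\<^sub>\<infinity>n\<in>X. ?F n l)"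
      by (rule infsum_swap_banach)
    have "(\<Sum>\<^sub>\<infinity>n\<in>X. ?F n l) = blinfun_apply (matrix_mult X A B k l) (f l)" for l
      by (simp add: matrix_mult_def blinfun_apply_infsum(1)[OF matrix_mult_summable[OF A B]])
    moreover have "(\<Sum>\<^sub>\<infinity>l\<in>X. ?F n l) = blinfun_apply (A k n) (matrix_operator X B f n)" for n
      unfolding matrix_operator_apply[OF f]
      by (intro infsumI has_sum_bounded_linear[OF blinfun.bounded_linear_right] has_sum_infsum
          matrix_operator_summable B f)
    moreover have "compose (ell2 X) (matrix_operator X A) (matrix_operator X B) f k
        = (\<Sum>\<^sub>\<infinity>n\<in>X. blinfun_apply (A k n) (matrix_operator X B f n))"
      by (simp only: compose_eq[OF f] matrix_operator_apply[OF matrix_operator_ell2[OF B f]])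
    moreover have "matrix_operator X (matrix_mult X A B) f k
        = (\<Sum>\<^sub>\<infinity>l\<in>X. blinfun_apply (matrix_mult X A B k l) (f l))"
      by (simp only: matrix_operator_apply[OF f])
    ultimately show "matrix_operator X (matrix_mult X A B) f k
        = compose (ell2 X) (matrix_operator X A) (matrix_operator X B) f k"
      using swap by (simp only:)
  qed
qed (auto simp: matrix_operator_def compose_extensional)

end

section \<open>The Jaffard algebra is a Banach algebra\<close>

definition jaffard_one :: "(real^'d) set \<Rightarrow> ('d, 'h::complex_hilbert) op_matrix" where
  "jaffard_one X = (\<lambda>k l. if k = l \<and> k \<in> X then id_blinfun else 0)"

lemma jaffard_algebra_simps:
  "carrier (jaffard_algebra X s) = jaffard_space X s"
  "mult (jaffard_algebra X s) = matrix_mult X"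
  "one (jaffard_algebra X s) = jaffard_one X"
  "zero (jaffard_algebra X s) = (\<lambda>k l. 0)"
  "add (jaffard_algebra X s) = (\<lambda>A B k l. A k l + B k l)"
  "smult (jaffard_algebra X s) = (\<lambda>c A k l. scaleC_operator c (A k l))"
  "anorm (jaffard_algebra X s) = jaffard_op_norm X s"
  by (simp_all add: jaffard_algebra_def jaffard_one_def)

lemma
  assumes A: "A \<in> jaffard_space X s" and B: "B \<in> jaffard_space X s"
  shows jaffard_space_add: "(\<lambda>k l. A k l + B k l) \<in> jaffard_space X s"
    and jaffard_bound_add:
      "jaffard_bound X s (\<lambda>k l. A k l + B k l) \<le> jaffard_bound X s A + jaffard_bound X s B"
proof -
  have "norm (A k l + B k l) \<le> (jaffard_bound X s A + jaffard_bound X s B) * weight s k l" for k l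
    using norm_triangle_ineq[of "A k l" "B k l"] jaffard_entry_bound[OF A, of k l]
      jaffard_entry_bound[OF B, of k l] by (simp add: distrib_right)
  moreover have "0 \<le> jaffard_bound X s A + jaffard_bound X s B" by simp
  moreover have "A k l + B k l = 0" if "k \<notin> X \<or> l \<notin> X" for k l
    using that jaffard_spaceD(2,3)[OF A] jaffard_spaceD(2,3)[OF B] by auto
  ultimately show "(\<lambda>k l. A k l + B k l) \<in> jaffard_space X s"
    and "jaffard_bound X s (\<lambda>k l. A k l + B k l) \<le> jaffard_bound X s A + jaffard_bound X s B"
    by (blast intro: jaffard_spaceI jaffard_bound_leI bounded_operators_add
        jaffard_spaceD(1)[OF A] jaffard_spaceD(1)[OF B])+
qed

lemma scaleC_operator_one: "scaleC_operator 1 T = T"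
  and scaleC_operator_zero_right: "scaleC_operator c 0 = 0"
  and scaleC_operator_scaleC_operator: "scaleC_operator a (scaleC_operator b T) = scaleC_operator (a * b) T"
  and scaleC_operator_minus_one: "scaleC_operator (-1) T = - T"
  and scaleC_operator_add_left: "scaleC_operator (a + b) T = scaleC_operator a T + scaleC_operator b T"
  and scaleC_operator_add_right: "scaleC_operator a (S + T) = scaleC_operator a S + scaleC_operator a T"
  by (auto intro!: blinfun_eqI simp: scaleC_one scaleC_zero_right scaleC_scaleC
      scaleC_minus_one scaleC_add_left scaleC_add_right blinfun.add_left blinfun.minus_left)

lemma
  assumes A: "A \<in> jaffard_space X s"
  shows jaffard_space_scaleC: "(\<lambda>k l. scaleC_operator c (A k l)) \<in> jaffard_space X s"
    and jaffard_bound_scaleC_le: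
      "jaffard_bound X s (\<lambda>k l. scaleC_operator c (A k l)) \<le> cmod c * jaffard_bound X s A"
proof -
  have "norm (scaleC_operator c (A k l)) \<le> cmod c * jaffard_bound X s A * weight s k l" for k l
    using order_trans[OF norm_scaleC_operator_le mult_left_mono[OF jaffard_entry_bound[OF A]], of c k l]
    by (simp add: mult.assoc)
  moreover have "0 \<le> cmod c * jaffard_bound X s A" by simp
  moreover have "scaleC_operator c (A k l) = 0" if "k \<notin> X \<or> l \<notin> X" for k l
    using that jaffard_spaceD(2,3)[OF A] by (auto simp: scaleC_operator_zero_right)
  ultimately show "(\<lambda>k l. scaleC_operator c (A k l)) \<in> jaffard_space X s"
    and "jaffard_bound X s (\<lambda>k l. scaleC_operator c (A k l)) \<le> cmod c * jaffard_bound X s A"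
    by (blast intro: jaffard_spaceI jaffard_bound_leI bounded_operators_scaleC jaffard_spaceD(1)[OF A])+
qed

text \<open>For nonzero \<open>c\<close> the lower bound is the upper bound for
  \<open>inverse c\<close> and the scaled matrix.\<close>

lemma jaffard_bound_scaleC:
  assumes A: "A \<in> jaffard_space X s"
  shows "jaffard_bound X s (\<lambda>k l. scaleC_operator c (A k l)) = cmod c * jaffard_bound X s A"
proof (cases "c = 0")
  case True
  then show ?thesis
    using jaffard_bound_scaleC_le[OF A, of c] by (simp add: order_antisym)
next
  case False
  have "jaffard_bound X s A \<le> inverse (cmod c) * jaffard_bound X s (\<lambda>k l. scaleC_operator c (A k l))"
    using jaffard_bound_scaleC_le[OF jaffard_space_scaleC[OF A], of "inverse c" c] False
    by (simp add: scaleC_operator_scaleC_operator scaleC_operator_one norm_inverse)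
  then have "cmod c * jaffard_bound X s A \<le> jaffard_bound X s (\<lambda>k l. scaleC_operator c (A k l))"
    using False by (simp add: field_simps)
  then show ?thesis using jaffard_bound_scaleC_le[OF A, of c] by simp
qed

lemma jaffard_space_diff:
  assumes "A \<in> jaffard_space X s" "B \<in> jaffard_space X s"
  shows "(\<lambda>k l. A k l - B k l) \<in> jaffard_space X s"
  using jaffard_space_add[OF assms(1) jaffard_space_scaleC[OF assms(2)], of "-1"]
  by (simp add: scaleC_operator_minus_one)

lemma jaffard_space_zero: "(\<lambda>k l. 0) \<in> jaffard_space X s"
  by (rule jaffard_spaceI[where c = 0]) (auto simp: bounded_operators_zero)

lemma
  shows jaffard_space_one: "jaffard_one X \<in> jaffard_space X s"
    and jaffard_bound_one_le: "jaffard_bound X s (jaffard_one X) \<le> 1"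
proof -
  have "norm (jaffard_one X k l) \<le> 1 * weight s k l" for k l
    by (auto simp: jaffard_one_def norm_blinfun_id_le)
  moreover have "jaffard_one X k l = 0" if "k \<notin> X \<or> l \<notin> X" for k l
    using that by (auto simp: jaffard_one_def)
  moreover have "jaffard_one X k l \<in> bounded_operators" for k l
    by (auto simp: jaffard_one_def bounded_operators_id bounded_operators_zero)
  ultimately show "jaffard_one X \<in> jaffard_space X s" "jaffard_bound X s (jaffard_one X) \<le> 1"
    by (blast intro: jaffard_spaceI jaffard_bound_leI zero_le_one)+
qed

lemma jaffard_bound_zero_iff:
  assumes "A \<in> jaffard_space X s"
  shows "jaffard_bound X s A = 0 \<longleftrightarrow> A = (\<lambda>k l. 0)"
proof
  assume "jaffard_bound X s A = 0"
  then show "A = (\<lambda>k l. 0)" using jaffard_entry_bound[OF assms] by (auto simp: fun_eq_iff)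
next
  assume "A = (\<lambda>k l. 0)"
  then have "jaffard_bound X s A \<le> 0" by (intro jaffard_bound_leI) (auto simp: bounded_operators_zero)
  then show "jaffard_bound X s A = 0" by (simp add: order_antisym)
qed

text \<open>The limit is taken entry by entry. A bound by a fixed multiple of the weight is a closed
  condition on each entry, so the Cauchy estimates survive without any exchange of limits.\<close>

lemma jaffard_space_complete:
  fixes u :: "nat \<Rightarrow> ('d::finite, 'h::complex_hilbert) op_matrix"
  assumes u: "\<And>n. u n \<in> jaffard_space X s" and s: "s \<ge> 0"
    and Cauchy: "\<And>e. 0 < e \<Longrightarrow> \<exists>N. \<forall>m\<ge>N. \<forall>n\<ge>N. jaffard_bound X s (\<lambda>k l. u m k l - u n k l) < e"
  shows "\<exists>A\<in>jaffard_space X s. \<forall>e>0. \<exists>N. \<forall>m\<ge>N. jaffard_bound X s (\<lambda>k l. u m k l - A k l) \<le> e"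
proof -
  define U where "U k l = lim (\<lambda>n. u n k l)" for k l
  have entry: "norm (u m k l - u n k l) \<le> jaffard_bound X s (\<lambda>k l. u m k l - u n k l) * weight s k l"
    for m n k l
    using jaffard_entry_bound[OF jaffard_space_diff[OF u u]] .
  have "Cauchy (\<lambda>n. u n k l)" for k l
  proof (rule metric_CauchyI)
    fix e :: real assume "e > 0"
    then obtain N where N: "\<And>m n. m \<ge> N \<Longrightarrow> n \<ge> N \<Longrightarrow> jaffard_bound X s (\<lambda>k l. u m k l - u n k l) < e"
      using Cauchy[OF \<open>e > 0\<close>] by blast
    have "dist (u m k l) (u n k l) < e" if "m \<ge> N" "n \<ge> N" for m n
    proof -
      have "norm (u m k l - u n k l) \<le> jaffard_bound X s (\<lambda>k l. u m k l - u n k l) * 1"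
        using entry by (rule order_trans) (intro mult_left_mono weight_le_1 s, simp)
      then show ?thesis using N[OF that] by (simp add: dist_norm)
    qed
    then show "\<exists>N. \<forall>m\<ge>N. \<forall>n\<ge>N. dist (u m k l) (u n k l) < e" by blast
  qed
  then have lim: "(\<lambda>n. u n k l) \<longlonglongrightarrow> U k l" for k l
    by (simp add: U_def Cauchy_convergent_iff convergent_LIMSEQ_iff)
  have U_bounded: "U k l \<in> bounded_operators" for k l
    by (rule closed_sequentially[OF closed_bounded_operators _ lim]) (rule jaffard_spaceD(1)[OF u])
  have U_eq_0: "U k l = 0" if "k \<notin> X \<or> l \<notin> X" for k l
  proof -
    have "u n k l = 0" for n using that jaffard_spaceD(2,3)[OF u] by auto
    then show ?thesis using lim[of k l] by (simp add: LIMSEQ_const_iff)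
  qed
  have est: "(\<lambda>k l. u m k l - U k l) \<in> jaffard_space X s \<and> jaffard_bound X s (\<lambda>k l. u m k l - U k l) \<le> e"
    if N: "\<And>m n. m \<ge> N \<Longrightarrow> n \<ge> N \<Longrightarrow> jaffard_bound X s (\<lambda>k l. u m k l - u n k l) < e"
      and m: "m \<ge> N" and e: "0 \<le> e" for e N m
  proof -
    have "norm (u m k l - U k l) \<le> e * weight s k l" for k l
    proof (rule LIMSEQ_le_const2)
      show "(\<lambda>n. norm (u m k l - u n k l)) \<longlonglongrightarrow> norm (u m k l - U k l)"
        by (intro tendsto_intros lim)
      have "norm (u m k l - u n k l) \<le> e * weight s k l" if "n \<ge> N" for n
        using entry by (rule order_trans) (rule mult_right_mono[OF less_imp_le[OF N[OF m that]]], simp)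
      then show "\<exists>M. \<forall>n\<ge>M. norm (u m k l - u n k l) \<le> e * weight s k l" by blast
    qed
    moreover have "u m k l - U k l = 0" if "k \<notin> X \<or> l \<notin> X" for k l
      using that jaffard_spaceD(2,3)[OF u] U_eq_0 by auto
    moreover have "u m k l - U k l \<in> bounded_operators" for k l
      using bounded_operators_add[OF jaffard_spaceD(1)[OF u] bounded_operators_uminus[OF U_bounded]] by simp
    ultimately show ?thesis
      using e by (intro conjI jaffard_spaceI[where c = e] jaffard_bound_leI) simp_all
  qed
  obtain N where N: "\<And>m n. m \<ge> N \<Longrightarrow> n \<ge> N \<Longrightarrow> jaffard_bound X s (\<lambda>k l. u m k l - u n k l) < 1"
    using Cauchy[OF zero_less_one] by blast
  \<comment> \<open>Membership of the limit follows from \<open>U = u N - (u N - U)\<close>.\<close>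
  have "U \<in> jaffard_space X s"
    using jaffard_space_diff[OF u[of N] conjunct1[OF est[where N = N and e = 1 and m = N, OF N order_refl zero_le_one]]] by simp
  moreover have "\<exists>N. \<forall>m\<ge>N. jaffard_bound X s (\<lambda>k l. u m k l - U k l) \<le> e" if e: "e > 0" for e
  proof -
    obtain N where N: "\<And>m n. m \<ge> N \<Longrightarrow> n \<ge> N \<Longrightarrow> jaffard_bound X s (\<lambda>k l. u m k l - u n k l) < e"
      using Cauchy[OF e] by blast
    have "jaffard_bound X s (\<lambda>k l. u m k l - U k l) \<le> e" if "m \<ge> N" for m
      by (rule conjunct2[OF est[OF N that less_imp_le[OF e]]])
    then show ?thesis by blast
  qed
  ultimately show ?thesis by blast
qed

section \<open>The embedding into operators and the norm of left multiplication\<close>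

context jaffard
begin

lemma matrix_operator_add:
  fixes A B :: "('d, 'h::complex_hilbert) op_matrix"
  assumes A: "A \<in> jaffard_space X s" and B: "B \<in> jaffard_space X s"
  shows "matrix_operator X (\<lambda>k l. A k l + B k l)
    = (\<lambda>f\<in>ell2 X. \<lambda>k. matrix_operator X A f k + matrix_operator X B f k)"
  unfolding matrix_operator_def
proof (intro restrict_ext ext)
  fix f :: "real^'d \<Rightarrow> 'h" and k assume f: "f \<in> ell2 X"
  show "(\<Sum>\<^sub>\<infinity>l\<in>X. blinfun_apply (A k l + B k l) (f l))
      = (\<lambda>f\<in>ell2 X. \<lambda>k. \<Sum>\<^sub>\<infinity>l\<in>X. blinfun_apply (A k l) (f l)) f k
      + (\<lambda>f\<in>ell2 X. \<lambda>k. \<Sum>\<^sub>\<infinity>l\<in>X. blinfun_apply (B k l) (f l)) f k"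
    unfolding blinfun.add_left restrict_apply'[OF f]
    by (intro infsum_add matrix_operator_summable A B f)
qed

lemma matrix_operator_scaleC:
  fixes A :: "('d, 'h::complex_hilbert) op_matrix"
  assumes A: "A \<in> jaffard_space X s"
  shows "matrix_operator X (\<lambda>k l. scaleC_operator c (A k l))
    = (\<lambda>f\<in>ell2 X. \<lambda>k. c *\<^sub>C matrix_operator X A f k)"
  unfolding matrix_operator_def
proof (intro restrict_ext ext)
  fix f :: "real^'d \<Rightarrow> 'h" and k assume f: "f \<in> ell2 X"
  have "((\<lambda>l. c *\<^sub>C blinfun_apply (A k l) (f l)) has_sum c *\<^sub>C (\<Sum>\<^sub>\<infinity>l\<in>X. blinfun_apply (A k l) (f l))) X"
    by (intro has_sum_bounded_linear[OF bounded_linear_scaleC] has_sum_infsum matrix_operator_summable A f)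
  then show "(\<Sum>\<^sub>\<infinity>l\<in>X. blinfun_apply (scaleC_operator c (A k l)) (f l))
      = c *\<^sub>C (\<lambda>f\<in>ell2 X. \<lambda>k. \<Sum>\<^sub>\<infinity>l\<in>X. blinfun_apply (A k l) (f l)) f k"
    using f by (simp add: infsumI)
qed

lemma matrix_operator_one:
  "matrix_operator X (jaffard_one X :: ('d, 'h::complex_hilbert) op_matrix) = (\<lambda>f\<in>ell2 X. f)"
  unfolding matrix_operator_def
proof (intro restrict_ext ext)
  fix f :: "real^'d \<Rightarrow> 'h" and k assume f: "f \<in> ell2 X"
  show "(\<Sum>\<^sub>\<infinity>l\<in>X. blinfun_apply (jaffard_one X k l) (f l)) = f k"
  proof (cases "k \<in> X")
    case True
    then have "((\<lambda>l. blinfun_apply (jaffard_one X k l) (f l)) has_sum f k) X"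
      by (intro has_sum_finite_neutralI[of "{k}"]) (auto simp: jaffard_one_def)
    then show ?thesis by (rule infsumI)
  qed (simp add: jaffard_one_def ell2_eq_0[OF f])
qed

lemmas matrix_operator_hom = matrix_operator_mult matrix_operator_add matrix_operator_scaleC
  matrix_operator_one

lemma matrix_operator_eqD:
  "matrix_operator X A = matrix_operator X B \<Longrightarrow> A \<in> jaffard_space X s \<Longrightarrow> B \<in> jaffard_space X s \<Longrightarrow> A = B"
  using matrix_operator_inj by (rule inj_onD)

lemmas jaffard_space_closed = jaffard_space_mult jaffard_space_add jaffard_space_scaleC jaffard_space_one
  jaffard_space_zero

text \<open>Algebraic identities are pulled back from \<open>ell2_operator_algebra X\<close> along the injective
  homomorphism \<open>matrix_operator X\<close>.\<close>

context
  fixes A :: "('d, 'h::complex_hilbert) op_matrix"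
  assumes A: "A \<in> jaffard_space X s"
begin

interpretation E: ring
  "ell2_operator_algebra X :: ((real^'d \<Rightarrow> 'h) \<Rightarrow> (real^'d \<Rightarrow> 'h)) normed_algebra"
  by (rule ring_ell2_operator_algebra)

lemma matrix_mult_one_left: "matrix_mult X (jaffard_one X) A = A"
  by (rule matrix_operator_eqD)
     (simp_all only: A jaffard_space_closed matrix_operator_hom matrix_operator_ell2_operators
       E.l_one[unfolded ell2_operator_algebra_simps])

lemma matrix_mult_one_right: "matrix_mult X A (jaffard_one X) = A"
  by (rule matrix_operator_eqD)
     (simp_all only: A jaffard_space_closed matrix_operator_hom matrix_operator_ell2_operators
       E.r_one[unfolded ell2_operator_algebra_simps])

context
  fixes B :: "('d, 'h) op_matrix"
  assumes B: "B \<in> jaffard_space X s"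
begin

lemma matrix_mult_scaleC_left:
  "matrix_mult X (\<lambda>k l. scaleC_operator c (A k l)) B = (\<lambda>k l. scaleC_operator c (matrix_mult X A B k l))"
  by (rule matrix_operator_eqD)
     (simp_all only: A B jaffard_space_closed matrix_operator_hom matrix_operator_ell2_operators
       unital_banach_algebra.smult_mult_left[OF unital_banach_algebra_ell2_operator_algebra,
         unfolded ell2_operator_algebra_simps])

lemma matrix_mult_scaleC_right:
  "matrix_mult X A (\<lambda>k l. scaleC_operator c (B k l)) = (\<lambda>k l. scaleC_operator c (matrix_mult X A B k l))"
  by (rule matrix_operator_eqD)
     (simp_all only: A B jaffard_space_closed matrix_operator_hom matrix_operator_ell2_operators
       unital_banach_algebra.smult_mult_right[OF unital_banach_algebra_ell2_operator_algebra,
         unfolded ell2_operator_algebra_simps])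

context
  fixes C :: "('d, 'h) op_matrix"
  assumes C: "C \<in> jaffard_space X s"
begin

lemma matrix_mult_assoc: "matrix_mult X (matrix_mult X A B) C = matrix_mult X A (matrix_mult X B C)"
  by (rule matrix_operator_eqD)
     (simp_all only: A B C jaffard_space_closed matrix_operator_hom matrix_operator_ell2_operators
       E.m_assoc[unfolded ell2_operator_algebra_simps])

lemma matrix_mult_distrib_left:
  "matrix_mult X (\<lambda>k l. A k l + B k l) C = (\<lambda>k l. matrix_mult X A C k l + matrix_mult X B C k l)"
  by (rule matrix_operator_eqD)
     (simp_all only: A B C jaffard_space_closed matrix_operator_hom matrix_operator_ell2_operators
       E.l_distr[unfolded ell2_operator_algebra_simps])

lemma matrix_mult_distrib_right:
  "matrix_mult X C (\<lambda>k l. A k l + B k l) = (\<lambda>k l. matrix_mult X C A k l + matrix_mult X C B k l)"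
  by (rule matrix_operator_eqD)
     (simp_all only: A B C jaffard_space_closed matrix_operator_hom matrix_operator_ell2_operators
       E.r_distr[unfolded ell2_operator_algebra_simps])

end

end

end

lemmas matrix_mult_one = matrix_mult_one_left matrix_mult_one_right
lemmas matrix_mult_distrib = matrix_mult_distrib_left matrix_mult_distrib_right
lemmas matrix_mult_scaleC = matrix_mult_scaleC_left matrix_mult_scaleC_right

text \<open>Together these characterise \<open>jaffard_op_norm\<close> on the Jaffard space as the
  best constant for left multiplication, which makes its submultiplicativity and triangle inequality
  immediate.\<close>

lemma
  fixes A :: "('d, 'h::complex_hilbert) op_matrix"
  assumes A: "A \<in> jaffard_space X s"
  shows jaffard_op_norm_le_bound: "jaffard_op_norm X s A \<le> mult_const * jaffard_bound X s A"
    and jaffard_op_norm_mult_bound: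
      "B \<in> jaffard_space X s \<Longrightarrow>
        jaffard_bound X s (matrix_mult X A B) \<le> jaffard_op_norm X s A * jaffard_bound X s B"
    and jaffard_op_norm_leI:
      "0 \<le> c \<Longrightarrow> (\<And>B. B \<in> jaffard_space X s \<Longrightarrow>
          jaffard_bound X s (matrix_mult X A B) \<le> c * jaffard_bound X s B) \<Longrightarrow> jaffard_op_norm X s A \<le> c"
proof -
  let ?S = "SUP B\<in>{B \<in> jaffard_space X s. jaffard_norm X s B = 1}. jaffard_norm X s (matrix_mult X A B)"
  have S_le: "?S \<le> ennreal c"
    if c: "0 \<le> c" "\<And>B. B \<in> jaffard_space X s \<Longrightarrow>
        jaffard_bound X s (matrix_mult X A B) \<le> c * jaffard_bound X s B" for c
  proof (rule SUP_least)
    fix B :: "('d, 'h) op_matrix" assume "B \<in> {B \<in> jaffard_space X s. jaffard_norm X s B = 1}"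
    then have B: "B \<in> jaffard_space X s" "jaffard_bound X s B = 1" by (auto simp: jaffard_bound_def)
    then show "jaffard_norm X s (matrix_mult X A B) \<le> ennreal c"
      using c(2)[OF B(1)] by (simp add: jaffard_norm_eq_bound[OF jaffard_space_mult[OF A B(1)]] ennreal_leI)
  qed
  then show leI: "jaffard_op_norm X s A \<le> c"
    if "0 \<le> c" "\<And>B. B \<in> jaffard_space X s \<Longrightarrow>
        jaffard_bound X s (matrix_mult X A B) \<le> c * jaffard_bound X s B" for c
    unfolding jaffard_op_norm_def using that by (intro enn2real_leI) auto
  show "jaffard_op_norm X s A \<le> mult_const * jaffard_bound X s A"
    by (intro leI jaffard_bound_mult A mult_nonneg_nonneg mult_const_nonneg) simp
  \<comment> \<open>\<open>enn2real\<close> sends infinity to 0, so the supremum must be known to be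
    finite before it can be identified with \<open>jaffard_op_norm\<close>.\<close>
  have "?S \<le> ennreal (mult_const * jaffard_bound X s A)"
    by (intro S_le jaffard_bound_mult A mult_nonneg_nonneg mult_const_nonneg) simp
  then have "?S < top_class.top" using ennreal_less_top by (rule le_less_trans)
  then have S: "?S = ennreal (jaffard_op_norm X s A)"
    unfolding jaffard_op_norm_def by simp
  show "jaffard_bound X s (matrix_mult X A B) \<le> jaffard_op_norm X s A * jaffard_bound X s B"
    if B: "B \<in> jaffard_space X s"
  proof (cases "jaffard_bound X s B = 0")
    case True
    then show ?thesis using jaffard_bound_mult[OF A B] by simp
  next
    case False
    \<comment> \<open>The supremum ranges over the unit sphere only, so \<open>B\<close> is first
      normalised.\<close>
    define c where "c = complex_of_real (inverse (jaffard_bound X s B))"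
    have c: "cmod c = inverse (jaffard_bound X s B)" by (simp add: c_def norm_inverse)
    let ?B = "\<lambda>k l. scaleC_operator c (B k l)"
    have B': "?B \<in> jaffard_space X s" by (rule jaffard_space_scaleC[OF B])
    have "jaffard_norm X s ?B = 1"
      using False by (simp add: jaffard_norm_eq_bound[OF B'] jaffard_bound_scaleC[OF B] c)
    then have "jaffard_norm X s (matrix_mult X A ?B) \<le> ?S"
      using B' by (intro SUP_upper) simp
    then have "jaffard_bound X s (matrix_mult X A ?B) \<le> jaffard_op_norm X s A"
      unfolding S by (simp add: jaffard_norm_eq_bound[OF jaffard_space_mult[OF A B']] jaffard_op_norm_def)
    then have "inverse (jaffard_bound X s B) * jaffard_bound X s (matrix_mult X A B) \<le> jaffard_op_norm X s A"
      by (simp add: matrix_mult_scaleC[OF A B] jaffard_bound_scaleC[OF jaffard_space_mult[OF A B]] c)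
    then have "inverse (jaffard_bound X s B) * jaffard_bound X s (matrix_mult X A B) * jaffard_bound X s B
        \<le> jaffard_op_norm X s A * jaffard_bound X s B"
      by (rule mult_right_mono) simp
    then show ?thesis using False by (simp add: field_simps)
  qed
qed

lemma jaffard_op_norm_nonneg [simp]: "0 \<le> jaffard_op_norm X s A"
  by (simp add: jaffard_op_norm_def)

text \<open>Left multiplication is tested on the unit matrix, whose Jaffard norm is at most 1. With
  \<open>jaffard_op_norm_le_bound\<close> this is the equivalence of the two norms.\<close>

lemma jaffard_bound_le_op_norm:
  fixes A :: "('d, 'h::complex_hilbert) op_matrix"
  assumes A: "A \<in> jaffard_space X s"
  shows "jaffard_bound X s A \<le> jaffard_op_norm X s A"
proof -
  have "jaffard_bound X s A \<le> jaffard_op_norm X s A * jaffard_bound X s (jaffard_one X :: ('d, 'h) op_matrix)"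
    using jaffard_op_norm_mult_bound[OF A jaffard_space_one] by (simp add: matrix_mult_one A)
  also have "\<dots> \<le> jaffard_op_norm X s A * 1"
    by (intro mult_left_mono jaffard_bound_one_le jaffard_op_norm_nonneg)
  finally show ?thesis by simp
qed

lemma jaffard_op_norm_scaleC_le:
  fixes A :: "('d, 'h::complex_hilbert) op_matrix"
  assumes A: "A \<in> jaffard_space X s"
  shows "jaffard_op_norm X s (\<lambda>k l. scaleC_operator c (A k l)) \<le> cmod c * jaffard_op_norm X s A"
proof (rule jaffard_op_norm_leI[OF jaffard_space_scaleC[OF A]])
  fix B :: "('d, 'h) op_matrix" assume B: "B \<in> jaffard_space X s"
  show "jaffard_bound X s (matrix_mult X (\<lambda>k l. scaleC_operator c (A k l)) B)
      \<le> cmod c * jaffard_op_norm X s A * jaffard_bound X s B"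
    using mult_left_mono[OF jaffard_op_norm_mult_bound[OF A B], of "cmod c"]
    by (simp add: matrix_mult_scaleC[OF A B] jaffard_bound_scaleC[OF jaffard_space_mult[OF A B]] mult.assoc)
qed simp

lemma abelian_group_jaffard_algebra:
  "abelian_group (jaffard_algebra X s :: ('d, 'h::complex_hilbert) op_matrix star_algebra)"
proof (rule abelian_groupI, unfold jaffard_algebra_simps)
  fix A :: "('d, 'h) op_matrix" assume "A \<in> jaffard_space X s"
  then show "\<exists>B\<in>jaffard_space X s. (\<lambda>k l. B k l + A k l) = (\<lambda>k l. 0)"
    by (intro bexI[OF _ jaffard_space_scaleC[of A X s "-1"]]) (auto simp: scaleC_operator_minus_one)
qed (auto simp: jaffard_space_add jaffard_space_zero ac_simps)

lemma ring_jaffard_algebra: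
  "ring (jaffard_algebra X s :: ('d, 'h::complex_hilbert) op_matrix star_algebra)"
proof (rule ringI[OF abelian_group_jaffard_algebra])
  show "monoid (jaffard_algebra X s :: ('d, 'h) op_matrix star_algebra)"
    by (rule monoidI)
       (auto simp: jaffard_algebra_simps jaffard_space_closed matrix_mult_assoc matrix_mult_one)
qed (auto simp: jaffard_algebra_simps matrix_mult_distrib)

lemma module_jaffard_algebra:
  "Module.module complex_ring (jaffard_algebra X s :: ('d, 'h::complex_hilbert) op_matrix star_algebra)"
  by (rule moduleI[OF cring_complex_ring abelian_group_jaffard_algebra])
     (auto simp: jaffard_algebra_simps complex_ring_def jaffard_space_scaleC scaleC_operator_add_left
       scaleC_operator_add_right scaleC_operator_scaleC_operator scaleC_operator_one)

lemma jaffard_algebra_minus: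
  fixes A :: "('d, 'h::complex_hilbert) op_matrix"
  assumes "A \<in> jaffard_space X s" "B \<in> jaffard_space X s"
  shows "A \<ominus>\<^bsub>jaffard_algebra X s\<^esub> B = (\<lambda>k l. A k l - B k l)"
proof -
  interpret abelian_group "jaffard_algebra X s :: ('d, 'h) op_matrix star_algebra"
    by (rule abelian_group_jaffard_algebra)
  have "\<ominus>\<^bsub>jaffard_algebra X s\<^esub> B = (\<lambda>k l. - B k l)"
    using assms(2) jaffard_space_scaleC[OF assms(2), of "-1"] by (intro minus_equality)
      (auto simp: jaffard_algebra_simps scaleC_operator_minus_one)
  then show ?thesis by (simp add: a_minus_def jaffard_algebra_simps)
qed

lemma unital_banach_algebra_jaffard_algebra:
  "unital_banach_algebra (jaffard_algebra X s :: ('d, 'h::complex_hilbert) op_matrix star_algebra)"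
    (is "unital_banach_algebra ?J")
proof (intro unital_banach_algebra.intro ring_jaffard_algebra module_jaffard_algebra
    unital_banach_algebra_axioms.intro)
  fix A :: "('d, 'h) op_matrix" and c
  assume "A \<in> carrier ?J"
  then have A: "A \<in> jaffard_space X s" by (simp add: jaffard_algebra_simps)
  show "0 \<le> anorm ?J A" by (simp add: jaffard_algebra_simps)
  show "anorm ?J A = 0 \<longleftrightarrow> A = \<zero>\<^bsub>?J\<^esub>"
    unfolding jaffard_algebra_simps jaffard_bound_zero_iff[OF A, symmetric]
  proof
    assume "jaffard_op_norm X s A = 0"
    then show "jaffard_bound X s A = 0"
      using jaffard_bound_le_op_norm[OF A] by (simp add: order_antisym)
  next
    assume "jaffard_bound X s A = 0"
    then show "jaffard_op_norm X s A = 0"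
      using jaffard_op_norm_le_bound[OF A] jaffard_op_norm_nonneg[of A] by simp
  qed
  show "anorm ?J (c \<odot>\<^bsub>?J\<^esub> A) = cmod c * anorm ?J A"
  proof (cases "c = 0")
    case True
    then show ?thesis using jaffard_op_norm_scaleC_le[OF A, of c]
      by (simp add: jaffard_algebra_simps order_antisym)
  next
    case False
    have "jaffard_op_norm X s A \<le> inverse (cmod c) * jaffard_op_norm X s (\<lambda>k l. scaleC_operator c (A k l))"
      using jaffard_op_norm_scaleC_le[OF jaffard_space_scaleC[OF A], of "inverse c" c] False
      by (simp add: scaleC_operator_scaleC_operator scaleC_operator_one norm_inverse)
    then have "cmod c * jaffard_op_norm X s A \<le> jaffard_op_norm X s (\<lambda>k l. scaleC_operator c (A k l))"
      using False by (simp add: field_simps)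
    then show ?thesis using jaffard_op_norm_scaleC_le[OF A, of c] by (simp add: jaffard_algebra_simps)
  qed
  fix B assume "B \<in> carrier ?J"
  then have B: "B \<in> jaffard_space X s" by (simp add: jaffard_algebra_simps)
  show "(c \<odot>\<^bsub>?J\<^esub> A) \<otimes>\<^bsub>?J\<^esub> B = c \<odot>\<^bsub>?J\<^esub> (A \<otimes>\<^bsub>?J\<^esub> B)"
    and "A \<otimes>\<^bsub>?J\<^esub> (c \<odot>\<^bsub>?J\<^esub> B) = c \<odot>\<^bsub>?J\<^esub> (A \<otimes>\<^bsub>?J\<^esub> B)"
    by (simp_all add: jaffard_algebra_simps matrix_mult_scaleC[OF A B])
  show "anorm ?J (A \<oplus>\<^bsub>?J\<^esub> B) \<le> anorm ?J A + anorm ?J B"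
    unfolding jaffard_algebra_simps
  proof (rule jaffard_op_norm_leI[OF jaffard_space_add[OF A B]])
    fix C :: "('d, 'h) op_matrix" assume C: "C \<in> jaffard_space X s"
    show "jaffard_bound X s (matrix_mult X (\<lambda>k l. A k l + B k l) C)
        \<le> (jaffard_op_norm X s A + jaffard_op_norm X s B) * jaffard_bound X s C"
      using jaffard_bound_add[OF jaffard_space_mult[OF A C] jaffard_space_mult[OF B C]]
        jaffard_op_norm_mult_bound[OF A C] jaffard_op_norm_mult_bound[OF B C]
      by (simp add: matrix_mult_distrib(1)[OF A B C] distrib_right)
  qed simp
  show "anorm ?J (A \<otimes>\<^bsub>?J\<^esub> B) \<le> anorm ?J A * anorm ?J B"
    unfolding jaffard_algebra_simps
  proof (rule jaffard_op_norm_leI[OF jaffard_space_mult[OF A B]])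
    fix C :: "('d, 'h) op_matrix" assume C: "C \<in> jaffard_space X s"
    have "jaffard_bound X s (matrix_mult X (matrix_mult X A B) C)
        \<le> jaffard_op_norm X s A * jaffard_bound X s (matrix_mult X B C)"
      using jaffard_op_norm_mult_bound[OF A jaffard_space_mult[OF B C]]
      by (simp add: matrix_mult_assoc[OF A B C])
    also have "\<dots> \<le> jaffard_op_norm X s A * (jaffard_op_norm X s B * jaffard_bound X s C)"
      by (intro mult_left_mono jaffard_op_norm_mult_bound B C) simp
    finally show "jaffard_bound X s (matrix_mult X (matrix_mult X A B) C)
        \<le> jaffard_op_norm X s A * jaffard_op_norm X s B * jaffard_bound X s C"
      by (simp add: mult.assoc)
  qed simp
next
  assume ne: "\<one>\<^bsub>?J\<^esub> \<noteq> \<zero>\<^bsub>?J\<^esub>"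
  let ?I = "jaffard_one X :: ('d, 'h) op_matrix"
  have I: "?I \<in> jaffard_space X s" by (rule jaffard_space_one)
  have pos: "0 < jaffard_bound X s ?I"
    using ne jaffard_bound_zero_iff[OF I] jaffard_bound_nonneg[of X s ?I]
    by (simp add: jaffard_algebra_simps less_le)
  have "jaffard_op_norm X s ?I \<le> 1"
    by (rule jaffard_op_norm_leI[OF I]) (auto simp: matrix_mult_one)
  moreover have "1 \<le> jaffard_op_norm X s ?I"
    using jaffard_op_norm_mult_bound[OF I I] pos by (simp add: matrix_mult_one[OF I])
  ultimately show "anorm ?J \<one>\<^bsub>?J\<^esub> = 1" by (simp add: jaffard_algebra_simps)
next
  fix u :: "nat \<Rightarrow> ('d, 'h) op_matrix"
  assume "\<And>n. u n \<in> carrier ?J"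
  then have u: "\<And>n. u n \<in> jaffard_space X s" by (simp add: jaffard_algebra_simps)
  assume C: "\<And>e. 0 < e \<Longrightarrow> \<exists>N. \<forall>m\<ge>N. \<forall>n\<ge>N. anorm ?J (u m \<ominus>\<^bsub>?J\<^esub> u n) < e"
  \<comment> \<open>Completeness is carried over from the entrywise norm: one half of the norm
    equivalence transfers the Cauchy condition, the other half the convergence.\<close>
  have "\<exists>A\<in>jaffard_space X s. \<forall>e>0. \<exists>N. \<forall>m\<ge>N. jaffard_bound X s (\<lambda>k l. u m k l - A k l) \<le> e"
  proof (rule jaffard_space_complete[OF u s_pos(2)])
    fix e :: real assume "0 < e"
    then obtain N where N: "\<And>m n. m \<ge> N \<Longrightarrow> n \<ge> N \<Longrightarrow> anorm ?J (u m \<ominus>\<^bsub>?J\<^esub> u n) < e"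
      using C by blast
    have "jaffard_bound X s (\<lambda>k l. u m k l - u n k l) < e" if "m \<ge> N" "n \<ge> N" for m n
      using N[OF that] jaffard_bound_le_op_norm[OF jaffard_space_diff[OF u u], of m n]
      by (simp add: jaffard_algebra_simps jaffard_algebra_minus[OF u u])
    then show "\<exists>N. \<forall>m\<ge>N. \<forall>n\<ge>N. jaffard_bound X s (\<lambda>k l. u m k l - u n k l) < e" by blast
  qed
  then obtain A where A: "A \<in> jaffard_space X s"
    and lim: "\<And>e. e > 0 \<Longrightarrow> \<exists>N. \<forall>m\<ge>N. jaffard_bound X s (\<lambda>k l. u m k l - A k l) \<le> e" by blast
  have "(\<lambda>n. jaffard_bound X s (\<lambda>k l. u n k l - A k l)) \<longlonglongrightarrow> 0"
  proof (rule LIMSEQ_I)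
    fix r :: real assume "r > 0"
    then obtain N where N: "\<forall>m\<ge>N. jaffard_bound X s (\<lambda>k l. u m k l - A k l) \<le> r / 2"
      using lim[of "r / 2"] by auto
    have "norm (jaffard_bound X s (\<lambda>k l. u n k l - A k l) - 0) < r" if "n \<ge> N" for n
      using N[rule_format, OF that] \<open>r > 0\<close> by simp
    then show "\<exists>N. \<forall>n\<ge>N. norm (jaffard_bound X s (\<lambda>k l. u n k l - A k l) - 0) < r"
      by blast
  qed
  then have "(\<lambda>n. mult_const * jaffard_bound X s (\<lambda>k l. u n k l - A k l)) \<longlonglongrightarrow> mult_const * 0"
    by (rule tendsto_mult_left)
  then have conv: "(\<lambda>n. mult_const * jaffard_bound X s (\<lambda>k l. u n k l - A k l)) \<longlonglongrightarrow> 0" by simp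
  have "norm (jaffard_op_norm X s (\<lambda>k l. u n k l - A k l))
      \<le> mult_const * jaffard_bound X s (\<lambda>k l. u n k l - A k l)" for n
    using jaffard_op_norm_le_bound[OF jaffard_space_diff[OF u A]] by simp
  then have "(\<lambda>n. jaffard_op_norm X s (\<lambda>k l. u n k l - A k l)) \<longlonglongrightarrow> 0"
    by (rule Lim_null_comparison[OF always_eventually[OF allI] conv])
  then show "\<exists>A\<in>carrier ?J. (\<lambda>n. anorm ?J (u n \<ominus>\<^bsub>?J\<^esub> A)) \<longlonglongrightarrow> 0"
    unfolding jaffard_algebra_minus[OF u A, symmetric] using A
    by (intro bexI[of _ A]) (simp_all only: jaffard_algebra_simps)
qed

end

section \<open>The inner product on square-summable families and the involution\<close>

text \<open>The real part of the complex inner product on families.\<close>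

definition ell2_inner :: "(real^'d) set \<Rightarrow> (real^'d \<Rightarrow> 'h::complex_hilbert) \<Rightarrow> (real^'d \<Rightarrow> 'h) \<Rightarrow> real" where
  "ell2_inner X f g = (\<Sum>\<^sub>\<infinity>k\<in>X. inner (f k) (g k))"

lemma ell2_inner_summable:
  assumes "f \<in> ell2 X" "g \<in> ell2 X"
  shows "(\<lambda>k. inner (f k) (g k)) summable_on X"
proof (rule summable_on_dominated)
  show "(\<lambda>k. (norm (f k))\<^sup>2 + (norm (g k))\<^sup>2) summable_on X"
    by (intro summable_on_add ell2_summable assms)
  fix k
  have "\<bar>inner (f k) (g k)\<bar> \<le> norm (f k) * norm (g k)" by (rule Cauchy_Schwarz_ineq2)
  also have "\<dots> \<le> (norm (f k))\<^sup>2 + (norm (g k))\<^sup>2"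
  proof -
    have "2 * (norm (f k) * norm (g k)) \<le> (norm (f k))\<^sup>2 + (norm (g k))\<^sup>2"
      using sum_squares_bound[of "norm (f k)" "norm (g k)"] by simp
    moreover have "0 \<le> norm (f k) * norm (g k)" by simp
    ultimately show ?thesis by linarith
  qed
  finally show "norm (inner (f k) (g k)) \<le> (norm (f k))\<^sup>2 + (norm (g k))\<^sup>2" by simp
qed

lemma ell2_inner_commute: "ell2_inner X f g = ell2_inner X g f"
  by (simp add: ell2_inner_def inner_commute)

lemma ell2_inner_self: "ell2_inner X f f = (ell2_norm X f)\<^sup>2"
  by (simp add: ell2_inner_def ell2_norm_square power2_norm_eq_inner)

lemma abs_ell2_inner_le:
  assumes f: "f \<in> ell2 X" and g: "g \<in> ell2 X"
  shows "\<bar>ell2_inner X f g\<bar> \<le> ell2_norm X f * ell2_norm X g"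
proof -
  have sm: "(\<lambda>k. norm (inner (f k) (g k))) summable_on X"
    using ell2_inner_summable[OF f g] by (rule summable_on_iff_abs_summable_on_real[THEN iffD1])
  have "\<bar>ell2_inner X f g\<bar> \<le> (\<Sum>\<^sub>\<infinity>k\<in>X. norm (inner (f k) (g k)))"
    using norm_infsum_bound[OF sm] by (simp add: ell2_inner_def)
  also have "\<dots> \<le> ell2_norm X f * ell2_norm X g"
  proof (rule infsum_le_finite_sums[OF sm])
    fix F assume F: "finite F" "F \<subseteq> X"
    have "(\<Sum>k\<in>F. norm (inner (f k) (g k))) \<le> (\<Sum>k\<in>F. \<bar>norm (f k)\<bar> * \<bar>norm (g k)\<bar>)"
      by (intro sum_mono) (simp add: Cauchy_Schwarz_ineq2)
    also have "\<dots> \<le> L2_set (\<lambda>k. norm (f k)) F * L2_set (\<lambda>k. norm (g k)) F"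
      by (rule L2_set_mult_ineq)
    also have "\<dots> \<le> ell2_norm X f * ell2_norm X g"
      by (intro mult_mono L2_set_le_ell2_norm f g F) auto
    finally show "(\<Sum>k\<in>F. norm (inner (f k) (g k))) \<le> ell2_norm X f * ell2_norm X g" .
  qed
  finally show ?thesis .
qed

lemma ell2_inner_diff_left:
  assumes "f \<in> ell2 X" "g \<in> ell2 X" "h \<in> ell2 X"
  shows "ell2_inner X (\<lambda>k. f k - g k) h = ell2_inner X f h - ell2_inner X g h"
proof -
  have "((\<lambda>k. inner (f k) (h k) + - inner (g k) (h k)) has_sum (ell2_inner X f h + - ell2_inner X g h)) X"
    unfolding ell2_inner_def
    by (intro has_sum_add has_sum_uminusI has_sum_infsum ell2_inner_summable assms)
  then show ?thesis by (simp add: ell2_inner_def[of X "\<lambda>k. f k - g k"] inner_diff_left infsumI)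
qed

lemma ell2_norm_diff_square:
  assumes f: "f \<in> ell2 X" and g: "g \<in> ell2 X"
  shows "(ell2_norm X (\<lambda>k. f k - g k))\<^sup>2 = (ell2_norm X f)\<^sup>2 - 2 * ell2_inner X f g + (ell2_norm X g)\<^sup>2"
proof -
  have fg: "(\<lambda>k. f k - g k) \<in> ell2 X" by (rule ell2_diff[OF f g])
  have "(ell2_norm X (\<lambda>k. f k - g k))\<^sup>2
      = ell2_inner X f (\<lambda>k. f k - g k) - ell2_inner X g (\<lambda>k. f k - g k)"
    by (simp only: ell2_inner_self[symmetric] ell2_inner_diff_left[OF f g fg])
  also have "\<dots> = ell2_inner X f f - 2 * ell2_inner X f g + ell2_inner X g g"
    by (simp add: ell2_inner_commute[of X _ "\<lambda>k. f k - g k"] ell2_inner_diff_left[OF f g f]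
        ell2_inner_diff_left[OF f g g] ell2_inner_commute[of X g f])
  finally show ?thesis by (simp add: ell2_inner_self)
qed

lemma ell2_inner_scaleC_self: "ell2_inner X (\<lambda>k. z *\<^sub>C f k) f = Re z * (ell2_norm X f)\<^sup>2"
  by (simp add: ell2_inner_def inner_scaleC_self ell2_norm_square infsum_cmult_right')

lemma ell2_inner_scaleC_scaleC_i:
  "ell2_inner X (\<lambda>k. z *\<^sub>C f k) (\<lambda>k. \<i> *\<^sub>C f k) = Im z * (ell2_norm X f)\<^sup>2"
  by (simp add: ell2_inner_def inner_scaleC_scaleC_i_self ell2_norm_square infsum_cmult_right')

lemma ell2_inner_scaleC_i_self: "ell2_inner X f (\<lambda>k. \<i> *\<^sub>C f k) = 0"
  by (simp add: ell2_inner_def inner_scaleC_i_self)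

section \<open>The involution, and its agreement with the adjoint on families\<close>

definition matrix_star :: "('d, 'h::complex_hilbert) op_matrix \<Rightarrow> ('d, 'h) op_matrix" where
  "matrix_star A = (\<lambda>k l. adjoint_operator (A l k))"

lemma star_jaffard_algebra: "star (jaffard_algebra X s) = matrix_star"
  by (simp add: jaffard_algebra_def matrix_star_def fun_eq_iff)

lemma jaffard_space_star:
  assumes A: "A \<in> jaffard_space X s"
  shows "matrix_star A \<in> jaffard_space X s"
proof (rule jaffard_spaceI)
  show "0 \<le> jaffard_bound X s A" by simp
  fix k l
  show "matrix_star A k l \<in> bounded_operators"
    unfolding matrix_star_def by (intro bounded_operators_adjoint jaffard_spaceD(1)[OF A])
  show "matrix_star A k l = 0" if "k \<notin> X \<or> l \<notin> X"
    using that jaffard_spaceD(2,3)[OF A] by (auto simp: matrix_star_def adjoint_operator_zero)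
  show "norm (matrix_star A k l) \<le> jaffard_bound X s A * weight s k l"
    using order_trans[OF norm_adjoint_operator_le[OF jaffard_spaceD(1)[OF A]] jaffard_entry_bound[OF A], of l k]
    by (simp add: matrix_star_def weight_commute)
qed

lemma matrix_star_star: "A \<in> jaffard_space X s \<Longrightarrow> matrix_star (matrix_star A) = A"
  by (simp add: matrix_star_def adjoint_operator_adjoint jaffard_spaceD(1))

lemma matrix_star_add:
  "A \<in> jaffard_space X s \<Longrightarrow> B \<in> jaffard_space X s \<Longrightarrow>
    matrix_star (\<lambda>k l. A k l + B k l) = (\<lambda>k l. matrix_star A k l + matrix_star B k l)"
  by (simp add: matrix_star_def adjoint_operator_add jaffard_spaceD(1))

lemma matrix_star_scaleC:
  "A \<in> jaffard_space X s \<Longrightarrow>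
    matrix_star (\<lambda>k l. scaleC_operator c (A k l)) = (\<lambda>k l. scaleC_operator (cnj c) (matrix_star A k l))"
  by (simp add: matrix_star_def adjoint_operator_scaleC jaffard_spaceD(1))

lemma matrix_star_one: "matrix_star (jaffard_one X) = jaffard_one X"
  unfolding matrix_star_def jaffard_one_def
  by (intro ext adjoint_operator_eqI) (auto simp: bounded_operators_id bounded_operators_zero)

context jaffard
begin

text \<open>Pairing with a fixed vector is continuous and so passes through the infinite sum
  defining an entry of the product.\<close>

lemma matrix_star_mult:
  fixes A B :: "('d, 'h::complex_hilbert) op_matrix"
  assumes A: "A \<in> jaffard_space X s" and B: "B \<in> jaffard_space X s"
  shows "matrix_star (matrix_mult X A B) = matrix_mult X (matrix_star B) (matrix_star A)"
proof (intro ext)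
  fix k l
  have "adjoint_operator (matrix_mult X A B l k) = matrix_mult X (matrix_star B) (matrix_star A) k l"
  proof (rule adjoint_operator_eqI[OF matrix_mult_bounded_operators[OF A B]])
    fix x y
    note sum1 = blinfun_apply_infsum[OF matrix_mult_summable[OF A B, of l k], of x]
    note sum2 = blinfun_apply_infsum[OF matrix_mult_summable[OF jaffard_space_star[OF B] jaffard_space_star[OF A], of k l], of y]
    have "inner (blinfun_apply (matrix_mult X A B l k) x) y
        = (\<Sum>\<^sub>\<infinity>n\<in>X. inner (blinfun_apply (A l n o\<^sub>L B n k) x) y)"
      unfolding matrix_mult_def sum1(1)
      by (intro infsumI[symmetric] has_sum_bounded_linear[OF bounded_linear_inner_left] has_sum_infsum sum1(2))
    also have "\<dots> = (\<Sum>\<^sub>\<infinity>n\<in>X. inner x (blinfun_apply (matrix_star B k n o\<^sub>L matrix_star A n l) y))"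
      by (simp add: matrix_star_def inner_adjoint_operator jaffard_spaceD(1)[OF A] jaffard_spaceD(1)[OF B])
    also have "\<dots> = inner x (blinfun_apply (matrix_mult X (matrix_star B) (matrix_star A) k l) y)"
      unfolding matrix_mult_def sum2(1)
      by (intro infsumI has_sum_bounded_linear[OF bounded_linear_inner_right] has_sum_infsum sum2(2))
    finally show "inner (blinfun_apply (matrix_mult X A B l k) x) y
        = inner x (blinfun_apply (matrix_mult X (matrix_star B) (matrix_star A) k l) y)" .
  qed
  then show "matrix_star (matrix_mult X A B) k l = matrix_mult X (matrix_star B) (matrix_star A) k l"
    by (simp add: matrix_star_def)
qed

lemma involutive_banach_algebra_jaffard_algebra:
  "involutive_banach_algebra (jaffard_algebra X s :: ('d, 'h::complex_hilbert) op_matrix star_algebra)"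
  by (intro involutive_banach_algebra.intro involutive_banach_algebra_axioms.intro
      unital_banach_algebra_jaffard_algebra, unfold jaffard_algebra_simps star_jaffard_algebra)
     (simp_all add: jaffard_space_star matrix_star_star matrix_star_add matrix_star_scaleC matrix_star_mult)

text \<open>The majorant for the next exchange of summations; the sum over \<open>l\<close> is taken
  first because the square depends on \<open>k\<close> only.\<close>

lemma weight_square_summable:
  fixes g :: "real^'d \<Rightarrow> 'h::complex_hilbert"
  assumes g: "g \<in> ell2 X"
  shows "(\<lambda>(k, l). weight s k l * (norm (g k))\<^sup>2) summable_on X \<times> X"
proof (rule summable_on_SigmaI)
  show "((\<lambda>l. (\<lambda>(k, l). weight s k l * (norm (g k))\<^sup>2) (k, l)) has_sum
      (\<Sum>\<^sub>\<infinity>l\<in>X. weight s k l) * (norm (g k))\<^sup>2) X" for k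
    by (simp, intro has_sum_cmult_left has_sum_infsum weight_summable exponent)
  show "(\<lambda>k. (\<Sum>\<^sub>\<infinity>l\<in>X. weight s k l) * (norm (g k))\<^sup>2) summable_on X"
  proof (rule summable_on_dominated)
    show "(\<lambda>k. weight_bound s * (norm (g k))\<^sup>2) summable_on X"
      by (intro summable_on_cmult_right ell2_summable g)
    show "norm ((\<Sum>\<^sub>\<infinity>l\<in>X. weight s k l) * (norm (g k))\<^sup>2) \<le> weight_bound s * (norm (g k))\<^sup>2" for k
      using mult_right_mono[OF infsum_weight_le[OF exponent, of k], of "(norm (g k))\<^sup>2"]
      by (simp add: abs_mult infsum_nonneg)
  qed
qed auto

text \<open>Fubini again. The product \<open>norm (f l) * norm (g k)\<close> is split into a sum of
  squares, so each half of the majorant contains a square of one family and can be summed over the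
  other index first.\<close>

lemma ell2_inner_matrix_star:
  fixes A :: "('d, 'h::complex_hilbert) op_matrix"
  assumes A: "A \<in> jaffard_space X s" and f: "f \<in> ell2 X" and g: "g \<in> ell2 X"
  shows "ell2_inner X (matrix_operator X A f) g = ell2_inner X f (matrix_operator X (matrix_star A) g)"
proof -
  let ?F = "\<lambda>k l. inner (blinfun_apply (A k l) (f l)) (g k)"
  have A': "matrix_star A \<in> jaffard_space X s" by (rule jaffard_space_star[OF A])
  have "(\<lambda>(k, l). ?F k l) summable_on X \<times> X"
  proof (rule summable_on_dominated)
    \<comment> \<open>For the square of \<open>f\<close> the roles of \<open>k\<close> and
      \<open>l\<close> are exchanged, which the symmetry of the weight permits.\<close>
    have "(\<lambda>(k, l). weight s k l * (norm (f l))\<^sup>2) summable_on X \<times> X"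
      using weight_square_summable[OF f] by (subst summable_on_swap) (simp add: weight_commute[of s] case_prod_unfold)
    then have "(\<lambda>p. (\<lambda>(k, l). weight s k l * (norm (f l))\<^sup>2) p + (\<lambda>(k, l). weight s k l * (norm (g k))\<^sup>2) p)
        summable_on X \<times> X"
      by (intro summable_on_add weight_square_summable g)
    then show "(\<lambda>p. jaffard_bound X s A *
        ((\<lambda>(k, l). weight s k l * (norm (f l))\<^sup>2) p + (\<lambda>(k, l). weight s k l * (norm (g k))\<^sup>2) p))
        summable_on X \<times> X"
      by (rule summable_on_cmult_right)
    have "norm (?F k l) \<le> jaffard_bound X s A * (weight s k l * (norm (f l))\<^sup>2 + weight s k l * (norm (g k))\<^sup>2)" for k l
    proof -
      have "norm (?F k l) \<le> norm (blinfun_apply (A k l) (f l)) * norm (g k)"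
        by (simp add: Cauchy_Schwarz_ineq2)
      also have "\<dots> \<le> (norm (A k l) * norm (f l)) * norm (g k)"
        by (intro mult_right_mono norm_blinfun) simp
      also have "\<dots> \<le> (jaffard_bound X s A * weight s k l) * (norm (f l) * norm (g k))"
        unfolding mult.assoc[of "norm (A k l)"]
        by (intro mult_right_mono jaffard_entry_bound[OF A]) simp
      also have "\<dots> \<le> (jaffard_bound X s A * weight s k l) * ((norm (f l))\<^sup>2 + (norm (g k))\<^sup>2)"
      proof (rule mult_left_mono)
        have "2 * (norm (f l) * norm (g k)) \<le> (norm (f l))\<^sup>2 + (norm (g k))\<^sup>2"
          using sum_squares_bound[of "norm (f l)" "norm (g k)"] by simp
        moreover have "0 \<le> norm (f l) * norm (g k)" by simp
        ultimately show "norm (f l) * norm (g k) \<le> (norm (f l))\<^sup>2 + (norm (g k))\<^sup>2" by linarith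
      qed simp
      finally show ?thesis by (simp add: algebra_simps)
    qed
    then show "norm (case p of (k, l) \<Rightarrow> ?F k l) \<le> jaffard_bound X s A *
        ((\<lambda>(k, l). weight s k l * (norm (f l))\<^sup>2) p + (\<lambda>(k, l). weight s k l * (norm (g k))\<^sup>2) p)" for p
      by (cases p) auto
  qed
  then have swap: "(\<Sum>\<^sub>\<infinity>k\<in>X. \<Sum>\<^sub>\<infinity>l\<in>X. ?F k l) = (\<Sum>\<^sub>\<infinity>l\<in>X. \<Sum>\<^sub>\<infinity>k\<in>X. ?F k l)"
    by (rule infsum_swap_banach)
  have "(\<Sum>\<^sub>\<infinity>l\<in>X. ?F k l) = inner (matrix_operator X A f k) (g k)" for k
    unfolding matrix_operator_apply[OF f]
    by (intro infsumI has_sum_bounded_linear[OF bounded_linear_inner_left] has_sum_infsum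
        matrix_operator_summable A f)
  moreover have "(\<Sum>\<^sub>\<infinity>k\<in>X. ?F k l) = inner (f l) (matrix_operator X (matrix_star A) g l)" for l
  proof -
    have "(\<Sum>\<^sub>\<infinity>k\<in>X. inner (f l) (blinfun_apply (matrix_star A l k) (g k)))
        = inner (f l) (matrix_operator X (matrix_star A) g l)"
      unfolding matrix_operator_apply[OF g]
      by (intro infsumI has_sum_bounded_linear[OF bounded_linear_inner_right] has_sum_infsum
          matrix_operator_summable A' g)
    then show ?thesis by (simp add: matrix_star_def inner_adjoint_operator jaffard_spaceD(1)[OF A])
  qed
  ultimately show ?thesis using swap by (simp add: ell2_inner_def)
qed

end

section \<open>Left inverses\<close>

text \<open>After normalising by \<open>q ^ 2 ^ m\<close> the recursion grows at most like \<open>L powr (1 + \<theta>) ^ m\<close>, which loses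
  against \<open>q ^ 2 ^ m\<close> since \<open>1 + \<theta> < 2\<close>.\<close>

lemma subquadratic_recursion_tendsto_0:
  fixes a :: "nat \<Rightarrow> real"
  assumes a: "\<And>m. 0 \<le> a m" and q: "0 < q" "q < 1" and \<theta>: "0 < \<theta>" "\<theta> < 1" and C: "0 < C"
    and step: "\<And>m. a (Suc m) \<le> C * a m powr (1 + \<theta>) * (q ^ 2 ^ m) powr (1 - \<theta>)"
  shows "a \<longlonglongrightarrow> 0"
proof -
  \<comment> \<open>Chosen so that \<open>D powr (1 + \<theta>) = D * C\<close>: rescaling by
    \<open>D\<close> absorbs the constant of the recursion.\<close>
  define D where "D = C powr (1 / \<theta>)"
  have D: "0 < D" using C by (simp add: D_def)
  have D_powr: "D powr (1 + \<theta>) = D * C"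
    using C \<theta> by (simp add: D_def powr_powr powr_add distrib_left)
  define v where "v m = D * a m / q ^ 2 ^ m" for m
  have v_nonneg: "0 \<le> v m" for m using a[of m] D q by (simp add: v_def)
  have v_step: "v (Suc m) \<le> v m powr (1 + \<theta>)" for m
  proof -
    let ?Q = "q ^ 2 ^ m"
    have Q: "?Q > 0" using q by simp
    have QQ: "q ^ 2 ^ Suc m = ?Q * ?Q" by (simp add: power_add[symmetric] mult_2)
    \<comment> \<open>The powers of \<open>q\<close> balance because
      \<open>(1 - \<theta>) - 2 = - (1 + \<theta>)\<close>; hence the normalised sequence satisfies
      the pure recursion \<open>v (Suc m) \<le> v m powr (1 + \<theta>)\<close>.\<close>
    have Q_powr: "?Q powr (1 - \<theta>) / (?Q * ?Q) = 1 / ?Q powr (1 + \<theta>)"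
    proof -
      have "?Q powr (1 - \<theta>) * ?Q powr (1 + \<theta>) = ?Q powr 2" by (simp add: powr_add[symmetric])
      also have "\<dots> = ?Q * ?Q" using Q by (simp add: power2_eq_square)
      finally have "?Q powr (1 - \<theta>) * ?Q powr (1 + \<theta>) = ?Q * ?Q" .
      moreover have key: "x / z = 1 / y" if "x * y = z" "0 < z" for x y z :: real
        using that by (auto simp: field_simps)
      ultimately show ?thesis by (intro key) (use Q in simp_all)
    qed
    have "v (Suc m) \<le> D * (C * a m powr (1 + \<theta>) * ?Q powr (1 - \<theta>)) / (?Q * ?Q)"
      unfolding v_def QQ using step[of m] D Q by (intro divide_right_mono mult_left_mono) auto
    also have "\<dots> = (D * C) * a m powr (1 + \<theta>) * (?Q powr (1 - \<theta>) / (?Q * ?Q))" by simp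
    also have "\<dots> = D powr (1 + \<theta>) * a m powr (1 + \<theta>) / ?Q powr (1 + \<theta>)"
      unfolding Q_powr D_powr by simp
    also have "\<dots> = v m powr (1 + \<theta>)"
      using a[of m] D Q by (simp add: v_def powr_mult powr_divide)
    finally show ?thesis .
  qed
  define L where "L = max 1 (v 0)"
  have v_le: "v m \<le> L powr ((1 + \<theta>) ^ m)" for m
  proof (induction m)
    case (Suc m)
    have "v (Suc m) \<le> v m powr (1 + \<theta>)" by (rule v_step)
    also have "\<dots> \<le> (L powr ((1 + \<theta>) ^ m)) powr (1 + \<theta>)"
      using Suc v_nonneg \<theta> by (intro powr_mono2) auto
    finally show ?case by (simp add: powr_powr mult.commute)
  qed (simp add: L_def)
  have L: "1 \<le> L" by (simp add: L_def)
  \<comment> \<open>With \<open>2 ^ m\<close> factored out of the exponent, the bracket tends to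
    \<open>ln q\<close>, which is negative.\<close>
  have a_le: "a m \<le> exp ((((1 + \<theta>) / 2) ^ m * ln L + ln q) * 2 ^ m) / D" for m
  proof -
    have "a m = v m * q ^ 2 ^ m / D" using D q by (simp add: v_def)
    also have "\<dots> \<le> L powr ((1 + \<theta>) ^ m) * q ^ 2 ^ m / D"
      using v_le[of m] D q by (intro divide_right_mono mult_right_mono) auto
    also have "q ^ 2 ^ m = exp (2 ^ m * ln q)"
      using q by (simp add: exp_of_nat_mult[symmetric] powr_realpow[symmetric] powr_def)
    also have "L powr ((1 + \<theta>) ^ m) = exp ((1 + \<theta>) ^ m * ln L)" using L by (simp add: powr_def)
    finally have "a m \<le> exp ((1 + \<theta>) ^ m * ln L + 2 ^ m * ln q) / D" by (simp add: exp_add)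
    moreover have "(((1 + \<theta>) / 2) ^ m * ln L + ln q) * 2 ^ m
        = ((1 + \<theta>) / 2) ^ m * 2 ^ m * ln L + 2 ^ m * ln q"
      by (simp only: distrib_left distrib_right mult_ac)
    moreover have "((1 + \<theta>) / 2) ^ m * 2 ^ m = (1 + \<theta>) ^ m"
      by (simp add: power_divide)
    ultimately show ?thesis by simp
  qed
  have "(\<lambda>m. ((1 + \<theta>) / 2) ^ m) \<longlonglongrightarrow> 0" using \<theta> by (intro LIMSEQ_realpow_zero) auto
  then have "(\<lambda>m. ((1 + \<theta>) / 2) ^ m * ln L + ln q) \<longlonglongrightarrow> 0 * ln L + ln q"
    by (intro tendsto_add tendsto_mult tendsto_const)
  moreover have "filterlim (\<lambda>m. (2::real) ^ m) at_top sequentially"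
    by (intro filterlim_at_infinity_imp_filterlim_at_top filterlim_realpow_sequentially_gt1) auto
  ultimately have "filterlim (\<lambda>m. (((1 + \<theta>) / 2) ^ m * ln L + ln q) * 2 ^ m) at_bot sequentially"
    using q by (intro filterlim_tendsto_neg_mult_at_bot[where c = "ln q"]) auto
  then have "(\<lambda>m. exp ((((1 + \<theta>) / 2) ^ m * ln L + ln q) * 2 ^ m)) \<longlonglongrightarrow> 0"
    by (rule filterlim_compose[OF exp_at_bot])
  then have "(\<lambda>m. exp ((((1 + \<theta>) / 2) ^ m * ln L + ln q) * 2 ^ m) / D) \<longlonglongrightarrow> 0 / D"
    using D by (intro tendsto_divide tendsto_const) auto
  then have lim: "(\<lambda>m. exp ((((1 + \<theta>) / 2) ^ m * ln L + ln q) * 2 ^ m) / D) \<longlonglongrightarrow> 0" by simp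
  have "norm (a m) \<le> exp ((((1 + \<theta>) / 2) ^ m * ln L + ln q) * 2 ^ m) / D" for m
    using a_le[of m] a[of m] by simp
  then show ?thesis by (rule Lim_null_comparison[OF always_eventually[OF allI] lim])
qed

lemma interpolate_bound:
  fixes z x y :: real
  assumes "0 \<le> z" "z \<le> x" "z \<le> y" "0 \<le> \<theta>" "\<theta> \<le> 1"
  shows "z \<le> x powr \<theta> * y powr (1 - \<theta>)"
proof -
  have "z = z powr \<theta> * z powr (1 - \<theta>)" using assms(1) by (simp add: powr_add[symmetric])
  also have "\<dots> \<le> x powr \<theta> * y powr (1 - \<theta>)"
    using assms by (intro mult_mono powr_mono2) auto
  finally show ?thesis .
qed

lemma
  assumes A: "A \<in> jaffard_space X s" and B: "B \<in> jaffard_space X s"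
  shows jaffard_bound_diff_le:
      "jaffard_bound X s (\<lambda>k l. A k l - B k l) \<le> jaffard_bound X s A + jaffard_bound X s B"
    and jaffard_bound_minus_commute:
      "jaffard_bound X s (\<lambda>k l. A k l - B k l) = jaffard_bound X s (\<lambda>k l. B k l - A k l)"
proof -
  have B': "(\<lambda>k l. - B k l) \<in> jaffard_space X s"
    using jaffard_space_scaleC[OF B, of "-1"] by (simp add: scaleC_operator_minus_one)
  have "jaffard_bound X s (\<lambda>k l. - B k l) = jaffard_bound X s B"
    using jaffard_bound_scaleC[OF B, of "-1"] by (simp add: scaleC_operator_minus_one)
  then show "jaffard_bound X s (\<lambda>k l. A k l - B k l) \<le> jaffard_bound X s A + jaffard_bound X s B"
    using jaffard_bound_add[OF A B'] by simp
  show "jaffard_bound X s (\<lambda>k l. A k l - B k l) = jaffard_bound X s (\<lambda>k l. B k l - A k l)"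
    using jaffard_bound_scaleC[OF jaffard_space_diff[OF A B], of "-1"]
    by (simp add: scaleC_operator_minus_one)
qed

section \<open>Neumann series and the passage from operator norm to Jaffard norm\<close>

context jaffard
begin

lemma matrix_mult_diff:
  fixes A B C :: "('d, 'h::complex_hilbert) op_matrix"
  assumes A: "A \<in> jaffard_space X s" and B: "B \<in> jaffard_space X s" and C: "C \<in> jaffard_space X s"
  shows "matrix_mult X (\<lambda>k l. A k l - B k l) C = (\<lambda>k l. matrix_mult X A C k l - matrix_mult X B C k l)"
    and "matrix_mult X C (\<lambda>k l. A k l - B k l) = (\<lambda>k l. matrix_mult X C A k l - matrix_mult X C B k l)"
  using matrix_mult_distrib[OF A jaffard_space_scaleC[OF B, of "-1"] C]
    matrix_mult_scaleC_left[OF B C, of "-1"] matrix_mult_scaleC_right[OF C B, of "-1"]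
  by (simp_all add: scaleC_operator_minus_one)

lemma matrix_operator_diff:
  fixes A B :: "('d, 'h::complex_hilbert) op_matrix"
  assumes A: "A \<in> jaffard_space X s" and B: "B \<in> jaffard_space X s" and f: "f \<in> ell2 X"
  shows "matrix_operator X (\<lambda>k l. A k l - B k l) f = (\<lambda>k. matrix_operator X A f k - matrix_operator X B f k)"
  using fun_cong[OF matrix_operator_add[OF A jaffard_space_scaleC[OF B, of "-1"]], of f]
    fun_cong[OF matrix_operator_scaleC[OF B, of "-1"], of f] f
  by (simp add: scaleC_operator_minus_one scaleC_minus_one)

text \<open>The partial sums are generated as iterates of \<open>B \<mapsto> 1 + B T\<close>. The
  smallness condition makes right multiplication by \<open>T\<close> a contraction for the Jaffard
  norm, and a fixed point satisfies \<open>B (1 - T) = 1\<close>.\<close>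

lemma neumann_left_inverse:
  fixes T :: "('d, 'h::complex_hilbert) op_matrix"
  assumes T: "T \<in> jaffard_space X s" and small: "mult_const * jaffard_bound X s T < 1"
  shows "\<exists>B\<in>jaffard_space X s. matrix_mult X B (\<lambda>k l. jaffard_one X k l - T k l) = jaffard_one X"
proof -
  let ?I = "jaffard_one X :: ('d, 'h) op_matrix" and ?b = "jaffard_bound X s"
  have I: "?I \<in> jaffard_space X s" by (rule jaffard_space_one)
  define r where "r = mult_const * ?b T"
  have r: "0 \<le> r" "r < 1" using small mult_const_nonneg by (simp_all add: r_def)
  have mult_le: "?b (matrix_mult X B T) \<le> r * ?b B" if "B \<in> jaffard_space X s" for B
    using jaffard_bound_mult[OF that T] by (simp add: r_def mult_ac)
  define u where "u n = ((\<lambda>B k l. ?I k l + matrix_mult X B T k l) ^^ n) ?I" for n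
  have u_0: "u 0 = ?I" and u_Suc: "u (Suc n) = (\<lambda>k l. ?I k l + matrix_mult X (u n) T k l)" for n
    by (simp_all add: u_def)
  have u: "u n \<in> jaffard_space X s" for n
    by (induction n) (simp_all add: u_0 u_Suc I jaffard_space_add jaffard_space_mult T)
  \<comment> \<open>The solution of \<open>K = jaffard_bound X s ?I + r * K\<close>, hence a bound
    preserved by the iteration.\<close>
  define K where "K = ?b ?I / (1 - r)"
  have "?b ?I \<le> K" using r jaffard_bound_nonneg[of X s ?I] by (simp add: K_def field_simps mult_left_le)
  have K_eq: "?b ?I + r * K = K" using r by (simp add: K_def field_simps)
  have u_le: "?b (u n) \<le> K" for n
  proof (induction n)
    case (Suc n)
    have "?b (u (Suc n)) \<le> ?b ?I + r * ?b (u n)"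
      unfolding u_Suc
      using jaffard_bound_add[OF I jaffard_space_mult[OF u[of n] T]] mult_le[OF u[of n]] by linarith
    also have "\<dots> \<le> ?b ?I + r * K" using Suc r by (intro add_left_mono mult_left_mono)
    finally show ?case by (simp add: K_eq)
  qed (simp add: u_0 \<open>?b ?I \<le> K\<close>)
  have u_diff: "(\<lambda>k l. u (Suc m) k l - u (Suc n) k l) = matrix_mult X (\<lambda>k l. u m k l - u n k l) T" for m n
    by (simp add: u_Suc matrix_mult_diff[OF u u T])
  have est: "?b (\<lambda>k l. u (n + j) k l - u n k l) \<le> r ^ n * (K + K)" for n j
  proof (induction n)
    case 0
    show ?case using jaffard_bound_diff_le[OF u[of j] u[of 0]] u_le[of j] u_le[of 0] by simp
  next
    case (Suc n)
    have "?b (\<lambda>k l. u (Suc n + j) k l - u (Suc n) k l) \<le> r * ?b (\<lambda>k l. u (n + j) k l - u n k l)"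
      using mult_le[OF jaffard_space_diff[OF u[of "n + j"] u[of n]]] by (simp add: u_diff)
    also have "\<dots> \<le> r * (r ^ n * (K + K))" using Suc r by (intro mult_left_mono)
    finally show ?case by (simp add: mult.assoc)
  qed
  have "(\<lambda>n. r ^ n * (K + K)) \<longlonglongrightarrow> 0 * (K + K)"
    using r by (intro tendsto_mult LIMSEQ_realpow_zero tendsto_const) auto
  then have rK: "(\<lambda>n. r ^ n * (K + K)) \<longlonglongrightarrow> 0" by simp
  have "\<exists>A\<in>jaffard_space X s. \<forall>e>0. \<exists>N. \<forall>m\<ge>N. ?b (\<lambda>k l. u m k l - A k l) \<le> e"
  proof (rule jaffard_space_complete[OF u s_pos(2)])
    fix e :: real assume "e > 0"
    then obtain N where N: "\<And>n. n \<ge> N \<Longrightarrow> r ^ n * (K + K) < e"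
      using order_tendstoD(2)[OF rK] by (auto simp: eventually_sequentially)
    have less: "?b (\<lambda>k l. u m k l - u n k l) < e" if "n \<ge> N" "m \<ge> n" for m n
      using est[of n "m - n"] N[OF that(1)] that(2) by simp
    have "?b (\<lambda>k l. u m k l - u n k l) < e" if "n \<ge> N" "m \<ge> N" for m n
      using less[of n m] less[of m n] that jaffard_bound_minus_commute[OF u[of m] u[of n]] by (cases "m \<ge> n") auto
    then show "\<exists>N. \<forall>m\<ge>N. \<forall>n\<ge>N. ?b (\<lambda>k l. u m k l - u n k l) < e" by blast
  qed
  then obtain B where B: "B \<in> jaffard_space X s"
    and lim: "\<And>e. e > 0 \<Longrightarrow> \<exists>N. \<forall>m\<ge>N. ?b (\<lambda>k l. u m k l - B k l) \<le> e" by blast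
  let ?R = "\<lambda>k l. ?I k l + matrix_mult X B T k l"
  have R: "?R \<in> jaffard_space X s" by (intro jaffard_space_add I jaffard_space_mult B T)
  have "?b (\<lambda>k l. B k l - ?R k l) \<le> 0"
  proof (rule field_le_epsilon)
    fix e :: real assume "e > 0"
    then obtain N where N: "\<forall>m\<ge>N. ?b (\<lambda>k l. u m k l - B k l) \<le> e / 2" using lim[of "e / 2"] by auto
    \<comment> \<open>The defect of the fixed point equation at \<open>B\<close> is written through
      the errors of two consecutive iterates.\<close>
    have "(\<lambda>k l. B k l - ?R k l)
        = (\<lambda>k l. matrix_mult X (\<lambda>k l. u N k l - B k l) T k l - (u (Suc N) k l - B k l))"
      by (simp add: u_Suc matrix_mult_diff[OF u B T] algebra_simps)
    then have "?b (\<lambda>k l. B k l - ?R k l)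
        \<le> ?b (matrix_mult X (\<lambda>k l. u N k l - B k l) T) + ?b (\<lambda>k l. u (Suc N) k l - B k l)"
      using jaffard_bound_diff_le[OF jaffard_space_mult[OF jaffard_space_diff[OF u B] T] jaffard_space_diff[OF u B]]
      by simp
    also have "\<dots> \<le> 1 * ?b (\<lambda>k l. u N k l - B k l) + ?b (\<lambda>k l. u (Suc N) k l - B k l)"
      using r by (intro add_right_mono order_trans[OF mult_le[OF jaffard_space_diff[OF u B]]] mult_right_mono) auto
    also have "\<dots> \<le> e"
    proof -
      have "?b (\<lambda>k l. u N k l - B k l) \<le> e / 2" "?b (\<lambda>k l. u (Suc N) k l - B k l) \<le> e / 2"
        using N by auto
      then show ?thesis by simp
    qed
    finally show "?b (\<lambda>k l. B k l - ?R k l) \<le> 0 + e" by simp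
  qed
  then have "?b (\<lambda>k l. B k l - ?R k l) = 0" by (simp add: order_antisym)
  then have zero: "(\<lambda>k l. B k l - ?R k l) = (\<lambda>k l. 0)"
    by (rule jaffard_bound_zero_iff[OF jaffard_space_diff[OF B R], THEN iffD1])
  have fixpoint: "B k l - matrix_mult X B T k l = ?I k l" for k l
    using fun_cong[OF fun_cong[OF zero, of k], of l] by (simp add: algebra_simps)
  have "matrix_mult X B (\<lambda>k l. ?I k l - T k l) = (\<lambda>k l. B k l - matrix_mult X B T k l)"
    by (simp add: matrix_mult_diff(2)[OF I T B] matrix_mult_one[OF B])
  also have "\<dots> = ?I"
    by (simp only: fixpoint)
  finally show ?thesis using B by blast
qed

text \<open>Since \<open>1 - T T = (1 + T) (1 - T)\<close>, the matrix \<open>B (1 + T)\<close> is a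
  left inverse of \<open>1 - T\<close>.\<close>

lemma matrix_square_left_inverse:
  fixes T :: "('d, 'h::complex_hilbert) op_matrix"
  assumes T: "T \<in> jaffard_space X s" and B: "B \<in> jaffard_space X s"
    and inv: "matrix_mult X B (\<lambda>k l. jaffard_one X k l - matrix_mult X T T k l) = jaffard_one X"
  shows "\<exists>B\<in>jaffard_space X s. matrix_mult X B (\<lambda>k l. jaffard_one X k l - T k l) = jaffard_one X"
proof -
  let ?I = "jaffard_one X :: ('d, 'h) op_matrix"
  have I: "?I \<in> jaffard_space X s" by (rule jaffard_space_one)
  let ?S = "\<lambda>k l. ?I k l + T k l" and ?D = "\<lambda>k l. ?I k l - T k l"
  have S: "?S \<in> jaffard_space X s" and D: "?D \<in> jaffard_space X s"
    by (intro jaffard_space_add jaffard_space_diff I T)+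
  have "matrix_mult X ?S ?D = (\<lambda>k l. ?S k l - matrix_mult X ?S T k l)"
    by (simp add: matrix_mult_diff(2)[OF I T S] matrix_mult_one[OF S])
  also have "\<dots> = (\<lambda>k l. ?I k l - matrix_mult X T T k l)"
    by (simp add: matrix_mult_distrib_left[OF I T T] matrix_mult_one[OF T])
  finally have "matrix_mult X (matrix_mult X B ?S) ?D = ?I"
    using inv by (simp add: matrix_mult_assoc[OF B S D])
  then show ?thesis using jaffard_space_mult[OF B S] by blast
qed

text \<open>An entry is read off by feeding in a family supported at \<open>l\<close> and looking at
  coordinate \<open>k\<close>; neither operation increases norms.\<close>

lemma norm_entry_le:
  fixes A :: "('d, 'h::complex_hilbert) op_matrix"
  assumes A: "A \<in> jaffard_space X s" and M: "0 \<le> M"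
    and bound: "\<And>f. f \<in> ell2 X \<Longrightarrow> ell2_norm X (matrix_operator X A f) \<le> M * ell2_norm X f"
  shows "norm (A k l) \<le> M"
proof (cases "l \<in> X")
  case True
  show ?thesis
  proof (rule norm_blinfun_bound[OF M])
    fix x :: 'h
    let ?e = "\<lambda>k. if k = l then x else 0"
    have e: "?e \<in> ell2 X" by (rule ell2_single[OF True])
    have "norm (blinfun_apply (A k l) x) \<le> ell2_norm X (matrix_operator X A ?e)"
      using norm_le_ell2_norm[OF matrix_operator_ell2[OF A e], of k]
      by (simp add: matrix_operator_single[OF True])
    also have "\<dots> \<le> M * norm x"
      using bound[OF e] mult_left_mono[OF ell2_norm_single_le[OF True, of x] M] by linarith
    finally show "norm (blinfun_apply (A k l) x) \<le> M * norm x" .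
  qed
qed (use M jaffard_spaceD(3)[OF A] in auto)

text \<open>The midpoint between \<open>CARD('d) / s\<close> and 1. Hence
  \<open>s * interpolation_exponent\<close> is the midpoint between the dimension and
  \<open>s\<close>, and the corresponding weight is still summable.\<close>

definition interpolation_exponent :: real where
  "interpolation_exponent = (s + real CARD('d)) / (2 * s)"

lemma interpolation_exponent:
  "0 < interpolation_exponent" "interpolation_exponent < 1" "real CARD('d) < s * interpolation_exponent"
  using exponent s_pos by (simp_all add: interpolation_exponent_def field_simps add_pos_nonneg)

text \<open>The interpolated entry bound is inserted for both factors in
  \<open>norm_matrix_mult_le\<close>. The estimate is homogeneous of degree 2, with the share
  \<open>1 - \<theta>\<close> moved from the Jaffard norm to the operator norm.\<close>

lemma jaffard_bound_square_le:
  fixes A :: "('d, 'h::complex_hilbert) op_matrix"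
  defines "\<theta> \<equiv> interpolation_exponent"
  assumes A: "A \<in> jaffard_space X s" and M: "0 \<le> M"
    and bound: "\<And>f. f \<in> ell2 X \<Longrightarrow> ell2_norm X (matrix_operator X A f) \<le> M * ell2_norm X f"
  shows "jaffard_bound X s (matrix_mult X A A)
    \<le> 2 powr s * weight_bound (s * \<theta>) * 2 * jaffard_bound X s A powr (1 + \<theta>) * M powr (1 - \<theta>)"
proof (rule jaffard_bound_leI)
  let ?b = "jaffard_bound X s A"
  define c where "c = ?b powr \<theta> * M powr (1 - \<theta>)"
  note \<theta> = interpolation_exponent[folded \<theta>_def]
  have entry: "norm (A k l) \<le> c * weight (s * \<theta>) k l" for k l
  proof -
    have "norm (A k l) \<le> (?b * weight s k l) powr \<theta> * M powr (1 - \<theta>)"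
      using \<theta> by (intro interpolate_bound jaffard_entry_bound A norm_entry_le[OF A M bound]) auto
    also have "\<dots> = c * weight (s * \<theta>) k l"
      by (simp add: c_def powr_mult weight_powr)
    finally show ?thesis .
  qed
  have b_powr: "?b * ?b powr \<theta> = ?b powr (1 + \<theta>)"
    by (cases "?b = 0") (simp_all add: powr_add)
  show "0 \<le> 2 powr s * weight_bound (s * \<theta>) * 2 * ?b powr (1 + \<theta>) * M powr (1 - \<theta>)"
    using \<theta> by (simp add: weight_bound_nonneg)
  fix k l
  show "matrix_mult X A A k l \<in> bounded_operators" by (rule matrix_mult_bounded_operators[OF A A])
  show "matrix_mult X A A k l = 0" if "k \<notin> X \<or> l \<notin> X" using that by (rule matrix_mult_eq_0[OF A A])
  have "norm (matrix_mult X A A k l) \<le> 2 powr s * weight_bound (s * \<theta>) * (?b * c + c * ?b) * weight s k l"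
    using \<theta> by (intro norm_matrix_mult_le A entry) (simp_all add: c_def)
  also have "?b * c + c * ?b = 2 * (?b * ?b powr \<theta>) * M powr (1 - \<theta>)" by (simp add: c_def)
  finally show "norm (matrix_mult X A A k l)
      \<le> 2 powr s * weight_bound (s * \<theta>) * 2 * ?b powr (1 + \<theta>) * M powr (1 - \<theta>) * weight s k l"
    unfolding b_powr by (simp add: mult_ac)
qed

text \<open>The operator norm of \<open>U n\<close> is at most \<open>q ^ 2 ^ n\<close>, and
  \<open>jaffard_bound_square_le\<close> puts its Jaffard norm into the form required by
  \<open>subquadratic_recursion_tendsto_0\<close>.\<close>

lemma contraction_left_inverse:
  fixes T :: "('d, 'h::complex_hilbert) op_matrix"
  assumes T: "T \<in> jaffard_space X s" and q: "0 < q" "q < 1"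
    and bound: "\<And>f. f \<in> ell2 X \<Longrightarrow> ell2_norm X (matrix_operator X T f) \<le> q * ell2_norm X f"
  shows "\<exists>B\<in>jaffard_space X s. matrix_mult X B (\<lambda>k l. jaffard_one X k l - T k l) = jaffard_one X"
proof -
  define U where "U n = ((\<lambda>A. matrix_mult X A A) ^^ n) T" for n
  have U_0: "U 0 = T" and U_Suc: "U (Suc n) = matrix_mult X (U n) (U n)" for n
    by (simp_all add: U_def)
  have U: "U n \<in> jaffard_space X s" for n
    by (induction n) (simp_all add: U_0 U_Suc T jaffard_space_mult)
  have U_bound: "ell2_norm X (matrix_operator X (U n) f) \<le> q ^ 2 ^ n * ell2_norm X f"
    if "f \<in> ell2 X" for n f
    using that
  proof (induction n arbitrary: f)
    case (Suc n)
    have "ell2_norm X (matrix_operator X (U n) (matrix_operator X (U n) f))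
        \<le> q ^ 2 ^ n * ell2_norm X (matrix_operator X (U n) f)"
      by (rule Suc.IH[OF matrix_operator_ell2[OF U Suc.prems]])
    also have "\<dots> \<le> q ^ 2 ^ n * (q ^ 2 ^ n * ell2_norm X f)"
      using q by (intro mult_left_mono Suc) auto
    finally show ?case
      using Suc.prems
      by (simp add: U_Suc matrix_operator_mult[OF U U] compose_eq mult_2 power_add mult.assoc)
  qed (simp add: U_0 bound)
  \<comment> \<open>The recursion lemma needs a strictly positive constant, but
    \<open>weight_bound\<close> is only known to be nonnegative; hence the
    \<open>+ 1\<close>.\<close>
  define C where "C = 2 powr s * weight_bound (s * interpolation_exponent) * 2 + 1"
  have C: "2 powr s * weight_bound (s * interpolation_exponent) * 2 \<le> C" "0 < C"
    using weight_bound_nonneg[OF interpolation_exponent(3)] by (auto simp: C_def add_nonneg_pos)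
  have "(\<lambda>n. jaffard_bound X s (U n)) \<longlonglongrightarrow> 0"
  proof (rule subquadratic_recursion_tendsto_0[OF _ q interpolation_exponent(1,2) C(2)])
    fix n
    have "jaffard_bound X s (U (Suc n))
      \<le> 2 powr s * weight_bound (s * interpolation_exponent) * 2
        * jaffard_bound X s (U n) powr (1 + interpolation_exponent) * (q ^ 2 ^ n) powr (1 - interpolation_exponent)"
      unfolding U_Suc using q by (intro jaffard_bound_square_le U U_bound) auto
    also have "\<dots> \<le> C * jaffard_bound X s (U n) powr (1 + interpolation_exponent)
        * (q ^ 2 ^ n) powr (1 - interpolation_exponent)"
      by (intro mult_right_mono C) auto
    finally show "jaffard_bound X s (U (Suc n)) \<le> C * jaffard_bound X s (U n) powr (1 + interpolation_exponent)
        * (q ^ 2 ^ n) powr (1 - interpolation_exponent)" .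
  qed simp
  then have "(\<lambda>n. mult_const * jaffard_bound X s (U n)) \<longlonglongrightarrow> mult_const * 0"
    by (rule tendsto_mult_left)
  then have "\<forall>\<^sub>F n in sequentially. mult_const * jaffard_bound X s (U n) < 1"
    by (intro order_tendstoD(2)[where y = "mult_const * 0"]) auto
  then obtain n where "mult_const * jaffard_bound X s (U n) < 1"
    by (auto simp: eventually_sequentially)
  then have "\<exists>B\<in>jaffard_space X s. matrix_mult X B (\<lambda>k l. jaffard_one X k l - U n k l) = jaffard_one X"
    by (rule neumann_left_inverse[OF U])
  \<comment> \<open>Downward along the squarings: a left inverse of \<open>1 - U (Suc n)\<close>
    gives one of \<open>1 - U n\<close>.\<close>
  then show ?thesis
  proof (induction n)
    case (Suc n)
    then obtain B where "B \<in> jaffard_space X s"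
      "matrix_mult X B (\<lambda>k l. jaffard_one X k l - matrix_mult X (U n) (U n) k l) = jaffard_one X"
      by (auto simp: U_Suc)
    then show ?case by (intro Suc.IH matrix_square_left_inverse[OF U])
  qed (simp add: U_0)
qed

text \<open>\<open>A\<^sup>* A\<close> is, up to a scalar, a contraction away from the identity.\<close>

lemma bounded_below_left_inverse:
  fixes A :: "('d, 'h::complex_hilbert) op_matrix"
  assumes A: "A \<in> jaffard_space X s" and c: "0 < c"
    and below: "\<And>f. f \<in> ell2 X \<Longrightarrow> c * ell2_norm X f \<le> ell2_norm X (matrix_operator X A f)"
  shows "\<exists>B\<in>jaffard_space X s. matrix_mult X B A = jaffard_one X"
proof -
  let ?A = "matrix_operator X A" and ?A' = "matrix_operator X (matrix_star A)"
  have A': "matrix_star A \<in> jaffard_space X s" by (rule jaffard_space_star[OF A])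
  define M where "M = max 1 (jaffard_bound X s (matrix_star A) * weight_bound s)"
  have M: "1 \<le> M" by (simp add: M_def)
  have A'_le: "ell2_norm X (?A' g) \<le> M * ell2_norm X g" if "g \<in> ell2 X" for g
    by (rule order_trans[OF ell2_norm_matrix_operator_le[OF A' that]])
       (intro mult_right_mono, simp_all add: M_def)
  \<comment> \<open>With \<open>M\<close> bounding the adjoint, this choice gives
    \<open>norm (\<mu> A\<^sup>* g) ^ 2 \<le> \<mu> * norm g ^ 2\<close>, used below for
    \<open>g = A f\<close>.\<close>
  define \<mu> where "\<mu> = 1 / M\<^sup>2"
  have \<mu>: "0 < \<mu>" "\<mu> * M\<^sup>2 = 1" using M by (auto simp: \<mu>_def)
  \<comment> \<open>The lower bound is weakened to at most \<open>M / 2\<close> so that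
    \<open>\<mu> * d\<^sup>2 \<le> 1 / 4\<close>; the radicand in \<open>q\<close> then stays
    positive.\<close>
  define d where "d = min c (M / 2)"
  have d: "0 < d" "d \<le> c" using c M by (auto simp: d_def)
  have "d\<^sup>2 \<le> (M / 2)\<^sup>2" using d by (intro power_mono) (auto simp: d_def)
  then have "\<mu> * d\<^sup>2 \<le> \<mu> * (M / 2)\<^sup>2" using \<mu> by (intro mult_left_mono) auto
  also have "\<dots> = 1 / 4" using \<mu>(2) by (simp add: power_divide)
  finally have \<mu>d: "\<mu> * d\<^sup>2 \<le> 1 / 4" .
  define q where "q = sqrt (1 - \<mu> * d\<^sup>2)"
  have \<mu>d_pos: "0 < \<mu> * d\<^sup>2" using \<mu> d by simp
  have q: "0 < q" "q < 1" "q\<^sup>2 = 1 - \<mu> * d\<^sup>2" using \<mu>d \<mu>d_pos by (auto simp: q_def)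
  define P where "P = matrix_mult X (matrix_star A) A"
  have P: "P \<in> jaffard_space X s" unfolding P_def by (rule jaffard_space_mult[OF A' A])
  let ?P = "\<lambda>k l. scaleC_operator (complex_of_real \<mu>) (P k l)"
  have \<mu>P: "?P \<in> jaffard_space X s" by (rule jaffard_space_scaleC[OF P])
  define T where "T = (\<lambda>k l. jaffard_one X k l - ?P k l)"
  have T: "T \<in> jaffard_space X s" unfolding T_def by (rule jaffard_space_diff[OF jaffard_space_one \<mu>P])
  have "ell2_norm X (matrix_operator X T f) \<le> q * ell2_norm X f" if f: "f \<in> ell2 X" for f
  proof -
    have Af: "?A f \<in> ell2 X" by (rule matrix_operator_ell2[OF A f])
    have A'Af: "?A' (?A f) \<in> ell2 X" by (rule matrix_operator_ell2[OF A' Af])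
    let ?g = "\<lambda>k. complex_of_real \<mu> *\<^sub>C ?A' (?A f) k"
    have g: "?g \<in> ell2 X" by (rule ell2_scaleC[OF A'Af])
    have Tf: "matrix_operator X T f = (\<lambda>k. f k - ?g k)"
    proof -
      have "matrix_operator X T f = (\<lambda>k. matrix_operator X (jaffard_one X) f k - matrix_operator X ?P f k)"
        unfolding T_def by (rule matrix_operator_diff[OF jaffard_space_one \<mu>P f])
      also have "\<dots> = (\<lambda>k. f k - complex_of_real \<mu> *\<^sub>C matrix_operator X P f k)"
        using f by (simp add: matrix_operator_one matrix_operator_scaleC[OF P])
      also have "matrix_operator X P f = ?A' (?A f)"
        using f by (simp add: P_def matrix_operator_mult[OF A' A] compose_eq)
      finally show ?thesis .
    qed
    have inner_fg: "ell2_inner X f ?g = \<mu> * (ell2_norm X (?A f))\<^sup>2"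
    proof -
      have "ell2_inner X f ?g = \<mu> * ell2_inner X f (?A' (?A f))"
        by (simp add: ell2_inner_def scaleC_of_real infsum_cmult_right')
      then show ?thesis
        by (simp add: ell2_inner_matrix_star[OF A f Af, symmetric] ell2_inner_self)
    qed
    have "(ell2_norm X ?g)\<^sup>2 = \<mu>\<^sup>2 * (ell2_norm X (?A' (?A f)))\<^sup>2"
      using \<mu> by (simp add: ell2_norm_scaleC[OF A'Af] power_mult_distrib)
    also have "\<dots> \<le> \<mu>\<^sup>2 * (M * ell2_norm X (?A f))\<^sup>2"
      by (intro mult_left_mono power_mono A'_le Af) auto
    also have "\<dots> = \<mu> * (\<mu> * M\<^sup>2) * (ell2_norm X (?A f))\<^sup>2"
      by (simp add: power2_eq_square)
    finally have norm_g: "(ell2_norm X ?g)\<^sup>2 \<le> \<mu> * (ell2_norm X (?A f))\<^sup>2" by (simp add: \<mu>(2))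
    have "d * ell2_norm X f \<le> ell2_norm X (?A f)"
      using below[OF f] mult_right_mono[OF d(2), of "ell2_norm X f"] by simp
    then have "(d * ell2_norm X f)\<^sup>2 \<le> (ell2_norm X (?A f))\<^sup>2"
      using d by (intro power_mono) auto
    then have low: "\<mu> * (d * ell2_norm X f)\<^sup>2 \<le> \<mu> * (ell2_norm X (?A f))\<^sup>2"
      using \<mu> by (intro mult_left_mono) auto
    \<comment> \<open>The cross term contributes \<open>- 2 * \<mu>\<close> times the squared norm
      of \<open>A f\<close>, the last square at most \<open>\<mu>\<close> times it; what remains is
      controlled by the lower bound on \<open>A\<close>.\<close>
    have "(ell2_norm X (matrix_operator X T f))\<^sup>2
        = (ell2_norm X f)\<^sup>2 - 2 * ell2_inner X f ?g + (ell2_norm X ?g)\<^sup>2"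
      unfolding Tf by (rule ell2_norm_diff_square[OF f g])
    also have "\<dots> \<le> (ell2_norm X f)\<^sup>2 - \<mu> * (d * ell2_norm X f)\<^sup>2"
      unfolding inner_fg using norm_g low by linarith
    also have "\<dots> = (q * ell2_norm X f)\<^sup>2"
      by (simp only: power_mult_distrib q(3) left_diff_distrib mult_1_left mult.assoc)
    finally show ?thesis by (rule power2_le_imp_le) (use q in simp)
  qed
  then have "\<exists>B\<in>jaffard_space X s. matrix_mult X B (\<lambda>k l. jaffard_one X k l - T k l) = jaffard_one X"
    by (rule contraction_left_inverse[OF T q(1,2)])
  then obtain B where B: "B \<in> jaffard_space X s"
    and inv: "matrix_mult X B (\<lambda>k l. jaffard_one X k l - T k l) = jaffard_one X"
    by blast
  \<comment> \<open>\<open>1 - T\<close> is \<open>\<mu> A\<^sup>* A\<close>, so the scalar and the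
    adjoint can be moved over to the left inverse.\<close>
  have "matrix_mult X B ?P = jaffard_one X" using inv by (simp add: T_def)
  then have "matrix_mult X (\<lambda>k l. scaleC_operator (complex_of_real \<mu>) (B k l)) P = jaffard_one X"
    by (simp add: matrix_mult_scaleC_left[OF B P] matrix_mult_scaleC_right[OF B P])
  then have "matrix_mult X (matrix_mult X (\<lambda>k l. scaleC_operator (complex_of_real \<mu>) (B k l)) (matrix_star A)) A
      = jaffard_one X"
    by (simp add: P_def matrix_mult_assoc[OF jaffard_space_scaleC[OF B] A' A])
  then show ?thesis using jaffard_space_mult[OF jaffard_space_scaleC[OF B] A'] by blast
qed

end

section \<open>Inverse-closedness and symmetry\<close>

context jaffard
begin

text \<open>A numerical range argument. Pairing \<open>z f - A\<^sup>* A f\<close> with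
  \<open>f\<close> gives \<open>Re z\<close> times the squared norm of \<open>f\<close> minus the
  squared norm of \<open>A f\<close>, which settles negative real \<open>z\<close>. Pairing with
  \<open>\<i>\<close> times \<open>f\<close> isolates \<open>Im z\<close> and settles nonreal
  \<open>z\<close>. Cauchy-Schwarz turns either value into a lower bound for the norm.\<close>

lemma shifted_positive_bounded_below:
  fixes A :: "('d, 'h::complex_hilbert) op_matrix"
  defines "P \<equiv> matrix_mult X (matrix_star A) A"
  assumes A: "A \<in> jaffard_space X s" and z: "z \<notin> complex_of_real ` {0..}"
  shows "\<exists>c>0. \<forall>f\<in>ell2 X. c * ell2_norm X f
    \<le> ell2_norm X (matrix_operator X (\<lambda>k l. scaleC_operator z (jaffard_one X k l) - P k l) f)"
proof -
  let ?A = "matrix_operator X A" and ?A' = "matrix_operator X (matrix_star A)"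
  have A': "matrix_star A \<in> jaffard_space X s" by (rule jaffard_space_star[OF A])
  have P: "P \<in> jaffard_space X s" unfolding P_def by (rule jaffard_space_mult[OF A' A])
  define c where "c = (if Im z = 0 then - Re z else \<bar>Im z\<bar>)"
  have "0 < c"
  proof (cases "Im z = 0")
    case True
    then have "z = complex_of_real (Re z)" by (simp add: complex_eq_iff)
    then have "Re z < 0" using z by (metis atLeast_iff image_eqI not_le)
    then show ?thesis using True by (simp add: c_def)
  qed (simp add: c_def)
  moreover have "c * ell2_norm X f \<le> ell2_norm X (matrix_operator X (\<lambda>k l. scaleC_operator z (jaffard_one X k l) - P k l) f)"
    if f: "f \<in> ell2 X" for f
  proof -
    have Af: "?A f \<in> ell2 X" by (rule matrix_operator_ell2[OF A f])
    let ?Pf = "?A' (?A f)"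
    have Pf: "?Pf \<in> ell2 X" by (rule matrix_operator_ell2[OF A' Af])
    have zf: "(\<lambda>k. z *\<^sub>C f k) \<in> ell2 X" and if_: "(\<lambda>k. \<i> *\<^sub>C f k) \<in> ell2 X"
      by (rule ell2_scaleC[OF f])+
    let ?g = "\<lambda>k. z *\<^sub>C f k - ?Pf k"
    have g: "?g \<in> ell2 X" by (rule ell2_diff[OF zf Pf])
    have eq: "matrix_operator X (\<lambda>k l. scaleC_operator z (jaffard_one X k l) - P k l) f = ?g"
    proof -
      have "matrix_operator X (\<lambda>k l. scaleC_operator z (jaffard_one X k l) - P k l) f
          = (\<lambda>k. matrix_operator X (\<lambda>k l. scaleC_operator z (jaffard_one X k l)) f k - matrix_operator X P f k)"
        by (rule matrix_operator_diff[OF jaffard_space_scaleC[OF jaffard_space_one] P f])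
      also have "matrix_operator X P f = ?Pf"
        using f by (simp add: P_def matrix_operator_mult[OF A' A] compose_eq)
      finally show ?thesis
        using f by (simp add: matrix_operator_scaleC[OF jaffard_space_one] matrix_operator_one)
    qed
    have inner_P: "ell2_inner X ?Pf h = ell2_inner X (?A f) (?A h)" if "h \<in> ell2 X" for h
      using ell2_inner_matrix_star[OF A that Af] by (simp add: ell2_inner_commute)
    have re: "ell2_inner X ?g f = Re z * (ell2_norm X f)\<^sup>2 - (ell2_norm X (?A f))\<^sup>2"
      by (simp only: ell2_inner_diff_left[OF zf Pf f] ell2_inner_scaleC_self inner_P[OF f] ell2_inner_self)
    \<comment> \<open>Complex linearity makes the pairing of \<open>A\<^sup>* A f\<close> with
      \<open>\<i>\<close> times \<open>f\<close> equal to that of \<open>A f\<close> with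
      \<open>\<i>\<close> times itself, which is 0.\<close>
    have "?A (\<lambda>k. \<i> *\<^sub>C f k) = (\<lambda>k. \<i> *\<^sub>C ?A f k)"
      by (rule ell2_operatorsD(4)[OF matrix_operator_ell2_operators[OF A] f])
    then have im: "ell2_inner X ?g (\<lambda>k. \<i> *\<^sub>C f k) = Im z * (ell2_norm X f)\<^sup>2"
      by (simp only: ell2_inner_diff_left[OF zf Pf if_] ell2_inner_scaleC_scaleC_i inner_P[OF if_]
          ell2_inner_scaleC_i_self diff_0_right)
    have "c * (ell2_norm X f)\<^sup>2 \<le> ell2_norm X ?g * ell2_norm X f"
    proof (cases "Im z = 0")
      case True
      have "c * (ell2_norm X f)\<^sup>2 \<le> - ell2_inner X ?g f" using True by (simp add: c_def re)
      also have "\<dots> \<le> ell2_norm X ?g * ell2_norm X f"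
        using abs_ell2_inner_le[OF g f] by linarith
      finally show ?thesis .
    next
      case False
      then have "c * (ell2_norm X f)\<^sup>2 = \<bar>ell2_inner X ?g (\<lambda>k. \<i> *\<^sub>C f k)\<bar>"
        by (simp add: c_def im abs_mult)
      also have "\<dots> \<le> ell2_norm X ?g * ell2_norm X f"
        using abs_ell2_inner_le[OF g if_] by (simp add: ell2_norm_scaleC[OF f])
      finally show ?thesis .
    qed
    then show ?thesis
      unfolding eq using ell2_norm_nonneg[of X f]
      by (cases "ell2_norm X f = 0") (auto simp: power2_eq_square mult.assoc[symmetric])
  qed
  ultimately show ?thesis by blast
qed

lemma matrix_star_diff:
  fixes A B :: "('d, 'h::complex_hilbert) op_matrix"
  assumes "A \<in> jaffard_space X s" "B \<in> jaffard_space X s"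
  shows "matrix_star (\<lambda>k l. A k l - B k l) = (\<lambda>k l. matrix_star A k l - matrix_star B k l)"
  using matrix_star_add[OF assms(1) jaffard_space_scaleC[OF assms(2), of "-1"]]
    matrix_star_scaleC[OF assms(2), of "-1"]
  by (simp add: scaleC_operator_minus_one)

text \<open>The admissible \<open>z\<close> are closed under conjugation and \<open>P\<close> is
  self-adjoint. The adjoint of a left inverse at \<open>cnj z\<close> is therefore a right inverse
  at \<open>z\<close>, and it agrees with the left inverse at \<open>z\<close>.\<close>

lemma shifted_positive_invertible:
  fixes A :: "('d, 'h::complex_hilbert) op_matrix"
  defines "P \<equiv> matrix_mult X (matrix_star A) A"
  assumes A: "A \<in> jaffard_space X s" and z: "z \<notin> complex_of_real ` {0..}"
  shows "(\<lambda>k l. scaleC_operator z (jaffard_one X k l) - P k l) \<in> Units (jaffard_algebra X s)"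
proof -
  let ?D = "\<lambda>z k l. scaleC_operator z (jaffard_one X k l) - P k l"
  have A': "matrix_star A \<in> jaffard_space X s" by (rule jaffard_space_star[OF A])
  have P: "P \<in> jaffard_space X s" unfolding P_def by (rule jaffard_space_mult[OF A' A])
  have D: "?D z \<in> jaffard_space X s" for z
    by (rule jaffard_space_diff[OF jaffard_space_scaleC[OF jaffard_space_one] P])
  have left_inverse: "\<exists>B\<in>jaffard_space X s. matrix_mult X B (?D z) = jaffard_one X"
    if "z \<notin> complex_of_real ` {0..}" for z
    using shifted_positive_bounded_below[OF A that] bounded_below_left_inverse[OF D]
    unfolding P_def by blast
  have star_P: "matrix_star P = P"
    by (simp add: P_def matrix_star_mult[OF A' A] matrix_star_star[OF A])
  have star_D: "matrix_star (?D (cnj z)) = ?D z"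
    by (simp add: matrix_star_diff[OF jaffard_space_scaleC[OF jaffard_space_one] P] star_P
        matrix_star_scaleC[OF jaffard_space_one] matrix_star_one)
  obtain B where B: "B \<in> jaffard_space X s" "matrix_mult X B (?D z) = jaffard_one X"
    using left_inverse[OF z] by blast
  have "cnj z \<notin> complex_of_real ` {0..}" using z by (metis complex_cnj_cnj complex_cnj_complex_of_real imageE image_eqI)
  then obtain C where C: "C \<in> jaffard_space X s" "matrix_mult X C (?D (cnj z)) = jaffard_one X"
    using left_inverse by blast
  have C': "matrix_star C \<in> jaffard_space X s" by (rule jaffard_space_star[OF C(1)])
  have right: "matrix_mult X (?D z) (matrix_star C) = jaffard_one X"
    using arg_cong[OF C(2), of matrix_star]
    by (simp only: matrix_star_mult[OF C(1) D] star_D matrix_star_one)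
  have "B = matrix_mult X B (matrix_mult X (?D z) (matrix_star C))"
    by (simp only: right matrix_mult_one[OF B(1)])
  also have "\<dots> = matrix_star C"
    by (simp only: matrix_mult_assoc[OF B(1) D C', symmetric] B(2) matrix_mult_one[OF C'])
  finally show ?thesis
    unfolding Units_def jaffard_algebra_simps using D B C' right by blast
qed

lemma symmetric_banach_algebra_jaffard_algebra:
  "symmetric_banach_algebra (jaffard_algebra X s :: ('d, 'h::complex_hilbert) op_matrix star_algebra)"
proof (intro symmetric_banach_algebra.intro involutive_banach_algebra_jaffard_algebra
    symmetric_banach_algebra_axioms.intro subsetI)
  let ?J = "jaffard_algebra X s :: ('d, 'h) op_matrix star_algebra"
  fix A :: "('d, 'h) op_matrix" and z
  assume "A \<in> carrier ?J" and z: "z \<in> spectrum ?J (star ?J A \<otimes>\<^bsub>?J\<^esub> A)"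
  then have A: "A \<in> jaffard_space X s" by (simp add: jaffard_algebra_simps)
  have P: "matrix_mult X (matrix_star A) A \<in> jaffard_space X s"
    by (rule jaffard_space_mult[OF jaffard_space_star[OF A] A])
  have "(\<lambda>k l. scaleC_operator z (jaffard_one X k l) - matrix_mult X (matrix_star A) A k l) \<notin> Units ?J"
    using z unfolding spectrum_def mem_Collect_eq jaffard_algebra_simps star_jaffard_algebra
      jaffard_algebra_minus[OF jaffard_space_scaleC[OF jaffard_space_one] P] .
  then show "z \<in> complex_of_real ` {0..}" using shifted_positive_invertible[OF A] by blast
qed

text \<open>A bounded inverse on families makes \<open>A\<close> bounded below there, which is all
  that \<open>bounded_below_left_inverse\<close> asks for.\<close>

lemma inverse_closed_in_jaffard_algebra:
  "inverse_closed_in (matrix_operator X)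
    (jaffard_algebra X s :: ('d, 'h::complex_hilbert) op_matrix star_algebra) (ell2_operator_algebra X)"
  unfolding inverse_closed_in_def
proof (intro conjI allI ballI impI unital_banach_algebra_jaffard_algebra
    unital_banach_algebra_ell2_operator_algebra)
  let ?J = "jaffard_algebra X s :: ('d, 'h) op_matrix star_algebra"
  let ?E = "ell2_operator_algebra X :: ((real^'d \<Rightarrow> 'h) \<Rightarrow> (real^'d \<Rightarrow> 'h)) normed_algebra"
  show "matrix_operator X \<in> ring_hom ?J ?E"
    by (rule ring_hom_memI)
       (simp_all add: jaffard_algebra_simps ell2_operator_algebra_simps matrix_operator_ell2_operators
         matrix_operator_hom)
  show "inj_on (matrix_operator X) (carrier ?J)"
    unfolding jaffard_algebra_simps by (rule matrix_operator_inj)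
  fix A :: "('d, 'h) op_matrix" assume "A \<in> carrier ?J"
  then have A: "A \<in> jaffard_space X s" by (simp add: jaffard_algebra_simps)
  show "matrix_operator X (c \<odot>\<^bsub>?J\<^esub> A) = c \<odot>\<^bsub>?E\<^esub> matrix_operator X A" for c
    by (simp add: jaffard_algebra_simps ell2_operator_algebra_simps matrix_operator_scaleC[OF A])
  assume unit: "matrix_operator X A \<in> Units ?E"
  interpret E: monoid ?E using ring_ell2_operator_algebra by (rule ring.is_monoid)
  let ?T = "inv\<^bsub>?E\<^esub> (matrix_operator X A)"
  have T: "?T \<in> ell2_operators X"
    using E.Units_inv_closed[OF unit] by (simp add: ell2_operator_algebra_simps)
  \<comment> \<open>The \<open>+ 1\<close> covers an inverse of norm 0, which occurs in the zero
    algebra.\<close>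
  define c where "c = 1 / (ell2_op_norm X ?T + 1)"
  have pos: "0 < ell2_op_norm X ?T + 1" using ell2_op_norm_nonneg_bdd(2)[OF T] by simp
  then have "0 < c" by (simp add: c_def)
  have "c * ell2_norm X f \<le> ell2_norm X (matrix_operator X A f)" if f: "f \<in> ell2 X" for f
  proof -
    have "?T (matrix_operator X A f) = f"
      using fun_cong[OF E.Units_l_inv[OF unit], of f] f by (simp add: ell2_operator_algebra_simps compose_eq)
    then have "ell2_norm X f \<le> ell2_op_norm X ?T * ell2_norm X (matrix_operator X A f)"
      using ell2_op_norm_bound[OF T matrix_operator_ell2[OF A f]] by simp
    also have "\<dots> \<le> (ell2_op_norm X ?T + 1) * ell2_norm X (matrix_operator X A f)"
      by (intro mult_right_mono) auto
    finally show ?thesis using pos by (simp add: c_def pos_divide_le_eq mult.commute)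
  qed
  then have "\<exists>B\<in>jaffard_space X s. matrix_mult X B A = jaffard_one X"
    by (rule bounded_below_left_inverse[OF A \<open>0 < c\<close>])
  then obtain B where B: "B \<in> jaffard_space X s" "matrix_mult X B A = jaffard_one X" by blast
  have "matrix_operator X B \<otimes>\<^bsub>?E\<^esub> matrix_operator X A = \<one>\<^bsub>?E\<^esub>"
    by (simp add: ell2_operator_algebra_simps matrix_operator_mult[OF B(1) A, symmetric] B(2) matrix_operator_one)
  \<comment> \<open>A left inverse of an invertible element is its inverse, so no right inverse has
    to be built inside the Jaffard algebra.\<close>
  then have "matrix_operator X B = ?T"
    by (rule E.inv_unique)
       (simp_all add: E.Units_r_inv[OF unit] E.Units_inv_closed[OF unit] E.Units_closed[OF unit],
        simp add: ell2_operator_algebra_simps matrix_operator_ell2_operators[OF B(1)])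
  then show "?T \<in> matrix_operator X ` carrier ?J"
    using B(1) by (metis image_eqI jaffard_algebra_simps(1))
qed

end

theorem corollary4p5:
  fixes X :: "(real^'d) set" and s :: real
  assumes "separable_space (euclidean :: 'h::complex_hilbert topology)"
    and "relatively_separated X"
    and "s > real CARD('d)"
  shows "inverse_closed_in (matrix_operator X)
           (jaffard_algebra X s :: ('d, 'h) op_matrix star_algebra)
           (ell2_operator_algebra X)
       \<and> symmetric_banach_algebra (jaffard_algebra X s :: ('d, 'h) op_matrix star_algebra)"
proof -
  interpret jaffard X s using assms(2,3) by (rule jaffard.intro)
  show ?thesis
    by (intro conjI inverse_closed_in_jaffard_algebra symmetric_banach_algebra_jaffard_algebra)
qed

end
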